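(* Let $T>0$ and let $G\colon\mathbb{R}^{2n}\to[0,+\infty)$ be a differentiable G-function with $G^\star$ semi-symplectic. Assume that: (1) $\mathcal{H}\colon[0,T]\times\mathbb{R}^{2n}\to\mathbb{R}$, $(t,u)\mapsto\mathcal{H}(t,u)$, is measurable in $t$, continuously differentiable with respect to $u$, and $\mathcal{H}(t,\cdot)\in\Gamma(\mathbb{R}^{2n})$; (2) there exist $\beta,\gamma\in \mathbf{L}^1([0,T],\mathbb{R})$ and $\Lambda>\lambda>0$ such that $$G(\lambda u)-\beta(t)\le\mathcal{H}(t,u)\le G(\Lambda u)+\gamma(t)\qquad(t\in[0,T],\ u\in\mathbb{R}^{2n}).$$ Then the dual action $$\chi(v)=\int_0^T\frac12\langle J\dot v,v\rangle+\mathcal{H}^\star(t,\dot v)\,dt$$ is Gâteaux differentiable on $\mathbf{W}^1_T\mathbf{L}^{G^\star}([0,T],\mathbb{R}^{2n})\cap\{v: d(\dot v,\mathbf{L}^\infty)<\lambda\}$. Moreover, if $v$ is a critical point of $\chi$ with $d(\dot v,\mathbf{L}^\infty)<\lambda$, then the function $u=\nabla\mathcal{H}^\star(t,\dot v)$ belongs to $\mathbf{W}^1\mathbf{L}^G([0,T],\mathbb{R}^{2n})$, solves $$\dot u=J\nabla\mathcal{H}(t,u),\qquad u(0)=u(T),$$ and the relation $\dot u=J\dot v$ holds.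
   Context: $J=\begin{pmatrix}0&I_n\\-I_n&0\end{pmatrix}$. Gradients of $\mathcal{H}$ and $\mathcal{H}^\star$ are with respect to the second variable. The convex conjugate of $F$ is $F^\star(v)=\sup_u\{\langle u,v\rangle-F(u)\}$; $\mathcal{H}^\star(t,\cdot)$ is the conjugate of $\mathcal{H}(t,\cdot)$. $\Gamma(\mathbb{R}^{m})$ is the set of differentiable, strictly convex $F\colon\mathbb{R}^m\to\mathbb{R}$ with $\lim_{|u|\to\infty}F(u)/|u|=\infty$. A G-function is a convex function $G\colon\mathbb{R}^m\to[0,\infty)$ with $G(u)=0\iff u=0$, $G(-u)=G(u)$, and $\lim_{|u|\to\infty}G(u)/|u|=\infty$; then $G^\star$ is also a G-function. A G-function $F$ on $\mathbb{R}^{2n}$ is semi-symplectic if there are $K>0$, $C\ge0$ with $F^\star(Ju)\le F(Ku)+C$ for all $u$; applied to $F=G^\star$ this reads $G(Ju)\le G^\star(Ku)+C$. $\mathbf{L}^G([0,T],\mathbb{R}^m)$ is the set of measurable $u\colon[0,T]\to\mathbb{R}^m$ with $\int_0^TG(\lambda u)\,dt<\infty$ for some $\lambda>0$, with the Luxemburg norm $\|u\|_{\mathbf{L}^G}=\inf\{\lambda>0:\int_0^TG(u/\lambda)\,dt\le1\}$. $\mathbf{W}^1\mathbf{L}^G$ is the space of absolutely continuous $u\in\mathbf{L}^G$ with $\dot u\in\mathbf{L}^G$, with norm $\|u\|_{\mathbf{L}^G}+\|\dot u\|_{\mathbf{L}^G}$; $\mathbf{W}^1_T\mathbf{L}^G=\{u\in\mathbf{W}^1\mathbf{L}^G:u(0)=u(T)\}$.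 $d(\dot v,\mathbf{L}^\infty)$ is the distance in $\mathbf{L}^{G^\star}([0,T],\mathbb{R}^{2n})$ (Luxemburg norm) from $\dot v$ to $\mathbf{L}^\infty([0,T],\mathbb{R}^{2n})$. A critical point is a $v$ in this set at which the Gâteaux derivative of $\chi$ vanishes in every direction $h\in\mathbf{W}^1_T\mathbf{L}^{G^\star}$. Membership of $u$ in $\mathbf{W}^1\mathbf{L}^G$ is understood up to modification on a null set, and the differential equation holds a.e. *)

theory Defs
  imports "HOL-Analysis.Analysis"
begin

section \<open>Convex analysis\<close>

definition superlinear :: "('a::real_normed_vector \<Rightarrow> real) \<Rightarrow> bool" where
  "superlinear F \<longleftrightarrow> filterlim (\<lambda>u. F u / norm u) at_top at_infinity"

definition strictly_convex :: "('a::real_vector \<Rightarrow> real) \<Rightarrow> bool" where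
  "strictly_convex F \<longleftrightarrow>
     (\<forall>x y. x \<noteq> y \<longrightarrow> (\<forall>s. 0 < s \<and> s < 1 \<longrightarrow>
        F ((1 - s) *\<^sub>R x + s *\<^sub>R y) < (1 - s) * F x + s * F y))"

definition Gamma_class :: "('a::euclidean_space \<Rightarrow> real) set" (\<open>\<Gamma>\<close>) where
  "\<Gamma> = {F. (\<forall>u. F differentiable (at u)) \<and> strictly_convex F \<and> superlinear F}"

definition G_function :: "('a::euclidean_space \<Rightarrow> real) \<Rightarrow> bool" where
  "G_function G \<longleftrightarrow> convex_on UNIV G \<and> (\<forall>u. 0 \<le> G u) \<and> (\<forall>u. G u = 0 \<longleftrightarrow> u = 0) \<and>
     (\<forall>u. G (- u) = G u) \<and> superlinear G"

text \<open>The supremum is taken in the reals. For a continuous superlinear F (G-functions and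
  members of \<open>\<Gamma>\<close> are such) the set is bounded above, so this is the usual conjugate.\<close>
definition convex_conjugate :: "('a::euclidean_space \<Rightarrow> real) \<Rightarrow> 'a \<Rightarrow> real" where
  "convex_conjugate F v = (SUP u. u \<bullet> v - F u)"

definition gradient :: "('a::euclidean_space \<Rightarrow> real) \<Rightarrow> 'a \<Rightarrow> 'a" where
  "gradient F u = (THE D. GDERIV F u :> D)"

section \<open>The symplectic matrix\<close>

text \<open>\<open>\<real>\<^sup>2\<^sup>n\<close> is \<open>\<real>\<^sup>n \<times> \<real>\<^sup>n\<close> with its Euclidean inner product, and the block matrix with rows
  \<open>(0, I)\<close> and \<open>(-I, 0)\<close> acts on the two blocks.\<close>
definition symp_J :: "(real ^ 'n) \<times> (real ^ 'n) \<Rightarrow> (real ^ 'n) \<times> (real ^ 'n)" where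
  "symp_J u = (snd u, - fst u)"

text \<open>Used for G-functions only.\<close>
definition semi_symplectic :: "((real ^ 'n) \<times> (real ^ 'n) \<Rightarrow> real) \<Rightarrow> bool" where
  "semi_symplectic F \<longleftrightarrow>
     (\<exists>K>0. \<exists>C\<ge>0. \<forall>u. convex_conjugate F (symp_J u) \<le> F (K *\<^sub>R u) + C)"

section \<open>Anisotropic Orlicz and Orlicz--Sobolev spaces on \<open>[0, T]\<close>\<close>

text \<open>Elements are functions on the reals of which only the values on \<open>{0..T}\<close> are used; they
  are not quotiented by equality almost everywhere.\<close>

definition Orlicz :: "('a::euclidean_space \<Rightarrow> real) \<Rightarrow> real \<Rightarrow> (real \<Rightarrow> 'a) set" where
  "Orlicz G T = {u \<in> borel_measurable (lebesgue_on {0..T}).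
     \<exists>k>0. (\<integral>\<^sup>+t. ennreal (G (k *\<^sub>R u t)) \<partial>lebesgue_on {0..T}) < \<infinity>}"

definition Luxemburg :: "('a::euclidean_space \<Rightarrow> real) \<Rightarrow> real \<Rightarrow> (real \<Rightarrow> 'a) \<Rightarrow> real" where
  "Luxemburg G T u =
     Inf {k. 0 < k \<and> (\<integral>\<^sup>+t. ennreal (G (u t /\<^sub>R k)) \<partial>lebesgue_on {0..T}) \<le> 1}"

definition L_infinity :: "real \<Rightarrow> (real \<Rightarrow> 'a::euclidean_space) set" where
  "L_infinity T = {u \<in> borel_measurable (lebesgue_on {0..T}).
     \<exists>B. AE t in lebesgue_on {0..T}. norm (u t) \<le> B}"

definition dist_L_infinity ::
    "('a::euclidean_space \<Rightarrow> real) \<Rightarrow> real \<Rightarrow> (real \<Rightarrow> 'a) \<Rightarrow> real" where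
  "dist_L_infinity G T u = (INF w\<in>L_infinity T. Luxemburg G T (\<lambda>t. u t - w t))"

text \<open>A finite family of subintervals is a finite set of pairs of endpoints.\<close>
definition abs_continuous :: "real \<Rightarrow> real \<Rightarrow> (real \<Rightarrow> 'a::real_normed_vector) \<Rightarrow> bool" where
  "abs_continuous a b f \<longleftrightarrow>
     (\<forall>\<epsilon>>0. \<exists>\<delta>>0. \<forall>I :: (real \<times> real) set.
        finite I \<and> (\<forall>(x, y)\<in>I. a \<le> x \<and> x \<le> y \<and> y \<le> b) \<and>
        pairwise (\<lambda>p q. {fst p<..<snd p} \<inter> {fst q<..<snd q} = {}) I \<and>
        (\<Sum>(x, y)\<in>I. y - x) < \<delta>
        \<longrightarrow> (\<Sum>(x, y)\<in>I. norm (f y - f x)) < \<epsilon>)"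

text \<open>The pointwise derivative. For absolutely continuous functions it exists at almost every
  point; elsewhere its value is arbitrary, and it is used only up to null sets.\<close>
definition dot :: "real \<Rightarrow> (real \<Rightarrow> 'a::real_normed_vector) \<Rightarrow> real \<Rightarrow> 'a" where
  "dot T u t = vector_derivative u (at t within {0..T})"

definition W1 :: "('a::euclidean_space \<Rightarrow> real) \<Rightarrow> real \<Rightarrow> (real \<Rightarrow> 'a) set" where
  "W1 G T = {u \<in> Orlicz G T. abs_continuous 0 T u \<and> dot T u \<in> Orlicz G T}"

definition W1_norm :: "('a::euclidean_space \<Rightarrow> real) \<Rightarrow> real \<Rightarrow> (real \<Rightarrow> 'a) \<Rightarrow> real" where
  "W1_norm G T u = Luxemburg G T u + Luxemburg G T (dot T u)"

definition W1_per :: "('a::euclidean_space \<Rightarrow> real) \<Rightarrow> real \<Rightarrow> (real \<Rightarrow> 'a) set" where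
  "W1_per G T = {u \<in> W1 G T. u 0 = u T}"

section \<open>Gateaux derivatives\<close>

text \<open>\<open>D\<close> is the Gateaux derivative of \<open>\<phi>\<close> at \<open>v\<close> in the function space \<open>X\<close> normed by \<open>N\<close>:
  a bounded linear functional on \<open>X\<close> giving all directional derivatives.\<close>
definition has_gateaux_derivative ::
    "((real \<Rightarrow> 'a::real_vector) \<Rightarrow> real) \<Rightarrow> (real \<Rightarrow> 'a) set \<Rightarrow> ((real \<Rightarrow> 'a) \<Rightarrow> real) \<Rightarrow>
     (real \<Rightarrow> 'a) \<Rightarrow> ((real \<Rightarrow> 'a) \<Rightarrow> real) \<Rightarrow> bool" where
  "has_gateaux_derivative \<phi> X N v D \<longleftrightarrow>
     (\<forall>h\<in>X. ((\<lambda>s::real. (\<phi> (\<lambda>t. v t + s *\<^sub>R h t) - \<phi> v) / s) \<longlongrightarrow> D h) (at 0)) \<and>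
     (\<forall>h\<in>X. \<forall>k\<in>X. D (\<lambda>t. h t + k t) = D h + D k) \<and>
     (\<forall>h\<in>X. \<forall>c. D (\<lambda>t. c *\<^sub>R h t) = c * D h) \<and>
     (\<exists>B. \<forall>h\<in>X. \<bar>D h\<bar> \<le> B * N h)"

section \<open>The dual action\<close>

definition dual_integrand ::
    "(real \<Rightarrow> (real ^ 'n) \<times> (real ^ 'n) \<Rightarrow> real) \<Rightarrow> real \<Rightarrow>
     (real \<Rightarrow> (real ^ 'n) \<times> (real ^ 'n)) \<Rightarrow> real \<Rightarrow> real" where
  "dual_integrand H T v t =
     1 / 2 * (symp_J (dot T v t) \<bullet> v t) + convex_conjugate (H t) (dot T v t)"

text \<open>The Bochner integral is 0 for a non-integrable integrand, so finiteness of \<open>\<chi>\<close> has to be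
  stated as integrability of \<open>dual_integrand\<close>.\<close>
definition dual_action ::
    "(real \<Rightarrow> (real ^ 'n) \<times> (real ^ 'n) \<Rightarrow> real) \<Rightarrow> real \<Rightarrow>
     (real \<Rightarrow> (real ^ 'n) \<times> (real ^ 'n)) \<Rightarrow> real" where
  "dual_action H T v = (LINT t|lebesgue_on {0..T}. dual_integrand H T v t)"

definition dual_domain ::
    "((real ^ 'n) \<times> (real ^ 'n) \<Rightarrow> real) \<Rightarrow> real \<Rightarrow> real \<Rightarrow>
     (real \<Rightarrow> (real ^ 'n) \<times> (real ^ 'n)) set" where
  "dual_domain G T r =
     W1_per (convex_conjugate G) T \<inter> {v. dist_L_infinity (convex_conjugate G) T (dot T v) < r}"

definition critical_point ::
    "((real ^ 'n) \<times> (real ^ 'n) \<Rightarrow> real) \<Rightarrow> (real \<Rightarrow> (real ^ 'n) \<times> (real ^ 'n) \<Rightarrow> real) \<Rightarrow>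
     real \<Rightarrow> real \<Rightarrow> (real \<Rightarrow> (real ^ 'n) \<times> (real ^ 'n)) \<Rightarrow> bool" where
  "critical_point G H T r v \<longleftrightarrow> v \<in> dual_domain G T r \<and>
     has_gateaux_derivative (dual_action H T) (W1_per (convex_conjugate G) T)
       (W1_norm (convex_conjugate G) T) v (\<lambda>h. 0)"

end

theory Submission
  imports Defs
begin

text \<open>
  If \<open>d(v', L\<^sup>\<infinity>) < \<lambda>\<close>, then \<open>G\<^sup>*(\<mu> v' / \<lambda>)\<close> is integrable for some \<open>\<mu> > 1\<close>, which leaves room for
  a small multiple of any direction of the Orlicz space; since \<open>H\<^sup>*(t, \<cdot>)\<close> is convex, its difference
  quotients are then dominated by those at the ends of this range. With \<open>p = \<nabla>H\<^sup>*(t, v')\<close>,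
  dominated convergence and an integration by parts in the quadratic term give the Gateaux derivative
  \<open>h \<mapsto> \<integral>(p - J v) \<bullet> h'\<close>. At a critical point du Bois-Reymond's lemma makes \<open>p - J v\<close> equal to a
  constant \<open>c\<close> almost everywhere, so \<open>u = J v + c\<close> is an absolutely continuous representative of \<open>p\<close>,
  and \<open>v' = \<nabla>H(t, u)\<close> because the gradients of \<open>H(t, \<cdot>)\<close> and \<open>H\<^sup>*(t, \<cdot>)\<close> are inverse to each other.

  The fundamental theorem of calculus for an absolutely continuous \<open>f\<close> comes from writing \<open>f\<close> as the
  difference of the monotone functions \<open>V\<close> and \<open>V - f\<close>, with \<open>V\<close> the variation, and applying the
  Radon--Nikodym theorem to their Stieltjes measures.
\<close>

section \<open>Absolutely continuous functions\<close>

text \<open>No Delta_2 condition is imposed on the conjugate \<open>\<Phi>\<close> of G, so for v in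
  the Sobolev space \<open>\<Phi> (v' / lam)\<close> may have infinite integral, while
  \<open>\<Phi> (v' / lam) + \<beta> t\<close> is the bound that the growth of H gives for the
  conjugate Hamiltonian. The distance condition repairs this: up to a bounded function, v' has
  Luxemburg norm below lam, bounded functions have all modulars finite, and convexity leaves a
  factor \<mu> > 1 to spare. The spare factor is spent on h' / k with k admissible for h'; the
  resulting estimate also bounds the derivative by the Luxemburg norm of h'.

  Semi-symplecticity enters at the end. From u' = J v' only integrability of \<open>\<Phi>\<close>
  along v' is known, and the chain \<open>G (J x) \<le> convex_conjugate \<Phi> (J x) \<le> \<Phi>
  (k0 x) + C\<close> carries it to the Orlicz space of G.

  Nonintegrable functions have integral 0, so integrability is proved beside every limit. Since
  \<open>dot\<close> is arbitrary on a null set, identities for it hold almost everywhere and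
  measurability passes through the completeness of Lebesgue measure.\<close>

definition interval_family :: "real \<Rightarrow> real \<Rightarrow> (real \<times> real) set \<Rightarrow> bool" where
  "interval_family a b I \<longleftrightarrow> finite I \<and> (\<forall>(x, y)\<in>I. a \<le> x \<and> x < y \<and> y \<le> b) \<and>
     pairwise (\<lambda>p q. {fst p<..<snd p} \<inter> {fst q<..<snd q} = {}) I"

definition var_sum :: "(real \<Rightarrow> 'a::real_normed_vector) \<Rightarrow> (real \<times> real) set \<Rightarrow> real" where
  "var_sum f I = (\<Sum>(x, y)\<in>I. norm (f y - f x))"

definition total_length :: "(real \<times> real) set \<Rightarrow> real" where
  "total_length I = (\<Sum>(x, y)\<in>I. y - x)"

text \<open>A supremum in the reals, so it is the total variation only where
  \<open>bounded_variation\<close> holds. Estimates of sums by it carry that hypothesis; the empty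
  family keeps the index set nonempty.\<close>

definition variation :: "(real \<Rightarrow> 'a::real_normed_vector) \<Rightarrow> real \<Rightarrow> real \<Rightarrow> real" where
  "variation f a b = (SUP I\<in>{I. interval_family a b I}. var_sum f I)"

lemma interval_family_empty [simp]: "interval_family a b {}"
  by (simp add: interval_family_def)

lemma interval_family_mono:
  "interval_family a b I \<Longrightarrow> a' \<le> a \<Longrightarrow> b \<le> b' \<Longrightarrow> interval_family a' b' I"
  by (fastforce simp: interval_family_def)

lemma abs_continuous_iff:
  "abs_continuous a b f \<longleftrightarrow>
     (\<forall>\<epsilon>>0. \<exists>\<delta>>0. \<forall>I. interval_family a b I \<longrightarrow> total_length I < \<delta> \<longrightarrow> var_sum f I < \<epsilon>)"
proof
  assume L: "abs_continuous a b f"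
  show "\<forall>\<epsilon>>0. \<exists>\<delta>>0. \<forall>I. interval_family a b I \<longrightarrow> total_length I < \<delta> \<longrightarrow> var_sum f I < \<epsilon>"
  proof (intro allI impI)
    fix \<epsilon> :: real assume "\<epsilon> > 0"
    with L obtain \<delta> where d: "\<delta> > 0" and *: "\<And>I. finite I \<and> (\<forall>(x, y)\<in>I. a \<le> x \<and> x \<le> y \<and> y \<le> b) \<and>
        pairwise (\<lambda>p q. {fst p<..<snd p} \<inter> {fst q<..<snd q} = {}) I \<and>
        (\<Sum>(x, y)\<in>I. y - x) < \<delta>
        \<longrightarrow> (\<Sum>(x, y)\<in>I. norm (f y - f x)) < \<epsilon>"
      unfolding abs_continuous_def by blast
    show "\<exists>\<delta>>0. \<forall>I. interval_family a b I \<longrightarrow> total_length I < \<delta> \<longrightarrow> var_sum f I < \<epsilon>"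
      using d * by (intro exI[of _ \<delta>]) (fastforce simp: interval_family_def total_length_def var_sum_def)
  qed
next
  assume R: "\<forall>\<epsilon>>0. \<exists>\<delta>>0. \<forall>I. interval_family a b I \<longrightarrow> total_length I < \<delta> \<longrightarrow> var_sum f I < \<epsilon>"
  show "abs_continuous a b f"
    unfolding abs_continuous_def
  proof (intro allI impI)
    fix \<epsilon> :: real assume "\<epsilon> > 0"
    with R obtain \<delta> where d: "\<delta> > 0"
      and *: "\<And>I. interval_family a b I \<Longrightarrow> total_length I < \<delta> \<Longrightarrow> var_sum f I < \<epsilon>" by metis
    have "(\<Sum>(x, y)\<in>I. norm (f y - f x)) < \<epsilon>"
      if I: "finite I" "\<forall>(x, y)\<in>I. a \<le> x \<and> x \<le> y \<and> y \<le> b"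
        "pairwise (\<lambda>p q. {fst p<..<snd p} \<inter> {fst q<..<snd q} = {}) I"
        "(\<Sum>(x, y)\<in>I. y - x) < \<delta>" for I
    proof -
      define J where "J = {p\<in>I. fst p < snd p}"
      have fam: "interval_family a b J"
        using I by (auto simp: interval_family_def J_def pairwise_def)
      have "(\<Sum>(x, y)\<in>I. y - x) = total_length J"
        unfolding total_length_def using I by (intro sum.mono_neutral_right) (auto simp: J_def)
      moreover have "(\<Sum>(x, y)\<in>I. norm (f y - f x)) = var_sum f J"
        unfolding var_sum_def using I by (intro sum.mono_neutral_right) (force simp: J_def)+
      ultimately show ?thesis using *[OF fam] I by simp
    qed
    then show "\<exists>\<delta>>0. \<forall>I. finite I \<and> (\<forall>(x, y)\<in>I. a \<le> x \<and> x \<le> y \<and> y \<le> b) \<and>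
        pairwise (\<lambda>p q. {fst p<..<snd p} \<inter> {fst q<..<snd q} = {}) I \<and>
        (\<Sum>(x, y)\<in>I. y - x) < \<delta> \<longrightarrow> (\<Sum>(x, y)\<in>I. norm (f y - f x)) < \<epsilon>"
      using d by blast
  qed
qed

text \<open>Reading the length as a Lebesgue measure makes it monotone under inclusion. It is
  compared below with an enclosing interval and with an open set of small measure.\<close>

lemma total_length_eq_measure:
  assumes "interval_family a b I"
  shows "total_length I = measure lborel (\<Union>p\<in>I. {fst p<..<snd p})"
proof -
  have "measure lborel (\<Union>p\<in>I. {fst p<..<snd p}) = (\<Sum>p\<in>I. measure lborel {fst p<..<snd p})"
    using assms by (intro measure_finite_Union)
      (auto simp: interval_family_def disjoint_family_on_def pairwise_def)
  also have "\<dots> = total_length I"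
    unfolding total_length_def using assms
    by (intro sum.cong) (auto simp: interval_family_def measure_lborel_Ioo)
  finally show ?thesis by simp
qed

lemma total_length_le:
  assumes "interval_family a b I" "a \<le> b"
  shows "total_length I \<le> b - a"
proof -
  have "(\<Union>p\<in>I. {fst p<..<snd p}) \<subseteq> {a..b}"
    using assms by (fastforce simp: interval_family_def)
  moreover have "(\<Union>p\<in>I. {fst p<..<snd p}) \<in> sets lborel"
    using assms by (auto simp: interval_family_def)
  ultimately have "measure lborel (\<Union>p\<in>I. {fst p<..<snd p}) \<le> measure lborel {a..b}"
    by (intro measure_mono_fmeasurable fmeasurableI) (auto simp: emeasure_lborel_Icc_eq)
  then show ?thesis using total_length_eq_measure[OF assms(1)] assms(2) by simp
qed

text \<open>Intervals of a family may collapse to the same degenerate interval under a clamping map;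
  such collisions do not contribute to the sum.\<close>
lemma interval_family_image:
  fixes m :: "real \<Rightarrow> real"
  assumes I: "interval_family a b I"
    and m: "\<And>x y. x \<le> y \<Longrightarrow> m x \<le> m y"
    and sub: "\<And>x y. {m x<..<m y} \<subseteq> {x<..<y}"
    and rng: "\<And>x. a \<le> x \<Longrightarrow> x \<le> b \<Longrightarrow> a' \<le> m x \<and> m x \<le> b'"
  obtains J where "interval_family a' b' J"
    "(\<Sum>(x, y)\<in>I. norm (f (m y) - f (m x))) = var_sum f J"
proof
  define h where "h = (\<lambda>p. (m (fst p), m (snd p)))"
  define J where "J = {p\<in>h ` I. fst p < snd p}"
  have disj: "{m x<..<m y} \<inter> {m x'<..<m y'} = {}"
    if "(x,y)\<in>I" "(x',y')\<in>I" "(x,y)\<noteq>(x',y')" for x y x' y'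
  proof -
    have "{x<..<y} \<inter> {x'<..<y'} = {}"
      using I that by (force simp: interval_family_def pairwise_def)
    then show ?thesis using sub[of x y] sub[of x' y'] by blast
  qed
  show "interval_family a' b' J"
    unfolding interval_family_def
  proof (intro conjI)
    show "finite J" using I by (simp add: J_def interval_family_def)
    show "\<forall>(x, y)\<in>J. a' \<le> x \<and> x < y \<and> y \<le> b'"
      using I rng by (fastforce simp: J_def h_def interval_family_def)
    show "pairwise (\<lambda>p q. {fst p<..<snd p} \<inter> {fst q<..<snd q} = {}) J"
      unfolding pairwise_def
    proof (intro ballI impI)
      fix p q assume pq: "p \<in> J" "q \<in> J" "p \<noteq> q"
      then obtain p' q' where "p' \<in> I" "p = h p'" "q' \<in> I" "q = h q'" by (auto simp: J_def)
      with pq disj[of "fst p'" "snd p'" "fst q'" "snd q'"]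
      show "{fst p<..<snd p} \<inter> {fst q<..<snd q} = {}" by (auto simp: h_def)
    qed
  qed
  have "var_sum f J = (\<Sum>(x, y)\<in>h ` I. norm (f y - f x))"
    unfolding var_sum_def
  proof (intro sum.mono_neutral_left)
    show "finite (h ` I)" using I by (simp add: interval_family_def)
    show "\<forall>p\<in>h ` I - J. (case p of (x, y) \<Rightarrow> norm (f y - f x)) = 0"
    proof
      fix p assume "p \<in> h ` I - J"
      then obtain q where q: "q \<in> I" "p = h q" "\<not> fst p < snd p" by (auto simp: J_def)
      moreover have "fst q \<le> snd q" using q I by (auto simp: interval_family_def)
      then have "m (fst q) \<le> m (snd q)" by (rule m)
      ultimately show "(case p of (x, y) \<Rightarrow> norm (f y - f x)) = 0" by (simp add: h_def)
    qed
  qed (auto simp: J_def)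
  also have "\<dots> = sum ((\<lambda>(x, y). norm (f y - f x)) \<circ> h) I"
  proof (rule sum.reindex_nontrivial)
    show "finite I" using I by (simp add: interval_family_def)
    fix p q assume pq: "p \<in> I" "q \<in> I" "p \<noteq> q" "h p = h q"
    with disj[of "fst p" "snd p" "fst q" "snd q"]
    have "{m (fst p)<..<m (snd p)} = {}" by (auto simp: h_def)
    moreover have "fst p \<le> snd p" using pq I by (auto simp: interval_family_def)
    then have "m (fst p) \<le> m (snd p)" by (rule m)
    ultimately have "m (fst p) = m (snd p)" by (simp add: greaterThanLessThan_empty_iff)
    then show "(case h p of (x, y) \<Rightarrow> norm (f y - f x)) = 0" by (simp add: h_def)
  qed
  finally show "(\<Sum>(x, y)\<in>I. norm (f (m y) - f (m x))) = var_sum f J"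
    by (simp add: h_def case_prod_beta o_def)
qed

text \<open>Clamp every endpoint from above and from below at c. The increment of f over an interval
  is the sum of its increments over the two clamped intervals, so the triangle inequality applies
  termwise.\<close>

lemma interval_family_split:
  assumes I: "interval_family a b I" and c: "a \<le> c" "c \<le> b"
  obtains I1 I2 where "interval_family a c I1" "interval_family c b I2"
    "var_sum f I \<le> var_sum f I1 + var_sum f I2"
proof -
  obtain I1 where I1: "interval_family a c I1"
      "(\<Sum>(x, y)\<in>I. norm (f (min y c) - f (min x c))) = var_sum f I1"
    by (rule interval_family_image[OF I, where m="\<lambda>x. min x c" and a'=a and b'=c and f=f]) (use c in auto)
  obtain I2 where I2: "interval_family c b I2"
      "(\<Sum>(x, y)\<in>I. norm (f (max y c) - f (max x c))) = var_sum f I2"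
    by (rule interval_family_image[OF I, where m="\<lambda>x. max x c" and a'=c and b'=b and f=f]) (use c in auto)
  have "norm (f y - f x) \<le> norm (f (min y c) - f (min x c)) + norm (f (max y c) - f (max x c))" for x y
  proof -
    have "f y - f x = (f (min y c) - f (min x c)) + (f (max y c) - f (max x c))"
      by (auto simp: min_def max_def)
    then show ?thesis by (metis norm_triangle_ineq)
  qed
  then have "var_sum f I \<le> (\<Sum>(x, y)\<in>I. norm (f (min y c) - f (min x c)) + norm (f (max y c) - f (max x c)))"
    unfolding var_sum_def by (intro sum_mono) auto
  also have "\<dots> = var_sum f I1 + var_sum f I2"
    by (simp add: I1(2)[symmetric] I2(2)[symmetric] sum.distrib[symmetric] case_prod_beta)
  finally show ?thesis using I1 I2 that by blast
qed

section \<open>Bounded variation and the variation function\<close>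

definition bounded_variation :: "(real \<Rightarrow> 'a::real_normed_vector) \<Rightarrow> real \<Rightarrow> real \<Rightarrow> bool" where
  "bounded_variation f a b \<longleftrightarrow> (\<exists>B. \<forall>I. interval_family a b I \<longrightarrow> var_sum f I \<le> B)"

lemma bounded_variation_subinterval:
  "bounded_variation f a b \<Longrightarrow> a \<le> c \<Longrightarrow> d \<le> b \<Longrightarrow> bounded_variation f c d"
  unfolding bounded_variation_def by (meson interval_family_mono)

lemma abs_continuous_imp_bounded_variation:
  assumes f: "abs_continuous a b f" and "a \<le> b"
  shows "bounded_variation f a b"
proof -
  obtain d0 where d0: "d0 > 0"
    and d0': "\<And>I. interval_family a b I \<Longrightarrow> total_length I < d0 \<Longrightarrow> var_sum f I < 1"
    using f unfolding abs_continuous_iff by (metis zero_less_one)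
  \<comment> \<open>The bisection principle also tests short intervals around a point that stick out
    of the original one, where nothing is known of f. The frame from A to B makes the property
    vacuous for them. An interval shorter than \<open>d0\<close> has sums at most 1, and gluing adds
    the bounds.\<close>
  have "A \<le> a \<and> b \<le> B \<longrightarrow> bounded_variation f a b"
    if *: "\<And>I. interval_family A B I \<Longrightarrow> total_length I < d0 \<Longrightarrow> var_sum f I < 1" for A B
    using \<open>a \<le> b\<close>
  proof (induction rule: Bolzano)
    case (trans c d e)
    show ?case
    proof
      assume "A \<le> c \<and> e \<le> B"
      with trans obtain B1 B2 where B: "\<And>I. interval_family c d I \<Longrightarrow> var_sum f I \<le> B1"
          "\<And>I. interval_family d e I \<Longrightarrow> var_sum f I \<le> B2"
        unfolding bounded_variation_def by force
      have "var_sum f I \<le> B1 + B2" if I: "interval_family c e I" for I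
      proof -
        obtain I1 I2 where "interval_family c d I1" "interval_family d e I2"
            "var_sum f I \<le> var_sum f I1 + var_sum f I2"
          by (rule interval_family_split[OF I, of d f]) (use trans in auto)
        then show ?thesis using B by fastforce
      qed
      then show "bounded_variation f c e" unfolding bounded_variation_def by blast
    qed
  next
    case (local x)
    have "bounded_variation f c d" if "c \<le> x" "x \<le> d" "d - c < d0" "A \<le> c" "d \<le> B" for c d
      unfolding bounded_variation_def
    proof (intro exI[of _ 1] allI impI)
      fix I assume I: "interval_family c d I"
      then have "total_length I \<le> d - c" by (rule total_length_le) (use that in simp)
      then show "var_sum f I \<le> 1"
        using *[OF interval_family_mono[OF I]] that by fastforce
    qed
    then show ?case using d0 by blast
  qed
  from this[OF d0'] show ?thesis by simp
qed

lemma bdd_above_var_sum: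
  "bounded_variation f a b \<Longrightarrow> bdd_above (var_sum f ` {I. interval_family a b I})"
  unfolding bounded_variation_def bdd_above_def by blast

lemma var_sum_le_variation:
  "bounded_variation f a b \<Longrightarrow> interval_family a b I \<Longrightarrow> var_sum f I \<le> variation f a b"
  unfolding variation_def by (intro cSUP_upper bdd_above_var_sum) auto

lemma variation_least:
  "(\<And>I. interval_family a b I \<Longrightarrow> var_sum f I \<le> B) \<Longrightarrow> variation f a b \<le> B"
  unfolding variation_def by (intro cSUP_least) (use interval_family_empty in blast, auto)

lemma variation_triangle:
  assumes "bounded_variation f a b" "a \<le> c" "c \<le> b"
  shows "variation f a b \<le> variation f a c + variation f c b"
proof (rule variation_least)
  fix I assume "interval_family a b I"
  from interval_family_split[OF this assms(2,3), of f]
  obtain I1 I2 where "interval_family a c I1" "interval_family c b I2"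
    "var_sum f I \<le> var_sum f I1 + var_sum f I2" .
  then show "var_sum f I \<le> variation f a c + variation f c b"
    using assms var_sum_le_variation bounded_variation_subinterval
    by (smt (verit, best))
qed

text \<open>Append the interval from c to b to any family on the left part. For real f this one
  inequality makes both V and V - f monotone.\<close>

lemma variation_increase:
  assumes "bounded_variation f a b" "a \<le> c" "c \<le> b"
  shows "variation f a c + norm (f b - f c) \<le> variation f a b"
proof (cases "c = b")
  case False
  have "variation f a c \<le> variation f a b - norm (f b - f c)"
  proof (rule variation_least)
    fix I assume I: "interval_family a c I"
    have *: "(c, b) \<notin> I" using I False assms by (auto simp: interval_family_def)
    have "interval_family a b (insert (c, b) I)"
      using I False assms unfolding interval_family_def
      by (fastforce simp: pairwise_insert)
    from var_sum_le_variation[OF assms(1) this]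
    show "var_sum f I \<le> variation f a b - norm (f b - f c)"
      using I * by (simp add: var_sum_def interval_family_def)
  qed
  then show ?thesis by simp
qed simp

text \<open>Replace each interval of a short family by a nearly optimal family inside it. The union
  is still short, so the absolute continuity of f bounds its sum by half of \<epsilon>; the defects
  from near optimality make up the other half.\<close>

lemma abs_continuous_variation:
  assumes f: "abs_continuous a b f" and "a \<le> b"
  shows "abs_continuous a b (variation f a)"
  unfolding abs_continuous_iff
proof (intro allI impI)
  fix \<epsilon> :: real assume e: "\<epsilon> > 0"
  then obtain \<delta> where d: "\<delta> > 0"
    and *: "\<And>I. interval_family a b I \<Longrightarrow> total_length I < \<delta> \<Longrightarrow> var_sum f I < \<epsilon>/2"
    using f unfolding abs_continuous_iff by (metis half_gt_zero)
  have bv: "bounded_variation f c d" if "a \<le> c" "d \<le> b" for c d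
    using abs_continuous_imp_bounded_variation[OF f \<open>a \<le> b\<close>] bounded_variation_subinterval that by blast
  have "var_sum (variation f a) J < \<epsilon>" if J: "interval_family a b J" and l: "total_length J < \<delta>" for J
  proof -
    \<comment> \<open>The total defect is \<open>card J * \<eta>\<close>, at most half of
      \<epsilon>; the added 1 covers the empty family.\<close>
    define \<eta> where "\<eta> = \<epsilon> / 2 / (card J + 1)"
    have \<eta>: "\<eta> > 0" using e by (simp add: \<eta>_def)
    have "\<exists>I. interval_family (fst p) (snd p) I \<and> variation f (fst p) (snd p) - \<eta> < var_sum f I"
      if "p \<in> J" for p
    proof (rule ccontr)
      assume "\<not> ?thesis"
      then have "variation f (fst p) (snd p) \<le> variation f (fst p) (snd p) - \<eta>"
        by (intro variation_least) force
      with \<eta> show False by simp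
    qed
    then obtain I where I: "\<And>p. p \<in> J \<Longrightarrow> interval_family (fst p) (snd p) (I p)"
      and Iv: "\<And>p. p \<in> J \<Longrightarrow> variation f (fst p) (snd p) - \<eta> < var_sum f (I p)"
      by metis
    have fin: "finite J" "\<And>p. p \<in> J \<Longrightarrow> finite (I p)"
      using J I by (auto simp: interval_family_def)
    have bnd: "fst p \<le> fst r \<and> fst r < snd r \<and> snd r \<le> snd p" if "p \<in> J" "r \<in> I p" for p r
      using I[OF that(1)] that(2) by (auto simp: interval_family_def)
    have disj0: "{fst r<..<snd r} \<inter> {fst s<..<snd s} = {}"
      if "p \<in> J" "q \<in> J" "p \<noteq> q" "r \<in> I p" "s \<in> I q" for p q r s
    proof -
      have "{fst p<..<snd p} \<inter> {fst q<..<snd q} = {}"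
        using J that by (auto simp: interval_family_def pairwise_def)
      then show ?thesis using bnd[OF that(1,4)] bnd[OF that(2,5)] by fastforce
    qed
    have disj: "I p \<inter> I q = {}" if "p \<in> J" "q \<in> J" "p \<noteq> q" for p q
    proof (rule ccontr)
      assume "I p \<inter> I q \<noteq> {}"
      then obtain r where r: "r \<in> I p" "r \<in> I q" by blast
      from disj0[OF that r] bnd[OF that(1) r(1)] show False
        by (simp add: greaterThanLessThan_empty_iff)
    qed
    define K where "K = (\<Union>p\<in>J. I p)"
    have K: "interval_family a b K"
      unfolding interval_family_def
    proof (intro conjI)
      show "finite K" using fin by (auto simp: K_def)
      show "\<forall>(x, y)\<in>K. a \<le> x \<and> x < y \<and> y \<le> b"
        using bnd J by (fastforce simp: K_def interval_family_def)
      show "pairwise (\<lambda>p q. {fst p<..<snd p} \<inter> {fst q<..<snd q} = {}) K"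
        unfolding pairwise_def
      proof (intro ballI impI)
        fix r s assume rs: "r \<in> K" "s \<in> K" "r \<noteq> s"
        then obtain p q where pq: "p \<in> J" "r \<in> I p" "q \<in> J" "s \<in> I q" by (auto simp: K_def)
        show "{fst r<..<snd r} \<inter> {fst s<..<snd s} = {}"
        proof (cases "p = q")
          case True
          then show ?thesis using I[OF pq(1)] pq rs by (auto simp: interval_family_def pairwise_def)
        qed (use disj0 pq in blast)
      qed
    qed
    have "total_length K = (\<Sum>p\<in>J. total_length (I p))"
      unfolding total_length_def K_def using fin disj by (intro sum.UNION_disjoint) auto
    also have "\<dots> \<le> (\<Sum>p\<in>J. snd p - fst p)"
      using total_length_le[OF I] J by (intro sum_mono) (fastforce simp: interval_family_def)
    finally have "var_sum f K < \<epsilon>/2"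
      using * K l by (simp add: total_length_def case_prod_beta)
    moreover have "var_sum f K = (\<Sum>p\<in>J. var_sum f (I p))"
      unfolding var_sum_def K_def using fin disj by (intro sum.UNION_disjoint) auto
    moreover have "var_sum (variation f a) J \<le> (\<Sum>p\<in>J. var_sum f (I p) + \<eta>)"
      unfolding var_sum_def[of "variation f a"] case_prod_beta
    proof (rule sum_mono)
      fix p assume p: "p \<in> J"
      then have ab: "a \<le> fst p" "fst p < snd p" "snd p \<le> b" using J by (auto simp: interval_family_def)
      have "variation f a (snd p) \<le> variation f a (fst p) + variation f (fst p) (snd p)"
        using variation_triangle[OF bv, of a "snd p" "fst p"] ab by simp
      moreover have "variation f a (fst p) \<le> variation f a (snd p)"
        using variation_increase[OF bv, of a "snd p" "fst p"] ab by (smt (verit) norm_ge_zero)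
      ultimately show "norm (variation f a (snd p) - variation f a (fst p)) \<le> var_sum f (I p) + \<eta>"
        using Iv[OF p] by simp
    qed
    moreover have "(\<Sum>p\<in>J. var_sum f (I p) + \<eta>) = (\<Sum>p\<in>J. var_sum f (I p)) + card J * \<eta>"
      by (simp add: sum.distrib)
    moreover have "card J * \<eta> \<le> \<epsilon> / 2"
      using e by (simp add: \<eta>_def field_simps)
    ultimately show ?thesis by linarith
  qed
  then show "\<exists>\<delta>>0. \<forall>I. interval_family a b I \<longrightarrow> total_length I < \<delta> \<longrightarrow> var_sum (variation f a) I < \<epsilon>"
    using d by blast
qed

text \<open>Enclose N in an open U of Lebesgue measure below \<delta> and cover its part in the
  interval by countably many nonoverlapping closed intervals inside U. Finitely many of them form a
  family of length below \<delta>, so their Stieltjes measure is at most \<epsilon>; continuity from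
  below extends this to the whole cover.\<close>

lemma interval_measure_null_if_abs_continuous:
  fixes F :: "real \<Rightarrow> real"
  assumes ab: "a < b" and mono: "\<And>x y. x \<le> y \<Longrightarrow> F x \<le> F y" and cont: "continuous_on UNIV F"
    and ac: "abs_continuous a b F" and N: "N \<in> null_sets lborel"
  shows "emeasure (interval_measure F) (N \<inter> {a..b}) = 0"
proof -
  let ?\<mu> = "interval_measure F"
  have "emeasure ?\<mu> (N \<inter> {a..b}) \<le> ennreal \<epsilon>" if e: "\<epsilon> > 0" for \<epsilon> :: real
  proof -
    obtain \<delta> where d: "\<delta> > 0"
      and *: "\<And>I. interval_family a b I \<Longrightarrow> total_length I < \<delta> \<Longrightarrow> var_sum F I < \<epsilon>"
      using ac e unfolding abs_continuous_iff by metis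
    have Nb: "N \<in> sets borel" using N by auto
    obtain U where U: "open U" "N \<subseteq> U" "emeasure lborel (U - N) < \<delta>"
      using outer_regular_lborel[OF Nb d] by blast
    have "emeasure lborel U = emeasure lborel (U - N)"
      using N U(1) by (subst emeasure_Diff_null_set) auto
    with U have Ud: "emeasure lborel U < \<delta>" by simp
    \<comment> \<open>A gauge needs a neighbourhood at every point. Each covering interval is
      controlled at a point of N, which lies in U, so it is contained in U.\<close>
    have gU: "gauge (\<lambda>x. if x \<in> U then U else UNIV)"
      using U(1) by (auto simp: gauge_def)
    have sub: "N \<inter> {a..b} \<subseteq> cbox a b" and ne: "box a b \<noteq> {}" using ab by auto
    obtain \<D> where D: "countable \<D>" "\<Union>\<D> \<subseteq> cbox a b"
        "\<And>K. K \<in> \<D> \<Longrightarrow> interior K \<noteq> {} \<and> (\<exists>c d. K = cbox c d)"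
        "pairwise (\<lambda>A B. interior A \<inter> interior B = {}) \<D>"
        "\<And>K. K \<in> \<D> \<Longrightarrow> \<exists>x \<in> (N \<inter> {a..b}) \<inter> K. K \<subseteq> (if x \<in> U then U else UNIV)"
        "N \<inter> {a..b} \<subseteq> \<Union>\<D>"
      by (rule covering_lemma[OF sub ne gU]) blast
    have KU: "K \<subseteq> U" if "K \<in> \<D>" for K using D(5)[OF that] U(2) by (auto split: if_splits)
    have K: "K = {Inf K..Sup K} \<and> Inf K < Sup K \<and> a \<le> Inf K \<and> Sup K \<le> b" if KD: "K \<in> \<D>" for K
    proof -
      obtain c d where cd: "K = {c..d}" "c < d"
        using D(3)[OF KD] by (auto simp: interior_atLeastAtMost_real)
      moreover have "{c..d} \<subseteq> {a..b}"
        using order_trans[OF Sup_upper[OF KD] D(2)] cd(1) by simp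
      then have "a \<le> c" "d \<le> b" using cd(2) by (simp_all add: atLeastatMost_subset_iff)
      ultimately show ?thesis by simp
    qed
    have Ks: "K \<in> sets ?\<mu>" if "K \<in> \<D>" for K using D(3)[OF that] by auto
    have fin: "emeasure ?\<mu> (\<Union>\<F>) \<le> ennreal \<epsilon>" if F: "finite \<F>" "\<F> \<subseteq> \<D>" for \<F>
    proof -
      define I where "I = (\<lambda>K. (Inf K, Sup K)) ` \<F>"
      have inj: "inj_on (\<lambda>K. (Inf K, Sup K)) \<F>"
        using K F(2) by (intro inj_onI) (metis Pair_inject subsetD)
      have int: "interior K = {Inf K<..<Sup K}" if "K \<in> \<F>" for K
        using K[of K] F(2) that by (metis interior_atLeastAtMost_real subsetD)
      have I: "interval_family a b I"
        unfolding interval_family_def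
      proof (intro conjI)
        show "finite I" using F by (simp add: I_def)
        show "\<forall>(x, y)\<in>I. a \<le> x \<and> x < y \<and> y \<le> b" using K F(2) by (auto simp: I_def)
        show "pairwise (\<lambda>p q. {fst p<..<snd p} \<inter> {fst q<..<snd q} = {}) I"
          unfolding pairwise_def
        proof (intro ballI impI)
          fix p q assume "p \<in> I" "q \<in> I" "p \<noteq> q"
          then obtain K L where KL: "K \<in> \<F>" "L \<in> \<F>" "K \<noteq> L" "p = (Inf K, Sup K)" "q = (Inf L, Sup L)"
            by (auto simp: I_def)
          then have "interior K \<inter> interior L = {}" using D(4) F(2) by (meson pairwiseD subsetD)
          then show "{fst p<..<snd p} \<inter> {fst q<..<snd q} = {}"
            by (simp only: KL(4,5) int[OF KL(1)] int[OF KL(2)] fst_conv snd_conv)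
        qed
      qed
      have "(\<Union>p\<in>I. {fst p<..<snd p}) \<subseteq> U"
      proof -
        have "{Inf K<..<Sup K} \<subseteq> U" if "K \<in> \<F>" for K
          using KU[of K] int[OF that] interior_subset[of K] F(2) that by auto
        then show ?thesis by (auto simp: I_def)
      qed
      then have "emeasure lborel (\<Union>p\<in>I. {fst p<..<snd p}) \<le> emeasure lborel U"
        using U(1) by (intro emeasure_mono) auto
      with Ud have lt: "emeasure lborel (\<Union>p\<in>I. {fst p<..<snd p}) < ennreal \<delta>" by simp
      then have "ennreal (measure lborel (\<Union>p\<in>I. {fst p<..<snd p})) < ennreal \<delta>"
        by (subst emeasure_eq_ennreal_measure[symmetric]) auto
      then have "measure lborel (\<Union>p\<in>I. {fst p<..<snd p}) < \<delta>"
        by (simp add: ennreal_less_iff)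
      then have v: "var_sum F I < \<epsilon>" using * I total_length_eq_measure[OF I] by simp
      \<comment> \<open>The closed intervals may share endpoints, hence subadditivity. Continuity of
        F rules out atoms, so the measure of a closed interval is the increment of F.\<close>
      have "emeasure ?\<mu> (\<Union>\<F>) \<le> (\<Sum>K\<in>\<F>. emeasure ?\<mu> K)"
      proof -
        have "emeasure ?\<mu> (\<Union>((\<lambda>K. K) ` \<F>)) \<le> (\<Sum>K\<in>\<F>. emeasure ?\<mu> K)"
          using F Ks by (intro emeasure_subadditive_finite) auto
        then show ?thesis by simp
      qed
      also have "\<dots> = (\<Sum>K\<in>\<F>. ennreal (norm (F (Sup K) - F (Inf K))))"
      proof (rule sum.cong[OF refl])
        fix K' assume "K' \<in> \<F>"
        then have k: "K' = {Inf K'..Sup K'}" "Inf K' < Sup K'" using K F(2) by blast+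
        have "emeasure ?\<mu> {Inf K'..Sup K'} = ennreal (F (Sup K') - F (Inf K'))"
          using k(2) by (intro emeasure_interval_measure_Icc mono cont) auto
        then show "emeasure ?\<mu> K' = ennreal (norm (F (Sup K') - F (Inf K')))"
          using k mono[of "Inf K'" "Sup K'"] by auto
      qed
      also have "\<dots> = ennreal (var_sum F I)"
        unfolding var_sum_def I_def by (subst sum.reindex[OF inj]) (simp add: sum_ennreal o_def)
      also have "\<dots> \<le> ennreal \<epsilon>" using v by (simp add: ennreal_leI)
      finally show ?thesis .
    qed
    show ?thesis
    proof (cases "\<D> = {}")
      case True
      with D(6) show ?thesis by simp
    next
      case False
      define A where "A = (\<lambda>n::nat. \<Union>(from_nat_into \<D> ` {..n}))"
      have An: "A n \<in> sets ?\<mu>" for n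
        unfolding A_def using Ks from_nat_into[OF False] by (intro sets.finite_UN) auto
      have "N \<inter> {a..b} \<subseteq> (\<Union>n. A n)"
      proof
        fix x assume "x \<in> N \<inter> {a..b}"
        with D(6) obtain K where "K \<in> \<D>" "x \<in> K" by blast
        moreover then obtain n where "from_nat_into \<D> n = K"
          using from_nat_into_surj[OF D(1)] by blast
        ultimately show "x \<in> (\<Union>n. A n)" unfolding A_def by blast
      qed
      then have "emeasure ?\<mu> (N \<inter> {a..b}) \<le> emeasure ?\<mu> (\<Union>n. A n)"
        using An by (intro emeasure_mono) auto
      also have "\<dots> = (SUP n. emeasure ?\<mu> (A n))"
        using An by (intro SUP_emeasure_incseq[symmetric]) (auto simp: incseq_def A_def intro: order_trans)
      also have "\<dots> \<le> ennreal \<epsilon>"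
        unfolding A_def using from_nat_into[OF False] by (intro SUP_least fin) auto
      finally show ?thesis .
    qed
  qed
  then show ?thesis
    by (metis ennreal_le_epsilon add_0 le_zero_eq)
qed

lemma abs_continuous_imp_continuous_on:
  assumes "abs_continuous a b f"
  shows "continuous_on {a..b} f"
  unfolding continuous_on_iff
proof (intro ballI allI impI)
  fix x e :: real assume x: "x \<in> {a..b}" and "0 < e"
  then obtain d where d: "d > 0"
    and *: "\<And>I. interval_family a b I \<Longrightarrow> total_length I < d \<Longrightarrow> var_sum f I < e"
    using assms unfolding abs_continuous_iff by metis
  have "dist (f y) (f x) < e" if y: "y \<in> {a..b}" "dist y x < d" for y
  proof (cases "x = y")
    case False
    define I where "I = {(min x y, max x y)}"
    have "interval_family a b I" using x y False by (auto simp: I_def interval_family_def)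
    moreover have "total_length I < d" using y by (auto simp: I_def total_length_def dist_real_def)
    ultimately have "var_sum f I < e" using * by blast
    then show ?thesis by (auto simp: I_def var_sum_def dist_norm min_def max_def norm_minus_commute split: if_splits)
  qed (use \<open>0 < e\<close> in simp)
  then show "\<exists>d>0. \<forall>x'\<in>{a..b}. dist x' x < d \<longrightarrow> dist (f x') (f x) < e" using d by blast
qed

lemma abs_continuous_cong:
  assumes "\<And>x. x \<in> {a..b} \<Longrightarrow> f x = g x" "abs_continuous a b f"
  shows "abs_continuous a b g"
proof -
  have "var_sum f I = var_sum g I" if "interval_family a b I" for I
    using that assms(1) unfolding var_sum_def interval_family_def by (intro sum.cong[OF refl]) fastforce
  then show ?thesis using assms(2) unfolding abs_continuous_iff by (metis (full_types))
qed

lemma mono_abs_continuous_density: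
  fixes F :: "real \<Rightarrow> real"
  assumes ab: "a < b" and mono: "\<And>x y. a \<le> x \<Longrightarrow> x \<le> y \<Longrightarrow> y \<le> b \<Longrightarrow> F x \<le> F y"
    and ac: "abs_continuous a b F"
  obtains g where "g absolutely_integrable_on {a..b}"
    "\<And>x. x \<in> {a..b} \<Longrightarrow> (g has_integral (F x - F a)) {a..x}"
proof -
  \<comment> \<open>Clamping extends F to a monotone continuous function on the line, as the
    Stieltjes construction requires. It is constant outside the interval, so both outer half-lines
    are null for its measure.\<close>
  define F' where "F' = (\<lambda>x. F (max a (min b x)))"
  have mono': "F' x \<le> F' y" if "x \<le> y" for x y
    unfolding F'_def using that ab by (intro mono) auto
  have cont': "continuous_on UNIV F'"
    unfolding F'_def using ab
    by (intro continuous_on_compose2[OF abs_continuous_imp_continuous_on[OF ac]] continuous_intros) auto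
  have ac': "abs_continuous a b F'"
    by (rule abs_continuous_cong[OF _ ac]) (auto simp: F'_def)
  define \<mu> where "\<mu> = interval_measure F'"
  have Ioc: "emeasure \<mu> {c<..d} = F' d - F' c" if "c \<le> d" for c d
    unfolding \<mu>_def using cont'
    by (intro emeasure_interval_measure_Ioc that mono')
       (auto simp: continuous_on_eq_continuous_within intro: continuous_within_subset)
  have sets[measurable_cong]: "sets \<mu> = sets borel" by (simp add: \<mu>_def)
  have left: "{..a} \<in> null_sets \<mu>"
  proof -
    have "(\<Union>n::nat. {a - n<..a}) \<in> null_sets \<mu>"
      using ab by (intro null_sets_UN null_setsI) (auto simp: Ioc F'_def sets)
    moreover have "{..a} = (\<Union>n::nat. {a - n<..a})"
    proof -
      have "\<exists>n::nat. a - real n < x" for x using reals_Archimedean2[of "a - x"] by (auto simp: algebra_simps)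
      then show ?thesis by auto
    qed
    ultimately show ?thesis by simp
  qed
  have right: "{b<..} \<in> null_sets \<mu>"
  proof -
    have "(\<Union>n::nat. {b<..b + n}) \<in> null_sets \<mu>"
      using ab by (intro null_sets_UN null_setsI) (auto simp: Ioc F'_def sets)
    moreover have "{b<..} = (\<Union>n::nat. {b<..b + n})"
    proof -
      have "\<exists>n::nat. x \<le> b + real n" for x using real_arch_simple[of "x - b"] by (auto simp: algebra_simps)
      then show ?thesis by auto
    qed
    ultimately show ?thesis by simp
  qed
  have "absolutely_continuous lborel \<mu>"
    unfolding absolutely_continuous_def
  proof
    fix N assume N: "N \<in> null_sets (lborel :: real measure)"
    have "N \<inter> {a..b} \<in> null_sets \<mu>"
      using interval_measure_null_if_abs_continuous[OF ab mono' cont' ac' N] N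
      by (intro null_setsI) (auto simp: \<mu>_def)
    with left right have "N \<inter> {a..b} \<union> {..a} \<union> {b<..} \<in> null_sets \<mu>" by (intro null_sets.Un)
    moreover have "N \<subseteq> N \<inter> {a..b} \<union> {..a} \<union> {b<..}" by force
    moreover have "N \<in> sets \<mu>" using N by (simp add: sets null_sets_def)
    ultimately show "N \<in> null_sets \<mu>" by (metis null_sets_subset)
  qed
  from sigma_finite_measure.Radon_Nikodym[OF sigma_finite_lborel this] sets
  obtain g0 where g0[measurable]: "g0 \<in> borel_measurable lborel" and dens: "density lborel g0 = \<mu>" by auto
  define g where "g = (\<lambda>x. enn2real (g0 x))"
  have gm[measurable]: "g \<in> borel_measurable borel" unfolding g_def using g0 by measurable
  have int: "(g has_integral (F x - F a)) {a..x}" if x: "x \<in> {a..b}" for x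
  proof -
    have "emeasure \<mu> {a<..x} = F x - F a" using Ioc[of a x] x ab by (simp add: F'_def)
    moreover have "emeasure \<mu> {a<..x} = (\<integral>\<^sup>+t. g0 t * indicator {a<..x} t \<partial>lborel)"
      unfolding dens[symmetric] by (intro emeasure_density) auto
    ultimately have i: "(\<integral>\<^sup>+t. g0 t * indicator {a<..x} t \<partial>lborel) = ennreal (F x - F a)" by simp
    \<comment> \<open>The density is extended-real and \<open>enn2real\<close> sends \<infinity> to
      0. Finiteness of the measure of the interval confines that value to a null set, so the
      integral is unchanged.\<close>
    have "AE t in lborel. g0 t * indicator {a<..x} t \<noteq> \<infinity>"
      by (rule nn_integral_PInf_AE) (auto simp: i)
    then have "(\<integral>\<^sup>+t. ennreal (g t * indicator {a<..x} t) \<partial>lborel) = (\<integral>\<^sup>+t. g0 t * indicator {a<..x} t \<partial>lborel)"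
      by (intro nn_integral_cong_AE, elim AE_mp)
        (auto simp: g_def indicator_def less_top[symmetric])
    with i have "(\<integral>\<^sup>+t. ennreal (g t * indicator {a<..x} t) \<partial>lborel) = ennreal (F x - F a)" by simp
    then have "((\<lambda>t. g t * indicator {a<..x} t) has_integral (F x - F a)) UNIV"
      using mono[of a x] x by (intro nn_integral_has_integral) (auto simp: g_def)
    then have "((\<lambda>t. if t \<in> {a<..x} then g t else 0) has_integral (F x - F a)) UNIV"
      by (rule has_integral_eq[rotated]) (auto simp: indicator_def)
    then have "(g has_integral (F x - F a)) {a<..x}"
      by (simp only: has_integral_restrict_UNIV)
    then show ?thesis
      by (rule has_integral_spike_set_eq[THEN iffD1, rotated -1]) (auto intro: negligible_subset[of "{a}"])
  qed
  have "g absolutely_integrable_on {a..b}"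
    using int[of b] ab by (intro nonnegative_absolutely_integrable_1) (auto simp: g_def)
  with int that show thesis by blast
qed

text \<open>Common source of the closure properties: linear images, differences, inner products and
  Lipschitz functions all have increments dominated by those of known absolutely continuous
  functions.\<close>

lemma abs_continuous_comparison:
  assumes f: "abs_continuous a b f" and g: "abs_continuous a b g"
    and le: "\<And>x y. a \<le> x \<Longrightarrow> x < y \<Longrightarrow> y \<le> b \<Longrightarrow> norm (h y - h x) \<le> C * (norm (f y - f x) + norm (g y - g x))"
  shows "abs_continuous a b h"
  unfolding abs_continuous_iff
proof (intro allI impI)
  fix e :: real assume e: "0 < e"
  define e' where "e' = e / (2 * (\<bar>C\<bar> + 1))"
  have e': "e' > 0" using e by (simp add: e'_def)
  then obtain d1 where d1: "d1 > 0" "\<And>I. interval_family a b I \<Longrightarrow> total_length I < d1 \<Longrightarrow> var_sum f I < e'"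
    using f unfolding abs_continuous_iff by metis
  from e' obtain d2 where d2: "d2 > 0" "\<And>I. interval_family a b I \<Longrightarrow> total_length I < d2 \<Longrightarrow> var_sum g I < e'"
    using g unfolding abs_continuous_iff by metis
  have "var_sum h I < e" if I: "interval_family a b I" "total_length I < min d1 d2" for I
  proof -
    have "var_sum h I \<le> (\<Sum>p\<in>I. \<bar>C\<bar> * ((case p of (x, y) \<Rightarrow> norm (f y - f x)) + (case p of (x, y) \<Rightarrow> norm (g y - g x))))"
      unfolding var_sum_def
    proof (rule sum_mono)
      fix p assume "p \<in> I"
      then have "norm (h (snd p) - h (fst p)) \<le> C * (norm (f (snd p) - f (fst p)) + norm (g (snd p) - g (fst p)))"
        using I(1) by (intro le) (auto simp: interval_family_def)
      also have "\<dots> \<le> \<bar>C\<bar> * (norm (f (snd p) - f (fst p)) + norm (g (snd p) - g (fst p)))"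
        by (intro mult_right_mono) auto
      finally show "(case p of (x, y) \<Rightarrow> norm (h y - h x))
         \<le> \<bar>C\<bar> * ((case p of (x, y) \<Rightarrow> norm (f y - f x)) + (case p of (x, y) \<Rightarrow> norm (g y - g x)))"
        by (simp add: case_prod_beta)
    qed
    also have "\<dots> = \<bar>C\<bar> * (var_sum f I + var_sum g I)"
      by (simp add: var_sum_def sum_distrib_left[symmetric] sum.distrib)
    also have "\<dots> \<le> \<bar>C\<bar> * (2 * e')"
      using d1(2)[of I] d2(2)[of I] I by (intro mult_left_mono) auto
    also have "\<dots> < (\<bar>C\<bar> + 1) * (2 * e')" using e' by simp
    also have "\<dots> = e" unfolding e'_def by (simp add: field_simps add_eq_0_iff)
    finally show ?thesis .
  qed
  then show "\<exists>\<delta>>0. \<forall>I. interval_family a b I \<longrightarrow> total_length I < \<delta> \<longrightarrow> var_sum h I < e"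
    using d1(1) d2(1) by (intro exI[of _ "min d1 d2"]) auto
qed

lemma abs_continuous_diff:
  assumes f: "abs_continuous a b f" and g: "abs_continuous a b g"
  shows "abs_continuous a b (\<lambda>x. f x - g x)"
proof (rule abs_continuous_comparison[OF f g])
  fix x y
  show "norm (f y - g y - (f x - g x)) \<le> 1 * (norm (f y - f x) + norm (g y - g x))"
    using norm_triangle_ineq4[of "f y - f x" "g y - g x"] by (simp add: algebra_simps)
qed

lemma abs_continuous_Lipschitz:
  assumes "\<And>x y. a \<le> x \<Longrightarrow> x < y \<Longrightarrow> y \<le> b \<Longrightarrow> norm (h y - h x) \<le> C * (y - x)"
  shows "abs_continuous a b h"
proof -
  have "var_sum (\<lambda>x. x) I = total_length I" if "interval_family a b I" for I
    using that unfolding var_sum_def total_length_def interval_family_def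
    by (intro sum.cong[OF refl]) fastforce
  then have id: "abs_continuous a b (\<lambda>x::real. x)" unfolding abs_continuous_iff by auto
  show ?thesis
  proof (rule abs_continuous_comparison[OF id id])
    fix x y assume "a \<le> x" "x < y" "y \<le> b"
    with assms[of x y] show "norm (h y - h x) \<le> C / 2 * (norm (y - x) + norm (y - x))"
      by (simp add: algebra_simps)
  qed
qed

lemma abs_continuous_linear:
  assumes f: "abs_continuous a b f" and L: "bounded_linear L"
  shows "abs_continuous a b (\<lambda>x. L (f x))"
proof -
  obtain K where K: "\<And>x. norm (L x) \<le> norm x * K"
    using bounded_linear.bounded[OF L] by blast
  show ?thesis
  proof (rule abs_continuous_comparison[OF f f])
    fix x y
    show "norm (L (f y) - L (f x)) \<le> K / 2 * (norm (f y - f x) + norm (f y - f x))"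
      using K[of "f y - f x"] by (simp add: linear_diff[OF bounded_linear.linear[OF L]] mult.commute)
  qed
qed

lemma abs_continuous_real_density:
  fixes f :: "real \<Rightarrow> real"
  assumes ab: "a < b" and f: "abs_continuous a b f"
  obtains g where "g absolutely_integrable_on {a..b}"
    "\<And>x. x \<in> {a..b} \<Longrightarrow> (g has_integral (f x - f a)) {a..x}"
proof -
  let ?V = "variation f a"
  have bv: "bounded_variation f a d" if "d \<le> b" for d
    using abs_continuous_imp_bounded_variation[OF f] bounded_variation_subinterval that ab by force
  have acV: "abs_continuous a b ?V" by (rule abs_continuous_variation[OF f]) (use ab in simp)
  have inc: "?V x + \<bar>f y - f x\<bar> \<le> ?V y" if "a \<le> x" "x \<le> y" "y \<le> b" for x y
    using variation_increase[OF bv, of y x] that by simp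
  have m1: "?V x \<le> ?V y" and m2: "?V x - f x \<le> ?V y - f y" if "a \<le> x" "x \<le> y" "y \<le> b" for x y
    using inc[OF that] by linarith+
  from mono_abs_continuous_density[OF ab m1 acV]
  obtain g1 where g1: "g1 absolutely_integrable_on {a..b}"
    "\<And>x. x \<in> {a..b} \<Longrightarrow> (g1 has_integral (?V x - ?V a)) {a..x}"
    by blast
  from mono_abs_continuous_density[OF ab m2 abs_continuous_diff[OF acV f]]
  obtain g2 where g2: "g2 absolutely_integrable_on {a..b}"
    "\<And>x. x \<in> {a..b} \<Longrightarrow> (g2 has_integral ((?V x - f x) - (?V a - f a))) {a..x}"
    by blast
  show thesis
  proof
    show "(\<lambda>x. g1 x - g2 x) absolutely_integrable_on {a..b}"
      using g1(1) g2(1) by (rule set_integral_diff)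
    show "((\<lambda>x. g1 x - g2 x) has_integral (f x - f a)) {a..x}" if "x \<in> {a..b}" for x
      using has_integral_diff[OF g1(2)[OF that] g2(2)[OF that]] by simp
  qed
qed

section \<open>Null sets and almost everywhere differentiation\<close>

lemma AE_lebesgue_onI:
  assumes "negligible N" "\<And>t. t \<in> S \<Longrightarrow> t \<notin> N \<Longrightarrow> P t" "S \<in> sets lebesgue"
  shows "AE t in lebesgue_on S. P t"
proof -
  have "N \<inter> S \<in> null_sets (lebesgue_on S)"
    using assms(1,3) negligible_subset[OF assms(1), of "N \<inter> S"]
    by (simp add: null_sets_restrict_space negligible_iff_null_sets)
  then show ?thesis by (rule AE_I') (use assms(2) in auto)
qed

lemma AE_lebesgue_onE:
  assumes "AE t in lebesgue_on S. P t" "S \<in> sets lebesgue"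
  obtains N where "negligible N" "\<And>t. t \<in> S \<Longrightarrow> t \<notin> N \<Longrightarrow> P t"
proof -
  obtain N where "{t \<in> space (lebesgue_on S). \<not> P t} \<subseteq> N" "N \<in> null_sets (lebesgue_on S)"
    using assms(1) unfolding eventually_ae_filter by blast
  with that[of N] assms(2) show thesis
    by (auto simp: null_sets_restrict_space negligible_iff_null_sets)
qed

text \<open>Preimages under f and g differ by a subset of a null set, which is measurable because
  Lebesgue measure is complete. This is how \<open>dot\<close>, uncontrolled on a null set, becomes
  measurable.\<close>

lemma borel_measurable_lebesgue_on_AE:
  fixes f g :: "'a::euclidean_space \<Rightarrow> 'b::topological_space"
  assumes f: "f \<in> borel_measurable (lebesgue_on S)" and S: "S \<in> sets lebesgue"
    and eq: "AE t in lebesgue_on S. f t = g t"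
  shows "g \<in> borel_measurable (lebesgue_on S)"
proof (rule borel_measurableI)
  fix U :: "'b set" assume U: "open U"
  obtain N where N: "negligible N" "\<And>t. t \<in> S \<Longrightarrow> t \<notin> N \<Longrightarrow> f t = g t"
    using AE_lebesgue_onE[OF eq S] by metis
  have "f -` U \<inter> space (lebesgue_on S) \<in> sets (lebesgue_on S)"
    using f U by (intro measurable_sets) auto
  then have "f -` U \<inter> S \<in> sets lebesgue" using S by (simp add: sets_restrict_space_iff)
  moreover have "N \<in> sets lebesgue" "g -` U \<inter> S \<inter> N \<in> sets lebesgue"
    using N(1) negligible_subset[OF N(1), of "g -` U \<inter> S \<inter> N"] by (auto intro: negligible_imp_sets)
  ultimately have "(f -` U \<inter> S - N) \<union> (g -` U \<inter> S \<inter> N) \<in> sets lebesgue" by auto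
  also have "(f -` U \<inter> S - N) \<union> (g -` U \<inter> S \<inter> N) = g -` U \<inter> S" using N(2) by auto
  finally show "g -` U \<inter> space (lebesgue_on S) \<in> sets (lebesgue_on S)"
    using S by (simp add: sets_restrict_space_iff)
qed

lemma integrable_lebesgue_on_AE:
  fixes f g :: "'a::euclidean_space \<Rightarrow> 'b::{banach, second_countable_topology}"
  assumes "integrable (lebesgue_on S) f" "S \<in> sets lebesgue" "AE t in lebesgue_on S. f t = g t"
  shows "integrable (lebesgue_on S) g"
proof -
  have "f \<in> borel_measurable (lebesgue_on S)" using assms(1) by (rule borel_measurable_integrable)
  with assms show ?thesis
    using integrable_cong_AE borel_measurable_lebesgue_on_AE by blast
qed

text \<open>The library provides the derivative from the right; reflection gives the left one.\<close>
lemma has_vector_derivative_indefinite_integral_AE: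
  fixes g :: "real \<Rightarrow> 'a::euclidean_space"
  assumes g: "g integrable_on {a..b}"
  obtains N where "negligible N"
    "\<And>x. x \<in> {a..b} \<Longrightarrow> x \<notin> N \<Longrightarrow> ((\<lambda>x. integral {a..x} g) has_vector_derivative g x) (at x within {a..b})"
proof -
  \<comment> \<open>The averages run over intervals that may leave the domain, and the
    differentiation theorem asks for integrability on every box; extension by zero provides
    it.\<close>
  define g' where "g' = (\<lambda>x. if x \<in> {a..b} then g x else 0)"
  have gU: "g' integrable_on UNIV" unfolding g'_def using g by (simp only: Henstock_Kurzweil_Integration.integrable_restrict_UNIV)
  have gi: "g' integrable_on cbox c d" for c d by (rule integrable_on_subcbox[OF gU]) simp
  have gr: "(\<lambda>x. g' (- x)) integrable_on cbox c d" for c d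
    using gi[of "-d" "-c"] Henstock_Kurzweil_Integration.integrable_reflect_real[of g' "- c" "- d"] by simp
  obtain N1 where N1: "negligible N1" "\<And>x e. x \<notin> N1 \<Longrightarrow> 0 < e \<Longrightarrow>
      \<exists>d>0. \<forall>h. 0 < h \<and> h < d \<longrightarrow> norm (integral (cbox x (x + h *\<^sub>R One)) g' /\<^sub>R h ^ DIM(real) - g' x) < e"
    using integrable_ccontinuous_explicit[OF gi] by metis
  obtain N2 where N2: "negligible N2" "\<And>x e. x \<notin> N2 \<Longrightarrow> 0 < e \<Longrightarrow>
      \<exists>d>0. \<forall>h. 0 < h \<and> h < d \<longrightarrow> norm (integral (cbox x (x + h *\<^sub>R One)) (\<lambda>x. g' (- x)) /\<^sub>R h ^ DIM(real) - g' (- x)) < e"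
    using integrable_ccontinuous_explicit[OF gr] by metis
  have neg: "negligible (N1 \<union> uminus ` N2)"
    using N1(1) N2(1) by (intro negligible_Un negligible_differentiable_image_negligible) (auto simp: differentiable_on_def)
  have "((\<lambda>x. integral {a..x} g) has_vector_derivative g x) (at x within {a..b})"
    if x: "x \<in> {a..b}" "x \<notin> N1 \<union> uminus ` N2" for x
    unfolding has_vector_derivative_def has_derivative_within_alt
  proof (intro conjI allI impI bounded_linear_scaleR_left)
    fix e :: real assume e: "0 < e"
    obtain d1 where d1: "d1 > 0" "\<And>h. 0 < h \<Longrightarrow> h < d1 \<Longrightarrow> norm (integral {x..x+h} g' /\<^sub>R h - g' x) < e"
      using N1(2)[of x e] x e by auto
    have "- x \<notin> N2" using x by force
    then obtain d2 where d2: "d2 > 0" "\<And>h. 0 < h \<Longrightarrow> h < d2 \<Longrightarrow> norm (integral {-x..-x+h} (\<lambda>x. g' (-x)) /\<^sub>R h - g' x) < e"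
      using N2(2)[of "-x" e] e by auto
    have sub: "integral {a..v} g - integral {a..u} g = integral {u..v} g'" if "a \<le> u" "u \<le> v" "v \<le> b" for u v
    proof -
      have "integral {a..u} g + integral {u..v} g = integral {a..v} g"
        using that by (intro Henstock_Kurzweil_Integration.integral_combine integrable_on_subinterval[OF g]) auto
      moreover have "integral {u..v} g = integral {u..v} g'"
        using that by (intro integral_cong) (auto simp: g'_def)
      ultimately show ?thesis by (simp add: algebra_simps)
    qed
    have key: "norm (w - h *\<^sub>R z) \<le> e * h" if "0 < h" "norm (w /\<^sub>R h - z) < e" for w z :: 'a and h :: real
    proof -
      have "w - h *\<^sub>R z = h *\<^sub>R (w /\<^sub>R h - z)" using that by (simp add: algebra_simps)
      then have "norm (w - h *\<^sub>R z) = h * norm (w /\<^sub>R h - z)" using that by simp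
      also have "\<dots> \<le> h * e" using that by (intro mult_left_mono) auto
      finally show ?thesis by (simp add: mult.commute)
    qed
    have gx: "g' x = g x" using x by (simp add: g'_def)
    have "norm (integral {a..y} g - integral {a..x} g - (y - x) *\<^sub>R g x) \<le> e * norm (y - x)"
      if y: "y \<in> {a..b}" "norm (y - x) < min d1 d2" for y
    proof -
      consider "y = x" | "y > x" | "y < x" by linarith
      then show ?thesis
      proof cases
        case 2
        have "norm (integral {x..y} g' - (y - x) *\<^sub>R g x) \<le> e * (y - x)"
          using d1(2)[of "y - x"] 2 y by (intro key) (auto simp: gx)
        with sub[of x y] x y 2 show ?thesis by simp
      next
        case 3
        have "integral {-x..-x+(x-y)} (\<lambda>x. g' (-x)) = integral {y..x} g'"
          using integral_reflect_real[where f=g' and a=y and b=x] by simp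
        then have "norm (integral {y..x} g' - (x - y) *\<^sub>R g x) \<le> e * (x - y)"
          using d2(2)[of "x - y"] 3 y by (intro key) (auto simp: gx)
        moreover have "integral {a..y} g - integral {a..x} g - (y - x) *\<^sub>R g x
            = - (integral {y..x} g' - (x - y) *\<^sub>R g x)"
          using sub[of y x] x y 3 by (simp add: algebra_simps)
        ultimately show ?thesis using 3 by (simp only: norm_minus_cancel real_norm_def) (simp add: abs_if)
      qed simp
    qed
    then show "\<exists>d>0. \<forall>y\<in>{a..b}. norm (y - x) < d \<longrightarrow>
        norm (integral {a..y} g - integral {a..x} g - (y - x) *\<^sub>R g x) \<le> e * norm (y - x)"
      using d1(1) d2(1) by (intro exI[of _ "min d1 d2"]) auto
  qed
  with neg that show thesis by blast
qed

lemma abs_continuous_density: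
  fixes f :: "real \<Rightarrow> 'a::euclidean_space"
  assumes ab: "a < b" and f: "abs_continuous a b f"
  obtains g where "g absolutely_integrable_on {a..b}"
    "\<And>x. x \<in> {a..b} \<Longrightarrow> (g has_integral (f x - f a)) {a..x}"
proof -
  have "\<exists>g. g absolutely_integrable_on {a..b} \<and>
      (\<forall>x\<in>{a..b}. (g has_integral (f x \<bullet> i - f a \<bullet> i)) {a..x})" for i
    by (rule abs_continuous_real_density[OF ab abs_continuous_linear[OF f bounded_linear_inner_left[of i]]]) auto
  then have "\<exists>g. \<forall>i. g i absolutely_integrable_on {a..b} \<and>
      (\<forall>x\<in>{a..b}. (g i has_integral (f x \<bullet> i - f a \<bullet> i)) {a..x})"
    by (intro choice allI)
  then obtain g where gg: "\<forall>i. g i absolutely_integrable_on {a..b} \<and>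
      (\<forall>x\<in>{a..b}. (g i has_integral (f x \<bullet> i - f a \<bullet> i)) {a..x})" ..
  note g = gg[rule_format, THEN conjunct1] gg[rule_format, THEN conjunct2, rule_format]
  define G where "G = (\<lambda>x. \<Sum>i\<in>Basis. g i x *\<^sub>R i)"
  have G: "(\<lambda>x. G x \<bullet> i) = g i" if "i \<in> Basis" for i
    using that by (simp add: G_def fun_eq_iff)
  have "G absolutely_integrable_on {a..b}"
  proof (rule absolutely_integrable_componentwise)
    fix i :: 'a assume "i \<in> Basis"
    then show "(\<lambda>x. G x \<bullet> i) absolutely_integrable_on {a..b}" by (simp only: G g(1))
  qed
  moreover have "(G has_integral (f x - f a)) {a..x}" if "x \<in> {a..b}" for x
    unfolding has_integral_componentwise_iff[of G]
    using g(2)[OF that] by (simp add: G inner_diff_left)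
  ultimately show thesis by (rule that)
qed

text \<open>Differentiating the indefinite integral of the density shows that \<open>dot T f\<close>
  equals the density off a null set. It therefore inherits integrability and the value of the
  integral.\<close>

lemma abs_continuous_dot:
  fixes f :: "real \<Rightarrow> 'a::euclidean_space"
  assumes T: "0 < T" and f: "abs_continuous 0 T f"
  shows "AE t in lebesgue_on {0..T}. (f has_vector_derivative dot T f t) (at t within {0..T})"
    and "integrable (lebesgue_on {0..T}) (dot T f)"
    and "(LINT t|lebesgue_on {0..T}. dot T f t) = f T - f 0"
proof -
  obtain g where g: "g absolutely_integrable_on {0..T}"
    "\<And>x. x \<in> {0..T} \<Longrightarrow> (g has_integral (f x - f 0)) {0..x}"
    by (rule abs_continuous_density[OF T f]) blast
  have gi: "g integrable_on {0..T}" using g(1) by (rule set_lebesgue_integral_eq_integral(1))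
  obtain N where N: "negligible N"
    "\<And>x. x \<in> {0..T} \<Longrightarrow> x \<notin> N \<Longrightarrow> ((\<lambda>x. integral {0..x} g) has_vector_derivative g x) (at x within {0..T})"
    by (rule has_vector_derivative_indefinite_integral_AE[OF gi]) blast
  have d: "(f has_vector_derivative g x) (at x within {0..T})" if x: "x \<in> {0..T}" "x \<notin> N" for x
  proof (rule has_vector_derivative_transform[OF x(1)])
    show "f y = f 0 + integral {0..y} g" if "y \<in> {0..T}" for y
      using g(2)[OF that] by (simp add: integral_unique)
    show "((\<lambda>y. f 0 + integral {0..y} g) has_vector_derivative g x) (at x within {0..T})"
      using has_vector_derivative_add[OF has_vector_derivative_const N(2)[OF x]] by simp
  qed
  have eq: "dot T f x = g x" if "x \<in> {0..T}" "x \<notin> N" for x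
    unfolding dot_def using T that d by (intro vector_derivative_within_closed_interval) auto
  show "AE t in lebesgue_on {0..T}. (f has_vector_derivative dot T f t) (at t within {0..T})"
    by (rule AE_lebesgue_onI[OF N(1)]) (simp_all add: d eq)
  have g': "integrable (lebesgue_on {0..T}) g" using g(1) by (rule absolutely_integrable_imp_integrable) simp
  have gd: "AE t in lebesgue_on {0..T}. g t = dot T f t"
    by (rule AE_lebesgue_onI[OF N(1)]) (simp_all add: eq)
  show i: "integrable (lebesgue_on {0..T}) (dot T f)"
    by (rule integrable_lebesgue_on_AE[OF g' _ gd]) simp
  then have "(LINT t|lebesgue_on {0..T}. dot T f t) = integral {0..T} (dot T f)"
    by (rule lebesgue_integral_eq_integral) simp
  also have "\<dots> = integral {0..T} g"
    by (rule integral_spike[OF N(1)]) (simp add: eq)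
  also have "\<dots> = f T - f 0" using g(2)[of T] T by (simp add: integral_unique)
  finally show "(LINT t|lebesgue_on {0..T}. dot T f t) = f T - f 0" .
qed

lemma dot_eq:
  fixes f :: "real \<Rightarrow> 'a::euclidean_space"
  assumes "0 < T" "t \<in> {0..T}" "(f has_vector_derivative f') (at t within {0..T})"
  shows "dot T f t = f'"
  unfolding dot_def using assms by (intro vector_derivative_within_closed_interval) auto

text \<open>Supplies the test functions for du Bois-Reymond's lemma. The bound makes the primitive
  Lipschitz, and a bounded derivative lies in every Orlicz space considered here.\<close>

lemma bounded_integrable_primitive:
  fixes q :: "real \<Rightarrow> 'a::euclidean_space"
  assumes T: "0 < T" and q: "q \<in> borel_measurable (lebesgue_on {0..T})"
    and B: "\<And>t. norm (q t) \<le> B"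
  defines "h \<equiv> \<lambda>x. integral {0..x} q"
  shows "abs_continuous 0 T h" "AE t in lebesgue_on {0..T}. dot T h t = q t" "h 0 = 0"
    "h T = (LINT t|lebesgue_on {0..T}. q t)"
proof -
  have fin: "finite_measure (lebesgue_on {0..T})" by (intro finite_measure_lebesgue_on) simp
  have "integrable (lebesgue_on {0..T}) q"
    using fin q B by (intro finite_measure.integrable_const_bound[where B=B]) auto
  then have qi: "q integrable_on {0..T}" and hT: "h T = (LINT t|lebesgue_on {0..T}. q t)"
    unfolding h_def by (simp_all add: integrable_on_lebesgue_on lebesgue_integral_eq_integral)
  show "h T = (LINT t|lebesgue_on {0..T}. q t)" by (rule hT)
  show "h 0 = 0" by (simp add: h_def)
  show "abs_continuous 0 T h"
  proof (rule abs_continuous_Lipschitz)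
    fix x y :: real assume xy: "0 \<le> x" "x < y" "y \<le> T"
    have "integral {0..x} q + integral {x..y} q = integral {0..y} q"
      using xy by (intro Henstock_Kurzweil_Integration.integral_combine integrable_on_subinterval[OF qi]) auto
    then have "h y - h x = integral {x..y} q" by (simp add: h_def algebra_simps)
    also have "norm \<dots> \<le> B * (y - x)"
    proof -
      have "q integrable_on cbox x y" using xy by (auto intro: integrable_on_subinterval[OF qi])
      moreover have "0 \<le> B" using B[of 0] norm_ge_zero[of "q 0"] by linarith
      ultimately show ?thesis using integrable_bound[of B q x y] B xy by simp
    qed
    finally show "norm (h y - h x) \<le> B * (y - x)" .
  qed
  obtain N where N: "negligible N"
    "\<And>x. x \<in> {0..T} \<Longrightarrow> x \<notin> N \<Longrightarrow> (h has_vector_derivative q x) (at x within {0..T})"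
    unfolding h_def by (rule has_vector_derivative_indefinite_integral_AE[OF qi]) blast
  show "AE t in lebesgue_on {0..T}. dot T h t = q t"
    by (rule AE_lebesgue_onI[OF N(1)]) (simp_all add: dot_eq[OF T] N(2))
qed

lemma abs_continuous_inner:
  fixes f g :: "real \<Rightarrow> 'a::euclidean_space"
  assumes f: "abs_continuous a b f" and g: "abs_continuous a b g"
  shows "abs_continuous a b (\<lambda>x. f x \<bullet> g x)"
proof -
  have "bounded (f ` {a..b})" "bounded (g ` {a..b})"
    using abs_continuous_imp_continuous_on f g by (auto intro!: compact_imp_bounded compact_continuous_image)
  then obtain A B where AB: "\<And>x. x \<in> {a..b} \<Longrightarrow> norm (f x) \<le> A" "\<And>x. x \<in> {a..b} \<Longrightarrow> norm (g x) \<le> B"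
    unfolding bounded_iff by blast
  show ?thesis
  proof (rule abs_continuous_comparison[OF f g])
    fix x y assume xy: "a \<le> x" "x < y" "y \<le> b"
    have "f y \<bullet> g y - f x \<bullet> g x = (f y - f x) \<bullet> g y + f x \<bullet> (g y - g x)"
      by (simp add: inner_diff_left inner_diff_right)
    also have "norm \<dots> \<le> norm (f y - f x) * norm (g y) + norm (f x) * norm (g y - g x)"
      by (intro norm_triangle_le add_mono) (auto simp: Cauchy_Schwarz_ineq2)
    also have "\<dots> \<le> norm (f y - f x) * max A B + max A B * norm (g y - g x)"
      using AB(1)[of x] AB(2)[of y] xy by (intro add_mono mult_left_mono mult_right_mono) auto
    finally show "norm (f y \<bullet> g y - f x \<bullet> g x) \<le> max A B * (norm (f y - f x) + norm (g y - g x))"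
      by (simp add: algebra_simps)
  qed
qed

lemma integral_by_parts_abs_continuous:
  fixes f g :: "real \<Rightarrow> 'a::euclidean_space"
  assumes T: "0 < T" and f: "abs_continuous 0 T f" and g: "abs_continuous 0 T g"
  shows "(LINT t|lebesgue_on {0..T}. dot T f t \<bullet> g t + f t \<bullet> dot T g t) = f T \<bullet> g T - f 0 \<bullet> g 0"
    and "integrable (lebesgue_on {0..T}) (\<lambda>t. dot T f t \<bullet> g t + f t \<bullet> dot T g t)"
proof -
  note fg = abs_continuous_inner[OF f g]
  have ae: "AE t in lebesgue_on {0..T}. dot T (\<lambda>t. f t \<bullet> g t) t = dot T f t \<bullet> g t + f t \<bullet> dot T g t"
    using abs_continuous_dot(1)[OF T f] abs_continuous_dot(1)[OF T g] AE_space
  proof eventually_elim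
    case (elim t)
    have "((\<lambda>t. f t \<bullet> g t) has_vector_derivative (f t \<bullet> dot T g t + dot T f t \<bullet> g t)) (at t within {0..T})"
      using bounded_bilinear.has_vector_derivative[OF bounded_bilinear_inner elim(1,2)] .
    then show ?case using elim(3) by (subst dot_eq[OF T]) (auto simp: add.commute)
  qed
  note i = abs_continuous_dot(2)[OF T fg]
  show *: "integrable (lebesgue_on {0..T}) (\<lambda>t. dot T f t \<bullet> g t + f t \<bullet> dot T g t)"
    by (rule integrable_lebesgue_on_AE[OF i _ ae]) simp
  have "(LINT t|lebesgue_on {0..T}. dot T f t \<bullet> g t + f t \<bullet> dot T g t)
      = (LINT t|lebesgue_on {0..T}. dot T (\<lambda>t. f t \<bullet> g t) t)"
    using i * ae by (intro integral_cong_AE) auto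
  then show "(LINT t|lebesgue_on {0..T}. dot T f t \<bullet> g t + f t \<bullet> dot T g t) = f T \<bullet> g T - f 0 \<bullet> g 0"
    using abs_continuous_dot(3)[OF T fg] by simp
qed

section \<open>Convex conjugates\<close>

lemma gradient_eq:
  assumes "GDERIV F u :> D"
  shows "gradient F u = D"
  unfolding gradient_def
proof (rule the_equality)
  show "GDERIV F u :> D" by fact
  fix D' assume "GDERIV F u :> D'"
  with assms have "(\<lambda>h. h \<bullet> D') = (\<lambda>h. h \<bullet> D)"
    unfolding gderiv_def by (rule has_derivative_unique[rotated])
  then have "(D' - D) \<bullet> D' = (D' - D) \<bullet> D" by (rule fun_cong)
  then have "(D' - D) \<bullet> (D' - D) = 0" by (simp add: inner_diff_right)
  then show "D' = D" by simp
qed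

text \<open>Superlinearity acts outside a ball, compactness inside. With r equal to the norm of v it
  bounds \<open>u \<bullet> v - F u\<close>; with one unit more it makes
  \<open>F u - u \<bullet> v\<close> coercive.\<close>

lemma superlinear_linear_bound:
  fixes F :: "'a::euclidean_space \<Rightarrow> real"
  assumes "superlinear F" and cont: "continuous_on UNIV F"
  obtains C where "\<And>u. r * norm u - C \<le> F u"
proof -
  have "eventually (\<lambda>u. r \<le> F u / norm u) at_infinity"
    using assms(1) unfolding superlinear_def filterlim_at_top by blast
  then obtain R0 where R0: "\<And>u. R0 \<le> norm u \<Longrightarrow> r \<le> F u / norm u"
    unfolding eventually_at_infinity by blast
  define R where "R = max R0 1"
  obtain w where w: "\<And>u. u \<in> cball 0 R \<Longrightarrow> F w \<le> F u"
    using continuous_attains_inf[of "cball 0 R" F] continuous_on_subset[OF cont, of "cball 0 R"]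
    by (fastforce simp: R_def)
  have "r * norm u - (\<bar>r\<bar> * R + \<bar>F w\<bar>) \<le> F u" for u
  proof (cases "norm u \<le> R")
    case True
    have "r * norm u \<le> \<bar>r\<bar> * R" using True by (intro mult_mono) auto
    moreover have "F w \<le> F u" using w True by simp
    ultimately show ?thesis by linarith
  next
    case False
    then have "r \<le> F u / norm u" "norm u > 0" using R0[of u] by (auto simp: R_def)
    then have "r * norm u \<le> F u" by (simp add: pos_le_divide_eq)
    moreover have "0 \<le> \<bar>r\<bar> * R" by (simp add: R_def)
    ultimately show ?thesis by linarith
  qed
  with that show thesis by blast
qed

lemma superlinear_conjugate_bdd:
  fixes F :: "'a::euclidean_space \<Rightarrow> real"
  assumes "superlinear F" "continuous_on UNIV F"
  shows "bdd_above (range (\<lambda>u. u \<bullet> v - F u))"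
proof -
  obtain C where C: "\<And>u. norm v * norm u - C \<le> F u"
    by (rule superlinear_linear_bound[OF assms, of "norm v"]) blast
  have "u \<bullet> v - F u \<le> C" for u
    using C[of u] norm_cauchy_schwarz[of u v] by (simp add: mult.commute)
  then show ?thesis by (intro bdd_aboveI2[where M=C])
qed

lemma convex_conjugate_upper:
  "bdd_above (range (\<lambda>u. u \<bullet> v - F u)) \<Longrightarrow> u \<bullet> v - F u \<le> convex_conjugate F v"
  unfolding convex_conjugate_def by (rule cSUP_upper) auto

lemma convex_conjugate_least:
  "(\<And>u. u \<bullet> v - F u \<le> B) \<Longrightarrow> convex_conjugate F v \<le> B"
  unfolding convex_conjugate_def by (rule cSUP_least) auto

lemma convex_on_convex_conjugate:
  assumes bdd: "\<And>v. bdd_above (range (\<lambda>u. u \<bullet> v - F u))"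
  shows "convex_on UNIV (convex_conjugate F)"
proof (rule convex_onI)
  fix s x y assume s: "0 < s" "s < (1::real)"
  show "convex_conjugate F ((1 - s) *\<^sub>R x + s *\<^sub>R y) \<le> (1 - s) * convex_conjugate F x + s * convex_conjugate F y"
  proof (rule convex_conjugate_least)
    fix u
    have "u \<bullet> ((1 - s) *\<^sub>R x + s *\<^sub>R y) - F u = (1 - s) * (u \<bullet> x - F u) + s * (u \<bullet> y - F u)"
      by (simp add: inner_add_right algebra_simps)
    also have "\<dots> \<le> (1 - s) * convex_conjugate F x + s * convex_conjugate F y"
      using s by (intro add_mono mult_left_mono convex_conjugate_upper bdd) auto
    finally show "u \<bullet> ((1 - s) *\<^sub>R x + s *\<^sub>R y) - F u \<le> (1 - s) * convex_conjugate F x + s * convex_conjugate F y" .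
  qed
qed simp

text \<open>Measurability of the conjugate of an integrand depending on time rests on this reduction to
  a countable supremum.\<close>
lemma convex_conjugate_dense:
  fixes F :: "'a::euclidean_space \<Rightarrow> real"
  assumes cont: "continuous_on UNIV F" and bdd: "bdd_above (range (\<lambda>u. u \<bullet> v - F u))"
    and D: "\<And>X. open X \<Longrightarrow> X \<noteq> {} \<Longrightarrow> \<exists>d\<in>D. d \<in> X"
  shows "convex_conjugate F v = (SUP u\<in>D. u \<bullet> v - F u)"
proof (rule antisym)
  have ne: "D \<noteq> {}" using D[of UNIV] by auto
  have bd: "bdd_above ((\<lambda>u. u \<bullet> v - F u) ` D)" using bdd by (rule bdd_above_mono) auto
  show "(SUP u\<in>D. u \<bullet> v - F u) \<le> convex_conjugate F v"
    by (intro cSUP_least ne convex_conjugate_upper bdd)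
  show "convex_conjugate F v \<le> (SUP u\<in>D. u \<bullet> v - F u)"
  proof (rule convex_conjugate_least, rule field_le_epsilon)
    fix u and e :: real assume e: "0 < e"
    have "open {x. u \<bullet> v - F u - e < x \<bullet> v - F x}"
      by (intro open_Collect_less continuous_intros cont)
    moreover have "u \<in> {x. u \<bullet> v - F u - e < x \<bullet> v - F x}" using e by simp
    ultimately obtain d where "d \<in> D" "u \<bullet> v - F u - e < d \<bullet> v - F d" using D by blast
    moreover have "d \<bullet> v - F d \<le> (SUP u\<in>D. u \<bullet> v - F u)" using \<open>d \<in> D\<close> bd by (intro cSUP_upper)
    ultimately show "u \<bullet> v - F u \<le> (SUP u\<in>D. u \<bullet> v - F u) + e" by linarith
  qed
qed

lemma strictly_convex_le:
  assumes "strictly_convex F" "0 \<le> s" "s \<le> 1"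
  shows "F ((1 - s) *\<^sub>R x + s *\<^sub>R y) \<le> (1 - s) * F x + s * F y"
proof (cases "x = y \<or> s = 0 \<or> s = 1")
  case True
  then show ?thesis by (auto simp: scaleR_left.diff algebra_simps)
next
  case False
  then show ?thesis using assms unfolding strictly_convex_def by (intro less_imp_le) auto
qed

text \<open>Strict convexity makes the minimiser unique, so compactness gives a positive gap m on
  the sphere of radius e around u. Convexity along rays from u turns the gap into linear growth with
  slope m / e outside. This growth absorbs small linear perturbations of \<phi>.\<close>

lemma strict_min_growth:
  fixes \<phi> :: "'a::euclidean_space \<Rightarrow> real"
  assumes sc: "strictly_convex \<phi>" and cont: "continuous_on UNIV \<phi>"
    and min: "\<And>w. \<phi> u \<le> \<phi> w" and e: "0 < e"
  obtains c where "c > 0" "\<And>w. e \<le> norm (w - u) \<Longrightarrow> \<phi> u + c * norm (w - u) \<le> \<phi> w"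
proof -
  have strict: "\<phi> u < \<phi> w" if "w \<noteq> u" for w
  proof (rule ccontr)
    assume "\<not> \<phi> u < \<phi> w"
    then have "\<phi> ((1 - 1/2) *\<^sub>R u + (1/2) *\<^sub>R w) < (1 - 1/2) * \<phi> u + 1/2 * \<phi> u"
      using sc that unfolding strictly_convex_def
      by (smt (verit, ccfv_SIG) divide_pos_pos half_bounded_equal mult_left_mono zero_less_divide_1_iff field_sum_of_halves)
    with min[of "(1 - 1/2) *\<^sub>R u + (1/2) *\<^sub>R w"] show False by simp
  qed
  have "\<exists>m>0. \<forall>w\<in>sphere u e. \<phi> u + m \<le> \<phi> w"
  proof (cases "sphere u e = {}")
    case False
    obtain z where z: "z \<in> sphere u e" "\<And>w. w \<in> sphere u e \<Longrightarrow> \<phi> z \<le> \<phi> w"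
      using continuous_attains_inf[of "sphere u e" \<phi>] False continuous_on_subset[OF cont] by auto
    have "\<phi> u < \<phi> z" using z(1) e by (intro strict) auto
    with z(2) show ?thesis by (intro exI[of _ "\<phi> z - \<phi> u"]) auto
  qed (auto intro: exI[of _ 1])
  then obtain m where m: "m > 0" "\<And>w. w \<in> sphere u e \<Longrightarrow> \<phi> u + m \<le> \<phi> w" by blast
  have "\<phi> u + m / e * norm (w - u) \<le> \<phi> w" if w: "e \<le> norm (w - u)" for w
  proof -
    define s where "s = e / norm (w - u)"
    have n: "norm (w - u) > 0" using w e by linarith
    have s: "0 < s" "s \<le> 1" using n w e by (auto simp: s_def)
    define z where "z = (1 - s) *\<^sub>R u + s *\<^sub>R w"
    have "z - u = s *\<^sub>R (w - u)" by (simp add: z_def algebra_simps)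
    then have "dist u z = e" using n e s by (simp add: dist_norm norm_minus_commute[of u z] s_def)
    then have "\<phi> u + m \<le> \<phi> z" using m by simp
    also have "\<phi> z \<le> (1 - s) * \<phi> u + s * \<phi> w"
      unfolding z_def using s by (intro strictly_convex_le sc) auto
    finally have "m \<le> s * (\<phi> w - \<phi> u)" by (simp add: algebra_simps)
    then have "m * norm (w - u) \<le> e * (\<phi> w - \<phi> u)"
      using n by (simp add: s_def field_simps)
    then show ?thesis using e by (simp add: field_simps)
  qed
  with m(1) e that[of "m / e"] show thesis by simp
qed

text \<open>The gradient of the conjugate at \<open>v\<close> is the unique maximiser \<open>u\<close> of \<open>u \<bullet> v - F u\<close>: by strict
  convexity the maximisers for nearby \<open>v'\<close> cannot leave a small ball around \<open>u\<close>.\<close>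
lemma Gamma_conjugate_GDERIV:
  fixes F :: "'a::euclidean_space \<Rightarrow> real"
  assumes "F \<in> \<Gamma>"
  obtains u where "GDERIV (convex_conjugate F) v :> u" "GDERIV F u :> v"
    "\<And>v'. convex_conjugate F v + u \<bullet> (v' - v) \<le> convex_conjugate F v'"
proof -
  have sc: "strictly_convex F" and sl: "superlinear F" and diff: "\<And>u. F differentiable (at u)"
    using assms by (auto simp: Gamma_class_def)
  have cont: "continuous_on UNIV F"
    using diff differentiable_imp_continuous_within by (auto simp: continuous_on_eq_continuous_within)
  note bdd = superlinear_conjugate_bdd[OF sl cont]
  define \<phi> where "\<phi> = (\<lambda>u. F u - u \<bullet> v)"
  have contp: "continuous_on UNIV \<phi>" unfolding \<phi>_def by (intro continuous_intros cont)
  have scp: "strictly_convex \<phi>"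
    using sc unfolding strictly_convex_def \<phi>_def by (auto simp: inner_add_left algebra_simps)
  obtain C where C: "\<And>u. (norm v + 1) * norm u - C \<le> F u"
    by (rule superlinear_linear_bound[OF sl cont, of "norm v + 1"]) blast
  have coer: "norm u - C \<le> \<phi> u" for u
    using C[of u] norm_cauchy_schwarz[of u v] by (simp add: \<phi>_def algebra_simps)
  \<comment> \<open>Beyond this radius coercivity forces \<phi> above its value at 0, so the
    minimiser over the ball is global.\<close>
  define R where "R = \<bar>C\<bar> + \<bar>\<phi> 0\<bar>"
  obtain u where u: "\<And>w. w \<in> cball 0 R \<Longrightarrow> \<phi> u \<le> \<phi> w"
    using continuous_attains_inf[of "cball 0 R" \<phi>] continuous_on_subset[OF contp, of "cball 0 R"]
    by (fastforce simp: R_def)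
  have min: "\<phi> u \<le> \<phi> w" for w
  proof (cases "norm w \<le> R")
    case False
    then have "\<phi> 0 \<le> \<phi> w" using coer[of w] by (simp add: R_def)
    moreover have "\<phi> u \<le> \<phi> 0" by (rule u) (simp add: R_def)
    ultimately show ?thesis by linarith
  qed (use u in simp)
  have conj_v: "convex_conjugate F v = - \<phi> u"
  proof (rule antisym)
    show "convex_conjugate F v \<le> - \<phi> u"
    proof (rule convex_conjugate_least)
      fix w show "w \<bullet> v - F w \<le> - \<phi> u" using min[of w] by (simp add: \<phi>_def)
    qed
    show "- \<phi> u \<le> convex_conjugate F v"
      using convex_conjugate_upper[OF bdd, of u v] by (simp add: \<phi>_def)
  qed
  have lower: "convex_conjugate F v + u \<bullet> (v' - v) \<le> convex_conjugate F v'" for v'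
    using convex_conjugate_upper[OF bdd, of u v'] by (simp add: conj_v \<phi>_def inner_diff_right)
  have "GDERIV F u :> v"
  proof -
    obtain D where D: "(F has_derivative D) (at u)" using diff[of u] by (auto simp: differentiable_def)
    then have "(\<phi> has_derivative (\<lambda>h. D h - h \<bullet> v)) (at u)"
      unfolding \<phi>_def by (auto intro!: derivative_eq_intros)
    then have "(\<lambda>h. D h - h \<bullet> v) = (\<lambda>h. 0)"
      by (rule has_derivative_local_min) (simp add: min)
    then have "D = (\<lambda>h. h \<bullet> v)" by (simp add: fun_eq_iff)
    with D show ?thesis by (simp add: gderiv_def)
  qed
  moreover have "GDERIV (convex_conjugate F) v :> u"
    unfolding gderiv_def has_derivative_at_alt
  proof (intro conjI allI impI bounded_linear_inner_left)
    fix e :: real assume e: "0 < e"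
    obtain c where c: "c > 0" "\<And>w. e \<le> norm (w - u) \<Longrightarrow> \<phi> u + c * norm (w - u) \<le> \<phi> w"
      using strict_min_growth[OF scp contp min e] by blast
    have "norm (convex_conjugate F v' - convex_conjugate F v - (v' - v) \<bullet> u) \<le> e * norm (v' - v)"
      if v': "norm (v' - v) < c" for v'
    proof -
      have "convex_conjugate F v' \<le> - \<phi> u + u \<bullet> (v' - v) + e * norm (v' - v)"
      proof (rule convex_conjugate_least)
        fix w
        \<comment> \<open>Moving from v to v' perturbs the competitor w by
          \<open>(w - u) \<bullet> (v' - v)\<close>. For w at distance at least e the growth with
          slope c outweighs it, since v' is closer than c to v; for nearer w it is at most the
          permitted remainder.\<close>
        have eq: "w \<bullet> v' - F w = - \<phi> w + u \<bullet> (v' - v) + (w - u) \<bullet> (v' - v)"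
          by (simp add: \<phi>_def inner_diff_left inner_diff_right)
        have cs: "(w - u) \<bullet> (v' - v) \<le> norm (w - u) * norm (v' - v)" by (rule norm_cauchy_schwarz)
        show "w \<bullet> v' - F w \<le> - \<phi> u + u \<bullet> (v' - v) + e * norm (v' - v)"
        proof (cases "e \<le> norm (w - u)")
          case True
          have "norm (w - u) * norm (v' - v) \<le> c * norm (w - u)"
            using v' by (simp add: mult.commute mult_right_mono)
          moreover have "0 \<le> e * norm (v' - v)" using e by simp
          ultimately show ?thesis using c(2)[OF True] cs eq by linarith
        next
          case False
          then have "norm (w - u) * norm (v' - v) \<le> e * norm (v' - v)"
            by (intro mult_right_mono) auto
          then show ?thesis using min[of w] cs eq by linarith
        qed
      qed
      with lower[of v'] show ?thesis by (simp add: conj_v inner_commute)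
    qed
    then show "\<exists>d>0. \<forall>y. norm (y - v) < d \<longrightarrow>
        norm (convex_conjugate F y - convex_conjugate F v - (y - v) \<bullet> u) \<le> e * norm (y - v)"
      using c(1) by blast
  qed
  ultimately show thesis using lower that by blast
qed

lemma GDERIV_directional:
  assumes "GDERIV F a :> p"
  shows "((\<lambda>s. (F (a + s *\<^sub>R b) - F a) / s) \<longlongrightarrow> p \<bullet> b) (at 0)"
proof -
  have "(F has_derivative (\<lambda>h. h \<bullet> p)) (at (a + 0 *\<^sub>R b))" using assms by (simp add: gderiv_def)
  moreover have "((\<lambda>s::real. a + s *\<^sub>R b) has_derivative (\<lambda>s. s *\<^sub>R b)) (at 0)"
    by (auto intro!: derivative_eq_intros)
  ultimately have "((\<lambda>s. F (a + s *\<^sub>R b)) has_derivative (\<lambda>s. (s *\<^sub>R b) \<bullet> p)) (at 0)"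
    using has_derivative_compose by blast
  moreover have "(\<lambda>s. (s *\<^sub>R b) \<bullet> p) = (*) (p \<bullet> b)"
    by (simp add: fun_eq_iff inner_commute mult.commute)
  ultimately have "((\<lambda>s. F (a + s *\<^sub>R b)) has_field_derivative (p \<bullet> b)) (at 0)"
    by (simp add: has_field_derivative_def)
  then show ?thesis by (simp add: DERIV_def)
qed

text \<open>Chord slopes of a convex function are monotone, so the quotient at s lies between the
  slopes for the steps -r and r. Absorbing the sign of s into the direction merely swaps the two end
  values, in which the bound is symmetric. The bound is free of s and can serve as a dominating
  function.\<close>

lemma convex_difference_quotient_bound:
  fixes K :: "'a::real_vector \<Rightarrow> real"
  assumes K: "convex_on UNIV K" and s: "s \<noteq> 0" "\<bar>s\<bar> \<le> r"
  shows "\<bar>(K (a + s *\<^sub>R b) - K a) / s\<bar> \<le> (\<bar>K (a + r *\<^sub>R b) - K a\<bar> + \<bar>K (a - r *\<^sub>R b) - K a\<bar>) / r"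
proof -
  have r: "r > 0" using s by auto
  have up: "K (a + (\<sigma> * r) *\<^sub>R c) - K a \<le> \<sigma> * (K (a + r *\<^sub>R c) - K a)" if "0 \<le> \<sigma>" "\<sigma> \<le> 1" for \<sigma> c
  proof -
    have "a + (\<sigma> * r) *\<^sub>R c = (1 - \<sigma>) *\<^sub>R a + \<sigma> *\<^sub>R (a + r *\<^sub>R c)" by (simp add: algebra_simps)
    then show ?thesis using convex_onD[OF K that, of a "a + r *\<^sub>R c"] by (simp add: algebra_simps)
  qed
  have lo: "\<sigma> * (K a - K (a - r *\<^sub>R c)) \<le> K (a + (\<sigma> * r) *\<^sub>R c) - K a" if "0 \<le> \<sigma>" "\<sigma> \<le> 1" for \<sigma> c
  proof -
    define z where "z = a + (\<sigma> * r) *\<^sub>R c"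
    \<comment> \<open>Here a lies between z, at signed distance \<open>\<sigma> * r\<close> along c,
      and the point at -r; the weights are inverse to these distances.\<close>
    have "a = (1 - \<sigma> / (1 + \<sigma>)) *\<^sub>R z + (\<sigma> / (1 + \<sigma>)) *\<^sub>R (a - r *\<^sub>R c)"
    proof -
      have "1 - \<sigma> / (1 + \<sigma>) = 1 / (1 + \<sigma>)" using that by (simp add: field_simps)
      then have "(1 + \<sigma>) *\<^sub>R ((1 - \<sigma> / (1 + \<sigma>)) *\<^sub>R z + (\<sigma> / (1 + \<sigma>)) *\<^sub>R (a - r *\<^sub>R c)) = z + \<sigma> *\<^sub>R (a - r *\<^sub>R c)"
        using that by (simp add: scaleR_add_right)
      also have "\<dots> = (1 + \<sigma>) *\<^sub>R a" by (simp add: z_def algebra_simps)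
      finally show ?thesis using that by (simp only: scaleR_cancel_left) auto
    qed
    then have "K a \<le> (1 - \<sigma> / (1 + \<sigma>)) * K z + \<sigma> / (1 + \<sigma>) * K (a - r *\<^sub>R c)"
      using convex_onD[OF K, of "\<sigma> / (1 + \<sigma>)" z "a - r *\<^sub>R c"] that by (simp add: divide_le_eq)
    then have "(1 + \<sigma>) * K a \<le> (1 + \<sigma>) * ((1 - \<sigma> / (1 + \<sigma>)) * K z + \<sigma> / (1 + \<sigma>) * K (a - r *\<^sub>R c))"
      using that by (intro mult_left_mono) auto
    also have "\<dots> = K z + \<sigma> * K (a - r *\<^sub>R c)"
    proof -
      have "(1 + \<sigma>) * (1 - \<sigma> / (1 + \<sigma>)) = 1" "(1 + \<sigma>) * (\<sigma> / (1 + \<sigma>)) = \<sigma>"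
        using that by (simp_all add: field_simps)
      then show ?thesis by (simp only: distrib_left mult.assoc[symmetric] mult_1_left)
    qed
    finally show ?thesis by (simp add: z_def algebra_simps)
  qed
  define \<sigma> where "\<sigma> = \<bar>s\<bar> / r"
  define c where "c = sgn s *\<^sub>R b"
  have sig: "0 < \<sigma>" "\<sigma> \<le> 1" using s r by (auto simp: \<sigma>_def)
  have sb: "s *\<^sub>R b = (\<sigma> * r) *\<^sub>R c" using r by (simp add: \<sigma>_def c_def abs_mult_sgn)
  have "\<bar>K (a + s *\<^sub>R b) - K a\<bar> \<le> \<sigma> * (\<bar>K (a + r *\<^sub>R c) - K a\<bar> + \<bar>K (a - r *\<^sub>R c) - K a\<bar>)"
  proof (rule abs_leI)
    have "\<sigma> * (K (a + r *\<^sub>R c) - K a) \<le> \<sigma> * (\<bar>K (a + r *\<^sub>R c) - K a\<bar> + \<bar>K (a - r *\<^sub>R c) - K a\<bar>)"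
      "\<sigma> * (K (a - r *\<^sub>R c) - K a) \<le> \<sigma> * (\<bar>K (a + r *\<^sub>R c) - K a\<bar> + \<bar>K (a - r *\<^sub>R c) - K a\<bar>)"
      using sig by (intro mult_left_mono; linarith)+
    with up[of \<sigma> c] lo[of \<sigma> c] sig
    show "K (a + s *\<^sub>R b) - K a \<le> \<sigma> * (\<bar>K (a + r *\<^sub>R c) - K a\<bar> + \<bar>K (a - r *\<^sub>R c) - K a\<bar>)"
      "- (K (a + s *\<^sub>R b) - K a) \<le> \<sigma> * (\<bar>K (a + r *\<^sub>R c) - K a\<bar> + \<bar>K (a - r *\<^sub>R c) - K a\<bar>)"
      unfolding sb by (simp_all add: right_diff_distrib)
  qed
  also have "\<bar>K (a + r *\<^sub>R c) - K a\<bar> + \<bar>K (a - r *\<^sub>R c) - K a\<bar>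
      = \<bar>K (a + r *\<^sub>R b) - K a\<bar> + \<bar>K (a - r *\<^sub>R b) - K a\<bar>"
    using s by (cases "s > 0") (auto simp: c_def)
  finally have "\<bar>K (a + s *\<^sub>R b) - K a\<bar> / \<bar>s\<bar> \<le> \<sigma> * (\<bar>K (a + r *\<^sub>R b) - K a\<bar> + \<bar>K (a - r *\<^sub>R b) - K a\<bar>) / \<bar>s\<bar>"
    by (intro divide_right_mono) auto
  then show ?thesis using s r by (simp add: \<sigma>_def)
qed

lemma G_function_continuous:
  "G_function G \<Longrightarrow> continuous_on UNIV G"
  by (auto simp: G_function_def intro: convex_on_continuous)

text \<open>The tangent plane at u has a slope p with
  \<open>convex_conjugate G p \<le> u \<bullet> p - G u\<close>, the equality case of Young's
  inequality, and p is the competitor for the biconjugate. This half of Fenchel-Moreau makes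
  semi-symplecticity of the conjugate a bound on G itself.\<close>

lemma G_function_le_biconjugate:
  fixes G :: "'a::euclidean_space \<Rightarrow> real"
  assumes G: "G_function G" and diff: "G differentiable (at u)"
  shows "G u \<le> convex_conjugate (convex_conjugate G) u"
proof -
  have cvx: "convex_on UNIV G" using G by (simp add: G_function_def)
  have bdd: "bdd_above (range (\<lambda>u. u \<bullet> v - G u))" for v
    using G by (intro superlinear_conjugate_bdd G_function_continuous) (auto simp: G_function_def)
  obtain D where D: "(G has_derivative D) (at u)" using diff by (auto simp: differentiable_def)
  define p where "p = (\<Sum>i\<in>Basis. D i *\<^sub>R i)"
  have "linear D" using D by (intro bounded_linear.linear has_derivative_bounded_linear)
  then have "D h = h \<bullet> p" for h
    by (subst euclidean_representation[symmetric, of h])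
      (simp add: linear_sum linear_cmul p_def inner_sum_left inner_sum_right mult.commute)
  then have "D = (\<lambda>h. h \<bullet> p)" by (rule ext)
  with D have gd: "GDERIV G u :> p" by (simp add: gderiv_def)
  have tangent: "G u + p \<bullet> (w - u) \<le> G w" for w
  proof -
    have "((\<lambda>s. (G (u + s *\<^sub>R (w - u)) - G u) / s) \<longlongrightarrow> p \<bullet> (w - u)) (at_right 0)"
      using GDERIV_directional[OF gd] by (rule filterlim_mono) (auto simp: at_le)
    moreover have "\<forall>\<^sub>F s in at_right 0. (G (u + s *\<^sub>R (w - u)) - G u) / s \<le> G w - G u"
    proof (rule eventually_at_rightI[of 0 1])
      fix s :: real assume s: "s \<in> {0<..<1}"
      have "u + s *\<^sub>R (w - u) = (1 - s) *\<^sub>R u + s *\<^sub>R w" by (simp add: algebra_simps)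
      then have "G (u + s *\<^sub>R (w - u)) \<le> (1 - s) * G u + s * G w"
        using convex_onD[OF cvx, of s u w] s by simp
      then show "(G (u + s *\<^sub>R (w - u)) - G u) / s \<le> G w - G u"
        using s by (subst pos_divide_le_eq) (simp_all add: algebra_simps)
    qed simp
    ultimately have "p \<bullet> (w - u) \<le> G w - G u" by (rule tendsto_upperbound) simp
    then show ?thesis by linarith
  qed
  have "convex_conjugate G p \<le> u \<bullet> p - G u"
  proof (rule convex_conjugate_least)
    fix w show "w \<bullet> p - G w \<le> u \<bullet> p - G u"
      using tangent[of w] by (simp add: inner_diff_right inner_commute)
  qed
  moreover have "p \<bullet> u - convex_conjugate G p \<le> convex_conjugate (convex_conjugate G) u"
  proof (rule convex_conjugate_upper, rule bdd_aboveI2)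
    fix x show "x \<bullet> u - convex_conjugate G x \<le> G u"
      using convex_conjugate_upper[OF bdd, of u x] by (simp add: inner_commute)
  qed
  ultimately show ?thesis by (simp add: inner_commute)
qed

section \<open>Orlicz spaces of a Young function\<close>

text \<open>Both G and its conjugate are instances. The growth clause keeps as much of
  superlinearity as embeds the Orlicz space in L^1.\<close>

locale young_function =
  fixes \<Phi> :: "'a::euclidean_space \<Rightarrow> real" and T :: real
  assumes convex: "convex_on UNIV \<Phi>" and nonneg: "\<And>x. 0 \<le> \<Phi> x" and zero: "\<Phi> 0 = 0"
    and even: "\<And>x. \<Phi> (- x) = \<Phi> x" and growth: "\<exists>C. \<forall>x. norm x \<le> \<Phi> x + C" and T_pos: "0 < T"
begin

abbreviation M :: "real measure" where "M \<equiv> lebesgue_on {0..T}"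

lemma finite_M: "finite_measure M"
  by (intro finite_measure_lebesgue_on) simp

lemma continuous: "continuous_on UNIV \<Phi>"
  using convex by (intro convex_on_continuous) auto

lemma measurable_compose_Phi: "w \<in> borel_measurable M \<Longrightarrow> (\<lambda>t. \<Phi> (w t)) \<in> borel_measurable M"
  using measurable_compose[OF _ borel_measurable_continuous_onI[OF continuous]] .

lemma integrable_Phi_iff:
  "w \<in> borel_measurable M \<Longrightarrow> integrable M (\<lambda>t. \<Phi> (w t)) \<longleftrightarrow> (\<integral>\<^sup>+t. ennreal (\<Phi> (w t)) \<partial>M) < \<infinity>"
  using measurable_compose_Phi by (simp add: integrable_iff_bounded nonneg)

lemma nn_integral_Phi_le_1_iff:
  assumes "w \<in> borel_measurable M"
  shows "(\<integral>\<^sup>+t. ennreal (\<Phi> (w t)) \<partial>M) \<le> 1 \<longleftrightarrow> integrable M (\<lambda>t. \<Phi> (w t)) \<and> (LINT t|M. \<Phi> (w t)) \<le> 1"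
proof -
  have "integrable M (\<lambda>t. \<Phi> (w t))" if "(\<integral>\<^sup>+t. ennreal (\<Phi> (w t)) \<partial>M) \<le> 1"
    unfolding integrable_Phi_iff[OF assms] using that by (rule le_less_trans) simp
  moreover have "(\<integral>\<^sup>+t. ennreal (\<Phi> (w t)) \<partial>M) = ennreal (LINT t|M. \<Phi> (w t))" if "integrable M (\<lambda>t. \<Phi> (w t))"
    using that by (intro nn_integral_eq_integral) (simp_all add: nonneg)
  ultimately show ?thesis by auto
qed

lemma convex_comb: "0 \<le> s \<Longrightarrow> s \<le> 1 \<Longrightarrow> \<Phi> ((1 - s) *\<^sub>R x + s *\<^sub>R y) \<le> (1 - s) * \<Phi> x + s * \<Phi> y"
  using convex_onD[OF convex] by simp

lemma scale_le: "0 \<le> s \<Longrightarrow> s \<le> 1 \<Longrightarrow> \<Phi> (s *\<^sub>R x) \<le> s * \<Phi> x"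
  using convex_comb[of s 0 x] by (simp add: zero)

lemma integrable_convex_comb:
  assumes "x \<in> borel_measurable M" "y \<in> borel_measurable M"
    and "integrable M (\<lambda>t. \<Phi> (x t))" "integrable M (\<lambda>t. \<Phi> (y t))" "0 \<le> s" "s \<le> 1"
  shows "integrable M (\<lambda>t. \<Phi> ((1 - s) *\<^sub>R x t + s *\<^sub>R y t))"
proof (rule Bochner_Integration.integrable_bound)
  show "integrable M (\<lambda>t. (1 - s) * \<Phi> (x t) + s * \<Phi> (y t))" using assms by simp
  show "(\<lambda>t. \<Phi> ((1 - s) *\<^sub>R x t + s *\<^sub>R y t)) \<in> borel_measurable M"
    using assms by (intro measurable_compose_Phi borel_measurable_add borel_measurable_scaleR borel_measurable_const)
  show "AE t in M. norm (\<Phi> ((1 - s) *\<^sub>R x t + s *\<^sub>R y t)) \<le> norm ((1 - s) * \<Phi> (x t) + s * \<Phi> (y t))"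
    using convex_comb[OF assms(5,6)] nonneg by (intro AE_I2) (smt (verit) real_norm_def)
qed

lemma Orlicz_iff:
  "u \<in> Orlicz \<Phi> T \<longleftrightarrow> u \<in> borel_measurable M \<and> (\<exists>k>0. integrable M (\<lambda>t. \<Phi> (k *\<^sub>R u t)))"
proof -
  have "(\<integral>\<^sup>+t. ennreal (\<Phi> (k *\<^sub>R u t)) \<partial>M) < \<infinity> \<longleftrightarrow> integrable M (\<lambda>t. \<Phi> (k *\<^sub>R u t))"
    if "u \<in> borel_measurable M" for k
    using that integrable_Phi_iff[of "\<lambda>t. k *\<^sub>R u t"] by simp
  then show ?thesis unfolding Orlicz_def by auto
qed

lemma integrable_Phi_bounded:
  assumes "u \<in> borel_measurable M" "AE t in M. norm (u t) \<le> B"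
  shows "integrable M (\<lambda>t. \<Phi> (u t))"
proof -
  have "bounded (\<Phi> ` cball 0 B)"
    by (intro compact_imp_bounded compact_continuous_image continuous_on_subset[OF continuous]) auto
  then obtain b where "\<And>x. norm x \<le> B \<Longrightarrow> norm (\<Phi> x) \<le> b" unfolding bounded_iff by (metis imageI mem_cball_0)
  then have "AE t in M. norm (\<Phi> (u t)) \<le> b" using assms(2) by auto
  then show ?thesis
    using finite_M assms(1) by (intro finite_measure.integrable_const_bound measurable_compose_Phi)
qed

lemma Orlicz_bounded:
  assumes "u \<in> borel_measurable M" "AE t in M. norm (u t) \<le> B"
  shows "u \<in> Orlicz \<Phi> T"
  unfolding Orlicz_iff
  using integrable_Phi_bounded[OF assms] assms(1) by (intro conjI exI[of _ 1]) auto

lemma Orlicz_integrable: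
  assumes "u \<in> Orlicz \<Phi> T"
  shows "integrable M u"
proof -
  obtain k where k: "k > 0" "integrable M (\<lambda>t. \<Phi> (k *\<^sub>R u t))" and u: "u \<in> borel_measurable M"
    using assms unfolding Orlicz_iff by blast
  obtain C where C: "\<And>x. norm x \<le> \<Phi> x + C" using growth by blast
  show ?thesis
  proof (rule Bochner_Integration.integrable_bound[OF _ u])
    show "integrable M (\<lambda>t. (\<Phi> (k *\<^sub>R u t) + C) / k)"
      using k finite_measure.integrable_const[OF finite_M] by simp
    have "norm (u t) \<le> (\<Phi> (k *\<^sub>R u t) + C) / k" for t
      using C[of "k *\<^sub>R u t"] k by (simp add: pos_le_divide_eq mult.commute)
    then show "AE t in M. norm (u t) \<le> norm ((\<Phi> (k *\<^sub>R u t) + C) / k)"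
      by (intro AE_I2) (smt (verit) real_norm_def)
  qed
qed

lemma Orlicz_diff_bounded:
  assumes u: "u \<in> Orlicz \<Phi> T" and w: "w \<in> L_infinity T"
  shows "(\<lambda>t. u t - w t) \<in> Orlicz \<Phi> T"
proof -
  obtain k where k: "k > 0" "integrable M (\<lambda>t. \<Phi> (k *\<^sub>R u t))" and um: "u \<in> borel_measurable M"
    using u unfolding Orlicz_iff by blast
  obtain B where wm: "w \<in> borel_measurable M" and B: "AE t in M. norm (w t) \<le> B"
    using w unfolding L_infinity_def by blast
  have "AE t in M. norm (- k *\<^sub>R w t) \<le> k * B" using B k by auto
  then have "integrable M (\<lambda>t. \<Phi> (- k *\<^sub>R w t))"
    using wm by (intro integrable_Phi_bounded) auto
  then have "integrable M (\<lambda>t. \<Phi> ((1 - 1/2) *\<^sub>R (k *\<^sub>R u t) + (1/2) *\<^sub>R (- k *\<^sub>R w t)))"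
    using k um wm by (intro integrable_convex_comb) auto
  moreover have "(1 - 1/2) *\<^sub>R (k *\<^sub>R u t) + (1/2) *\<^sub>R (- k *\<^sub>R w t) = (k/2) *\<^sub>R (u t - w t)" for t
    by (simp add: algebra_simps)
  ultimately show ?thesis
    unfolding Orlicz_iff using k um wm by (intro conjI exI[of _ "k/2"]) auto
qed

text \<open>The competitors of the Luxemburg infimum, in terms of the Bochner integral.
  Integrability is a separate clause because a nonintegrable function would have integral 0 and pass
  the bound.\<close>

definition admissible :: "(real \<Rightarrow> 'a) \<Rightarrow> real \<Rightarrow> bool" where
  "admissible u k \<longleftrightarrow> 0 < k \<and> integrable M (\<lambda>t. \<Phi> (u t /\<^sub>R k)) \<and> (LINT t|M. \<Phi> (u t /\<^sub>R k)) \<le> 1"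

lemma Luxemburg_eq: "u \<in> borel_measurable M \<Longrightarrow> Luxemburg \<Phi> T u = Inf {k. admissible u k}"
  unfolding Luxemburg_def admissible_def
  using nn_integral_Phi_le_1_iff[of "\<lambda>t. u t /\<^sub>R k" for k] by simp

lemma admissible_ex:
  assumes "u \<in> Orlicz \<Phi> T"
  shows "\<exists>k. admissible u k"
proof -
  obtain k where k: "k > 0" "integrable M (\<lambda>t. \<Phi> (k *\<^sub>R u t))" and u: "u \<in> borel_measurable M"
    using assms unfolding Orlicz_iff by blast
  define I where "I = (LINT t|M. \<Phi> (k *\<^sub>R u t))"
  have I: "0 \<le> I" unfolding I_def by (intro integral_nonneg_AE AE_I2 nonneg)
  \<comment> \<open>By \<open>scale_le\<close> the factor s scales the integral I down to at most
    \<open>s * I\<close>, which is below 1; adding 1 covers I = 0.\<close>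
  define s where "s = 1 / (1 + I)"
  have s: "0 < s" "s \<le> 1" "s * I \<le> 1" using I by (auto simp: s_def field_simps)
  have le: "\<Phi> (s *\<^sub>R k *\<^sub>R u t) \<le> s * \<Phi> (k *\<^sub>R u t)" for t using s by (intro scale_le) auto
  have "integrable M (\<lambda>t. \<Phi> ((1 - s) *\<^sub>R 0 + s *\<^sub>R (k *\<^sub>R u t)))"
    using k u s by (intro integrable_convex_comb) (auto simp: zero)
  then have i: "integrable M (\<lambda>t. \<Phi> (s *\<^sub>R k *\<^sub>R u t))" by simp
  have "(LINT t|M. \<Phi> (s *\<^sub>R k *\<^sub>R u t)) \<le> (LINT t|M. s * \<Phi> (k *\<^sub>R u t))"
    using i k le by (intro integral_mono) auto
  also have "\<dots> \<le> 1" using s(3) by (simp add: I_def)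
  finally have "admissible u (1 / (s * k))"
    unfolding admissible_def using i s k by simp
  then show ?thesis by blast
qed

text \<open>Estimates are proved for every admissible k and passed to the infimum here, so its
  attainment never has to be discussed.\<close>

lemma le_Luxemburg:
  assumes "u \<in> Orlicz \<Phi> T" "0 < c" "\<And>k. admissible u k \<Longrightarrow> x \<le> c * k"
  shows "x \<le> c * Luxemburg \<Phi> T u"
proof -
  have "x / c \<le> Inf {k. admissible u k}"
    using assms admissible_ex[OF assms(1)]
    by (intro cInf_greatest) (auto simp: pos_divide_le_eq mult.commute)
  then show ?thesis
    using assms(1,2) Luxemburg_eq[of u] by (simp add: Orlicz_iff pos_divide_le_eq mult.commute)
qed

text \<open>Apply the growth clause to u / k and integrate: for admissible k the modular contributes
  at most 1 and the constant contributes \<open>C * T\<close>.\<close>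

lemma integral_norm_le_Luxemburg:
  obtains c where "c > 0" "\<And>u. u \<in> Orlicz \<Phi> T \<Longrightarrow> (LINT t|M. norm (u t)) \<le> c * Luxemburg \<Phi> T u"
proof -
  obtain C where C: "\<And>x. norm x \<le> \<Phi> x + C" using growth by blast
  have "0 \<le> C" using C[of 0] by (simp add: zero)
  have "(LINT t|M. norm (u t)) \<le> (1 + C * T) * Luxemburg \<Phi> T u" if u: "u \<in> Orlicz \<Phi> T" for u
  proof (rule le_Luxemburg[OF u])
    show "0 < 1 + C * T" using \<open>0 \<le> C\<close> T_pos by (simp add: add_pos_nonneg)
    fix k assume k: "admissible u k"
    have Ci: "integrable M (\<lambda>t. C)" using finite_measure.integrable_const[OF finite_M] .
    have "(LINT t|M. norm (u t)) \<le> (LINT t|M. k * (\<Phi> (u t /\<^sub>R k) + C))"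
    proof (rule integral_mono)
      show "integrable M (\<lambda>t. norm (u t))" using Orlicz_integrable[OF u] by simp
      show "integrable M (\<lambda>t. k * (\<Phi> (u t /\<^sub>R k) + C))"
        using k Ci by (simp add: admissible_def)
      fix t show "norm (u t) \<le> k * (\<Phi> (u t /\<^sub>R k) + C)"
      proof -
        have "norm (u t) = k * norm (u t /\<^sub>R k)" using k by (simp add: admissible_def)
        also have "\<dots> \<le> k * (\<Phi> (u t /\<^sub>R k) + C)"
          using C[of "u t /\<^sub>R k"] k unfolding admissible_def by (intro mult_left_mono) linarith+
        finally show ?thesis .
      qed
    qed
    also have "\<dots> = k * ((LINT t|M. \<Phi> (u t /\<^sub>R k)) + C * T)"
      using k Ci T_pos by (simp add: admissible_def measure_restrict_space)
    also have "\<dots> \<le> k * (1 + C * T)" using k by (simp add: admissible_def)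
    finally show "(LINT t|M. norm (u t)) \<le> (1 + C * T) * k" by (simp add: mult.commute)
  qed
  moreover have "0 < 1 + C * T" using \<open>0 \<le> C\<close> T_pos by (simp add: add_pos_nonneg)
  ultimately show thesis using that by blast
qed

text \<open>Pick a bounded w and an admissible k < r for u - w, and let r' lie strictly between k
  and r. Then u / r' is the convex combination of (u - w) / k with weight k / r' and of w / (r' -
  k). The first modular is finite by admissibility, the second since w is bounded, and \<mu> = r /
  r' exceeds 1.\<close>

lemma dist_L_infinity_less:
  assumes u: "u \<in> Orlicz \<Phi> T" and d: "dist_L_infinity \<Phi> T u < r"
  obtains \<mu> where "\<mu> > 1" "integrable M (\<lambda>t. \<Phi> ((\<mu> / r) *\<^sub>R u t))"
proof -
  have "(\<lambda>t. 0) \<in> L_infinity T" unfolding L_infinity_def by auto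
  then obtain w where w: "w \<in> L_infinity T" and lw: "Luxemburg \<Phi> T (\<lambda>t. u t - w t) < r"
    using cInf_lessD[OF _ d[unfolded dist_L_infinity_def]] by blast
  note uw = Orlicz_diff_bounded[OF u w]
  have um: "u \<in> borel_measurable M" using u by (simp add: Orlicz_iff)
  obtain B where wm: "w \<in> borel_measurable M" and B: "AE t in M. norm (w t) \<le> B"
    using w unfolding L_infinity_def by blast
  have "Inf {k. admissible (\<lambda>t. u t - w t) k} < r"
    using lw um wm by (simp add: Luxemburg_eq)
  then obtain k where k: "admissible (\<lambda>t. u t - w t) k" "k < r"
    using cInf_lessD[of "{k. admissible (\<lambda>t. u t - w t) k}" r] admissible_ex[OF uw] by blast
  have k0: "0 < k" using k(1) by (simp add: admissible_def)
  define r' where "r' = (k + r) / 2"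
  have r': "k < r'" "r' < r" using k(2) by (auto simp: r'_def)
  have "AE t in M. norm (w t /\<^sub>R (r' - k)) \<le> B / (r' - k)"
    using B
  proof eventually_elim
    case (elim t)
    then have "norm (w t) / (r' - k) \<le> B / (r' - k)" using r' by (intro divide_right_mono) auto
    then show ?case using r' by (simp add: divide_inverse_commute)
  qed
  then have "integrable M (\<lambda>t. \<Phi> (w t /\<^sub>R (r' - k)))"
    using wm by (intro integrable_Phi_bounded) auto
  then have "integrable M (\<lambda>t. \<Phi> ((1 - k/r') *\<^sub>R (w t /\<^sub>R (r' - k)) + (k/r') *\<^sub>R ((u t - w t) /\<^sub>R k)))"
    using k k0 r' um wm by (intro integrable_convex_comb) (auto simp: admissible_def)
  moreover have "(1 - k/r') *\<^sub>R (w t /\<^sub>R (r' - k)) + (k/r') *\<^sub>R ((u t - w t) /\<^sub>R k) = ((r / r') / r) *\<^sub>R u t" for t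
  proof -
    have "(1 - k/r') * inverse (r' - k) = 1 / r'" "(k / r') * inverse k = 1 / r'" "(r / r') / r = 1 / r'"
      using r' k0 by (simp_all add: field_simps)
    then show ?thesis by (simp only: scaleR_scaleR scaleR_add_right[symmetric]) simp
  qed
  ultimately have "integrable M (\<lambda>t. \<Phi> (((r / r') / r) *\<^sub>R u t))" by simp
  moreover have "r / r' > 1" using r' k0 by simp
  ultimately show thesis using that by blast
qed

end

lemma young_function_conjugate:
  fixes G :: "'a::euclidean_space \<Rightarrow> real"
  assumes G: "G_function G" and T: "0 < T"
  shows "young_function (convex_conjugate G) T"
proof
  have bdd: "bdd_above (range (\<lambda>u. u \<bullet> v - G u))" for v
    using G by (intro superlinear_conjugate_bdd G_function_continuous) (auto simp: G_function_def)
  have G0: "G 0 = 0" and Gn: "\<And>u. 0 \<le> G u" and Ge: "\<And>u. G (- u) = G u" using G by (auto simp: G_function_def)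
  show "convex_on UNIV (convex_conjugate G)" by (rule convex_on_convex_conjugate[OF bdd])
  show nn: "0 \<le> convex_conjugate G x" for x
    using convex_conjugate_upper[OF bdd, of 0 x] by (simp add: G0)
  show "convex_conjugate G 0 = 0"
    using nn[of 0] by (intro antisym convex_conjugate_least) (auto simp: Gn)
  have le: "convex_conjugate G (- x) \<le> convex_conjugate G x" for x
  proof (rule convex_conjugate_least)
    fix u show "u \<bullet> - x - G u \<le> convex_conjugate G x"
      using convex_conjugate_upper[OF bdd, of "- u" x] by (simp add: Ge)
  qed
  show "convex_conjugate G (- x) = convex_conjugate G x" for x
    using le[of x] le[of "- x"] by simp
  have "bounded (G ` cball 0 1)"
    by (intro compact_imp_bounded compact_continuous_image continuous_on_subset[OF G_function_continuous[OF G]]) auto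
  then obtain b where b: "\<And>x. norm x \<le> 1 \<Longrightarrow> norm (G x) \<le> b"
    unfolding bounded_iff by (metis imageI mem_cball_0)
  \<comment> \<open>The unit vector in the direction of x is the competitor in the supremum, and b
    bounds G on the unit ball.\<close>
  have "norm x \<le> convex_conjugate G x + b" for x
  proof -
    have "sgn x \<bullet> x = norm x"
      by (cases "x = 0") (simp_all add: sgn_div_norm power2_norm_eq_inner[symmetric] power2_eq_square)
    moreover have "norm (sgn x) \<le> 1" by (simp add: norm_sgn)
    then have "G (sgn x) \<le> b" using b by fastforce
    ultimately show ?thesis using convex_conjugate_upper[OF bdd, of "sgn x" x] by simp
  qed
  then show "\<exists>C. \<forall>x. norm x \<le> convex_conjugate G x + C" by blast
  show "0 < T" by (rule T)
qed

section \<open>The conjugate Hamiltonian\<close>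

lemma Gamma_continuous: "F \<in> \<Gamma> \<Longrightarrow> continuous_on UNIV F"
  by (auto simp: Gamma_class_def continuous_on_eq_continuous_within intro: differentiable_imp_continuous_within)

lemma Gamma_conjugate_bdd: "F \<in> \<Gamma> \<Longrightarrow> bdd_above (range (\<lambda>u. u \<bullet> v - F u))"
  by (intro superlinear_conjugate_bdd Gamma_continuous) (auto simp: Gamma_class_def)

locale dual_hamiltonian =
  fixes G :: "'a::euclidean_space \<Rightarrow> real" and H :: "real \<Rightarrow> 'a \<Rightarrow> real"
    and \<beta> \<gamma> :: "real \<Rightarrow> real" and T lam Lam :: real
  assumes G: "G_function G" and T: "0 < T"
    and H_meas: "\<And>u. (\<lambda>t. H t u) \<in> borel_measurable (lebesgue_on {0..T})"
    and H_Gamma: "\<And>t. t \<in> {0..T} \<Longrightarrow> H t \<in> \<Gamma>"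
    and beta: "integrable (lebesgue_on {0..T}) \<beta>" and gamma: "integrable (lebesgue_on {0..T}) \<gamma>"
    and lam: "0 < lam"
    and lower: "\<And>t u. t \<in> {0..T} \<Longrightarrow> G (lam *\<^sub>R u) - \<beta> t \<le> H t u"
    and upper: "\<And>t u. t \<in> {0..T} \<Longrightarrow> H t u \<le> G (Lam *\<^sub>R u) + \<gamma> t"
begin

abbreviation \<Phi> :: "'a \<Rightarrow> real" where "\<Phi> \<equiv> convex_conjugate G"
abbreviation K :: "real \<Rightarrow> 'a \<Rightarrow> real" where "K t \<equiv> convex_conjugate (H t)"

sublocale young_function \<Phi> T
  using G T by (rule young_function_conjugate)

text \<open>Conjugation reverses the lower bound on H and turns the inner factor lam into 1 / lam.
  Hence lam is the threshold for the distance to the bounded functions.\<close>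

lemma K_upper: "t \<in> {0..T} \<Longrightarrow> K t w \<le> \<Phi> (w /\<^sub>R lam) + \<beta> t"
proof (rule convex_conjugate_least)
  fix u assume t: "t \<in> {0..T}"
  have "bdd_above (range (\<lambda>u. u \<bullet> v - G u))" for v
    using G by (intro superlinear_conjugate_bdd G_function_continuous) (auto simp: G_function_def)
  then have "(lam *\<^sub>R u) \<bullet> (w /\<^sub>R lam) - G (lam *\<^sub>R u) \<le> \<Phi> (w /\<^sub>R lam)"
    by (rule convex_conjugate_upper)
  moreover have "(lam *\<^sub>R u) \<bullet> (w /\<^sub>R lam) = u \<bullet> w" using lam by simp
  ultimately show "u \<bullet> w - H t u \<le> \<Phi> (w /\<^sub>R lam) + \<beta> t"
    using lower[OF t, of u] by linarith
qed

text \<open>The competitor u = 0 and the upper bound on H at 0, where G vanishes, give a minorant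
  independent of w.\<close>

lemma K_lower: "t \<in> {0..T} \<Longrightarrow> - \<gamma> t \<le> K t w"
proof -
  assume t: "t \<in> {0..T}"
  have "G 0 = 0" using G by (simp add: G_function_def)
  with convex_conjugate_upper[OF Gamma_conjugate_bdd[OF H_Gamma[OF t]], of 0 w] upper[OF t, of 0]
  show ?thesis by simp
qed

lemma K_convex: "t \<in> {0..T} \<Longrightarrow> convex_on UNIV (K t)"
  by (intro convex_on_convex_conjugate Gamma_conjugate_bdd H_Gamma)

lemma
  assumes "t \<in> {0..T}"
  shows K_GDERIV: "GDERIV (K t) v :> gradient (K t) v"
    and H_GDERIV: "GDERIV (H t) (gradient (K t) v) :> v"
    and K_subgradient: "K t v + gradient (K t) v \<bullet> (v' - v) \<le> K t v'"
proof -
  obtain u where u: "GDERIV (K t) v :> u" "GDERIV (H t) u :> v" "\<And>v'. K t v + u \<bullet> (v' - v) \<le> K t v'"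
    using Gamma_conjugate_GDERIV[OF H_Gamma[OF assms]] by blast
  moreover have "gradient (K t) v = u" using u(1) by (rule gradient_eq)
  ultimately show "GDERIV (K t) v :> gradient (K t) v" "GDERIV (H t) (gradient (K t) v) :> v"
    "K t v + gradient (K t) v \<bullet> (v' - v) \<le> K t v'" by simp_all
qed

lemma K_measurable:
  assumes w: "w \<in> borel_measurable M"
  shows "(\<lambda>t. K t (w t)) \<in> borel_measurable M"
proof -
  obtain D :: "'a set" where D: "countable D" "\<And>X. open X \<Longrightarrow> X \<noteq> {} \<Longrightarrow> \<exists>d\<in>D. d \<in> X"
    using countable_dense_setE by blast
  have eq: "K t (w t) = (SUP u\<in>D. u \<bullet> w t - H t u)" if "t \<in> space M" for t
    using that by (intro convex_conjugate_dense[OF Gamma_continuous Gamma_conjugate_bdd D(2)] H_Gamma) auto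
  have "(\<lambda>t. SUP u\<in>D. u \<bullet> w t - H t u) \<in> borel_measurable M"
  proof (rule borel_measurable_cSUP[OF D(1)])
    show "(\<lambda>t. u \<bullet> w t - H t u) \<in> borel_measurable M" for u
      using w H_meas by (intro borel_measurable_diff borel_measurable_inner borel_measurable_const)
    show "bdd_above ((\<lambda>u. u \<bullet> w t - H t u) ` D)" if "t \<in> space M" for t
      using that by (intro bdd_above_mono[OF Gamma_conjugate_bdd[OF H_Gamma]]) auto
  qed
  with eq show ?thesis by (subst measurable_cong)
qed

text \<open>The pairing is a pointwise limit of difference quotients of \<open>K t\<close>, whose
  measurability is known even though \<open>gradient\<close> is a definite description.\<close>

lemma gradient_inner_measurable:
  assumes a: "a \<in> borel_measurable M" and b: "b \<in> borel_measurable M"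
  shows "(\<lambda>t. gradient (K t) (a t) \<bullet> b t) \<in> borel_measurable M"
proof (rule borel_measurable_LIMSEQ_real)
  let ?s = "\<lambda>n. inverse (real (Suc n))"
  show "(\<lambda>n. (K t (a t + ?s n *\<^sub>R b t) - K t (a t)) / ?s n) \<longlonglongrightarrow> gradient (K t) (a t) \<bullet> b t"
    if "t \<in> space M" for t
  proof (rule filterlim_compose[OF GDERIV_directional[OF K_GDERIV]])
    show "filterlim ?s (at 0) sequentially"
      using LIMSEQ_inverse_real_of_nat by (intro filterlim_atI) auto
  qed (use that in simp)
  show "(\<lambda>t. (K t (a t + ?s n *\<^sub>R b t) - K t (a t)) / ?s n) \<in> borel_measurable M" for n
    using a b by (intro borel_measurable_divide borel_measurable_diff K_measurable
        borel_measurable_add borel_measurable_scaleR borel_measurable_const)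
qed

text \<open>The step \<open>\<epsilon> / k\<close> is chosen so that \<open>(a + (\<epsilon> / k) b) / lam\<close> is the convex combination of
  \<open>(\<mu> / lam) a\<close> and \<open>b / k\<close> with weights \<open>1 / \<mu>\<close> and \<open>1 - 1 / \<mu>\<close>.\<close>
context
  fixes a :: "real \<Rightarrow> 'a" and \<mu> \<epsilon> :: real
  assumes a: "a \<in> borel_measurable M" and mu: "\<mu> > 1" and a_int: "integrable M (\<lambda>t. \<Phi> ((\<mu> / lam) *\<^sub>R a t))"
  defines "\<epsilon> \<equiv> lam * (1 - 1 / \<mu>)"
begin

lemma eps_pos: "0 < \<epsilon>"
  using lam mu by (simp add: \<epsilon>_def)

lemma K_shift_upper:
  assumes t: "t \<in> {0..T}" and k: "0 < k"
  shows "K t (x + (\<epsilon> / k) *\<^sub>R y) \<le> \<Phi> ((\<mu> / lam) *\<^sub>R x) + \<Phi> (y /\<^sub>R k) + \<beta> t"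
proof -
  define \<sigma> where "\<sigma> = 1 - 1 / \<mu>"
  have s: "0 \<le> \<sigma>" "\<sigma> \<le> 1" using mu by (auto simp: \<sigma>_def)
  have "(x + (\<epsilon> / k) *\<^sub>R y) /\<^sub>R lam = (1 - \<sigma>) *\<^sub>R ((\<mu> / lam) *\<^sub>R x) + \<sigma> *\<^sub>R (y /\<^sub>R k)"
    using lam mu k by (simp add: \<sigma>_def \<epsilon>_def scaleR_add_right field_simps)
  then have "\<Phi> ((x + (\<epsilon> / k) *\<^sub>R y) /\<^sub>R lam) \<le> (1 - \<sigma>) * \<Phi> ((\<mu> / lam) *\<^sub>R x) + \<sigma> * \<Phi> (y /\<^sub>R k)"
    using convex_comb[OF s] by metis
  also have "\<dots> \<le> 1 * \<Phi> ((\<mu> / lam) *\<^sub>R x) + 1 * \<Phi> (y /\<^sub>R k)"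
    using s nonneg by (intro add_mono mult_right_mono) auto
  finally show ?thesis using K_upper[OF t, of "x + (\<epsilon> / k) *\<^sub>R y"] by linarith
qed

lemma K_integrable_shift:
  assumes b: "b \<in> borel_measurable M" and k: "0 < k" and b_int: "integrable M (\<lambda>t. \<Phi> (b t /\<^sub>R k))"
  shows "integrable M (\<lambda>t. K t (a t + (\<epsilon> / k) *\<^sub>R b t))"
proof (rule Bochner_Integration.integrable_bound)
  show "integrable M (\<lambda>t. \<Phi> ((\<mu> / lam) *\<^sub>R a t) + \<Phi> (b t /\<^sub>R k) + \<bar>\<beta> t\<bar> + \<bar>\<gamma> t\<bar>)"
    using a_int b_int beta gamma by simp
  show "(\<lambda>t. K t (a t + (\<epsilon> / k) *\<^sub>R b t)) \<in> borel_measurable M"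
    using a b by (intro K_measurable borel_measurable_add borel_measurable_scaleR borel_measurable_const)
  show "AE t in M. norm (K t (a t + (\<epsilon> / k) *\<^sub>R b t))
      \<le> norm (\<Phi> ((\<mu> / lam) *\<^sub>R a t) + \<Phi> (b t /\<^sub>R k) + \<bar>\<beta> t\<bar> + \<bar>\<gamma> t\<bar>)"
  proof (rule AE_I2)
    fix t assume "t \<in> space M"
    then have t: "t \<in> {0..T}" by simp
    show "norm (K t (a t + (\<epsilon> / k) *\<^sub>R b t)) \<le> norm (\<Phi> ((\<mu> / lam) *\<^sub>R a t) + \<Phi> (b t /\<^sub>R k) + \<bar>\<beta> t\<bar> + \<bar>\<gamma> t\<bar>)"
      using K_shift_upper[OF t k, of "a t" "b t"] K_lower[OF t, of "a t + (\<epsilon> / k) *\<^sub>R b t"]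
        nonneg[of "(\<mu> / lam) *\<^sub>R a t"] nonneg[of "b t /\<^sub>R k"]
      unfolding real_norm_def by linarith
  qed
qed

lemma K_integrable: "integrable M (\<lambda>t. K t (a t))"
  using K_integrable_shift[of "\<lambda>t. 0" 1] by (simp add: zero)

text \<open>Test the subgradient inequality at x with the step \<open>(\<epsilon> / k) y\<close> and
  bound the increment of \<open>K t\<close> from both sides; evenness of \<open>\<Phi>\<close>
  covers -y. Multiplying by k / \<epsilon> puts k in front, ready for the passage to the Luxemburg
  norm.\<close>

lemma gradient_inner_bound:
  assumes t: "t \<in> {0..T}" and k: "0 < k"
  shows "\<bar>gradient (K t) x \<bullet> y\<bar> \<le> k / \<epsilon> * (\<Phi> ((\<mu> / lam) *\<^sub>R x) + \<Phi> (y /\<^sub>R k) + \<beta> t + \<gamma> t)"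
proof -
  have *: "gradient (K t) x \<bullet> z \<le> k / \<epsilon> * (\<Phi> ((\<mu> / lam) *\<^sub>R x) + \<Phi> (z /\<^sub>R k) + \<beta> t + \<gamma> t)" for z
  proof -
    have "K t x + gradient (K t) x \<bullet> ((\<epsilon> / k) *\<^sub>R z) \<le> K t (x + (\<epsilon> / k) *\<^sub>R z)"
      using K_subgradient[OF t, of x "x + (\<epsilon> / k) *\<^sub>R z"] by simp
    then have "\<epsilon> / k * (gradient (K t) x \<bullet> z) \<le> \<Phi> ((\<mu> / lam) *\<^sub>R x) + \<Phi> (z /\<^sub>R k) + \<beta> t + \<gamma> t"
      using K_shift_upper[OF t k, of x z] K_lower[OF t, of x] by simp
    then show ?thesis using k eps_pos by (simp add: field_simps)
  qed
  have "\<Phi> (- y /\<^sub>R k) = \<Phi> (y /\<^sub>R k)" using even[of "y /\<^sub>R k"] by simp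
  with *[of y] *[of "- y"] show ?thesis by (intro abs_leI) auto
qed

lemma gradient_inner_integrable:
  assumes b: "b \<in> Orlicz \<Phi> T"
  shows "integrable M (\<lambda>t. gradient (K t) (a t) \<bullet> b t)"
proof -
  have bm: "b \<in> borel_measurable M" using b by (simp add: Orlicz_iff)
  obtain k where k: "admissible b k" using admissible_ex[OF b] by blast
  show ?thesis
  proof (rule Bochner_Integration.integrable_bound[OF _ gradient_inner_measurable[OF a bm]])
    show "integrable M (\<lambda>t. k / \<epsilon> * (\<Phi> ((\<mu> / lam) *\<^sub>R a t) + \<Phi> (b t /\<^sub>R k) + \<beta> t + \<gamma> t))"
      using a_int beta gamma k by (simp add: admissible_def)
    show "AE t in M. norm (gradient (K t) (a t) \<bullet> b t)
        \<le> norm (k / \<epsilon> * (\<Phi> ((\<mu> / lam) *\<^sub>R a t) + \<Phi> (b t /\<^sub>R k) + \<beta> t + \<gamma> t))"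
    proof (rule AE_I2)
      fix t assume "t \<in> space M"
      then have "\<bar>gradient (K t) (a t) \<bullet> b t\<bar> \<le> k / \<epsilon> * (\<Phi> ((\<mu> / lam) *\<^sub>R a t) + \<Phi> (b t /\<^sub>R k) + \<beta> t + \<gamma> t)"
        using k by (intro gradient_inner_bound) (auto simp: admissible_def)
      then show "norm (gradient (K t) (a t) \<bullet> b t)
          \<le> norm (k / \<epsilon> * (\<Phi> ((\<mu> / lam) *\<^sub>R a t) + \<Phi> (b t /\<^sub>R k) + \<beta> t + \<gamma> t))"
        unfolding real_norm_def by linarith
    qed
  qed
qed

lemma gradient_integral_bound:
  obtains c where "c > 0"
    "\<And>b. b \<in> Orlicz \<Phi> T \<Longrightarrow> \<bar>LINT t|M. gradient (K t) (a t) \<bullet> b t\<bar> \<le> c * Luxemburg \<Phi> T b"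
proof -
  define m where "m = (LINT t|M. \<Phi> ((\<mu> / lam) *\<^sub>R a t)) + (LINT t|M. \<beta> t) + (LINT t|M. \<gamma> t)"
  \<comment> \<open>The 1 is the bound on the modular of b / k for admissible k; it also makes c
    positive.\<close>
  define c where "c = (\<bar>m\<bar> + 1) / \<epsilon>"
  have c: "c > 0" using eps_pos by (simp add: c_def add_nonneg_pos)
  have "\<bar>LINT t|M. gradient (K t) (a t) \<bullet> b t\<bar> \<le> c * Luxemburg \<Phi> T b" if b: "b \<in> Orlicz \<Phi> T" for b
  proof (rule le_Luxemburg[OF b c])
    fix k assume k: "admissible b k"
    then have k0: "0 < k" and ki: "integrable M (\<lambda>t. \<Phi> (b t /\<^sub>R k))" "(LINT t|M. \<Phi> (b t /\<^sub>R k)) \<le> 1"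
      by (auto simp: admissible_def)
    have "\<bar>LINT t|M. gradient (K t) (a t) \<bullet> b t\<bar> \<le> (LINT t|M. \<bar>gradient (K t) (a t) \<bullet> b t\<bar>)"
      by (rule integral_abs_bound)
    also have "\<dots> \<le> (LINT t|M. k / \<epsilon> * (\<Phi> ((\<mu> / lam) *\<^sub>R a t) + \<Phi> (b t /\<^sub>R k) + \<beta> t + \<gamma> t))"
      using gradient_inner_integrable[OF b] a_int ki beta gamma gradient_inner_bound[OF _ k0]
      by (intro integral_mono) auto
    also have "\<dots> = k / \<epsilon> * (m + (LINT t|M. \<Phi> (b t /\<^sub>R k)))"
      using a_int ki(1) beta gamma by (simp add: m_def)
    also have "\<dots> \<le> k / \<epsilon> * (\<bar>m\<bar> + 1)"
      using ki(2) k0 eps_pos by (intro mult_left_mono) auto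
    also have "\<dots> = c * k" by (simp add: c_def)
    finally show "\<bar>LINT t|M. gradient (K t) (a t) \<bullet> b t\<bar> \<le> c * k" .
  qed
  with c that show thesis by blast
qed

text \<open>The first claim makes the second meaningful: without integrability at the shifted points
  the integrals there would be default zeros, and the dual action could not be split into its
  quadratic and conjugate parts.\<close>

lemma K_gateaux:
  assumes b: "b \<in> Orlicz \<Phi> T"
  shows "\<forall>\<^sub>F s in at 0. integrable M (\<lambda>t. K t (a t + s *\<^sub>R b t))"
    and "((\<lambda>s. ((LINT t|M. K t (a t + s *\<^sub>R b t)) - (LINT t|M. K t (a t))) / s)
           \<longlongrightarrow> (LINT t|M. gradient (K t) (a t) \<bullet> b t)) (at 0)"
proof -
  have bm: "b \<in> borel_measurable M" using b by (simp add: Orlicz_iff)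
  obtain k where "admissible b k" using admissible_ex[OF b] by blast
  then have k0: "0 < k" and ki: "integrable M (\<lambda>t. \<Phi> (b t /\<^sub>R k))" by (auto simp: admissible_def)
  define r where "r = \<epsilon> / k"
  have r: "r > 0" using k0 eps_pos by (simp add: r_def)
  have i1: "integrable M (\<lambda>t. K t (a t + r *\<^sub>R b t))"
    unfolding r_def by (rule K_integrable_shift[OF bm k0 ki])
  have "integrable M (\<lambda>t. K t (a t + r *\<^sub>R (- b t)))"
    unfolding r_def using bm ki even[of "b t /\<^sub>R k" for t] by (intro K_integrable_shift k0) auto
  then have i2: "integrable M (\<lambda>t. K t (a t - r *\<^sub>R b t))" by simp
  define w where "w = (\<lambda>t. (\<bar>K t (a t + r *\<^sub>R b t) - K t (a t)\<bar> + \<bar>K t (a t - r *\<^sub>R b t) - K t (a t)\<bar>) / r)"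
  have wi: "integrable M w" unfolding w_def using i1 i2 K_integrable by simp
  define q where "q = (\<lambda>s t. (K t (a t + s *\<^sub>R b t) - K t (a t)) / s)"
  have qm: "q s \<in> borel_measurable M" for s
    unfolding q_def using a bm by (intro borel_measurable_divide borel_measurable_diff K_measurable
        borel_measurable_add borel_measurable_scaleR borel_measurable_const)
  have qw: "AE t in M. norm (q s t) \<le> w t" if "s \<noteq> 0" "\<bar>s\<bar> \<le> r" for s
    unfolding q_def w_def real_norm_def
    using convex_difference_quotient_bound[OF K_convex that] by (intro AE_I2) simp
  have qi: "integrable M (q s)" if "s \<noteq> 0" "\<bar>s\<bar> \<le> r" for s
  proof (rule Bochner_Integration.integrable_bound[OF wi qm])
    show "AE t in M. norm (q s t) \<le> norm (w t)" using qw[OF that] by (auto elim!: eventually_mono)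
  qed
  have Ki: "integrable M (\<lambda>t. K t (a t + s *\<^sub>R b t))" if "s \<noteq> 0" "\<bar>s\<bar> \<le> r" for s
  proof -
    have "integrable M (\<lambda>t. s * q s t + K t (a t))" using qi[OF that] K_integrable by simp
    then show ?thesis using that by (simp add: q_def)
  qed
  have ev: "\<forall>\<^sub>F s in at 0. s \<noteq> 0 \<and> \<bar>s\<bar> \<le> r"
    using r unfolding eventually_at by (intro exI[of _ r]) (auto simp: dist_real_def)
  show "\<forall>\<^sub>F s in at 0. integrable M (\<lambda>t. K t (a t + s *\<^sub>R b t))"
    using ev by eventually_elim (use Ki in blast)
  \<comment> \<open>Dominated convergence works along sequences and needs every term dominated.
    Restricting s to this interval keeps each term in the range where w dominates; as the interval
    is open around 0, the full limit follows.\<close>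
  have lim: "((\<lambda>s. LINT t|M. q s t) \<longlongrightarrow> (LINT t|M. gradient (K t) (a t) \<bullet> b t)) (at 0 within {-r<..<r})"
    unfolding tendsto_at_iff_sequentially o_def
  proof (intro allI impI)
    fix X :: "nat \<Rightarrow> real" assume X: "\<forall>i. X i \<in> {-r<..<r} - {0}" "X \<longlonglongrightarrow> 0"
    show "(\<lambda>i. LINT t|M. q (X i) t) \<longlonglongrightarrow> (LINT t|M. gradient (K t) (a t) \<bullet> b t)"
    proof (rule integral_dominated_convergence[OF gradient_inner_measurable[OF a bm] qm wi])
      have "filterlim X (at 0) sequentially" using X by (intro filterlim_atI) auto
      then show "AE t in M. (\<lambda>i. q (X i) t) \<longlonglongrightarrow> gradient (K t) (a t) \<bullet> b t"
        unfolding q_def by (intro AE_I2 filterlim_compose[OF GDERIV_directional[OF K_GDERIV]]) auto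
      show "AE t in M. norm (q (X i) t) \<le> w t" for i
        using X(1)[rule_format, of i] by (intro qw) auto
    qed
  qed
  then have lim: "((\<lambda>s. LINT t|M. q s t) \<longlongrightarrow> (LINT t|M. gradient (K t) (a t) \<bullet> b t)) (at 0)"
    using r by (simp add: at_within_open[of 0 "{-r<..<r}"])
  moreover have "\<forall>\<^sub>F s in at 0. (LINT t|M. q s t) = ((LINT t|M. K t (a t + s *\<^sub>R b t)) - (LINT t|M. K t (a t))) / s"
    using ev by eventually_elim (use Ki K_integrable in \<open>simp add: q_def\<close>)
  ultimately show "((\<lambda>s. ((LINT t|M. K t (a t + s *\<^sub>R b t)) - (LINT t|M. K t (a t))) / s)
           \<longlongrightarrow> (LINT t|M. gradient (K t) (a t) \<bullet> b t)) (at 0)"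
    by (rule Lim_transform_eventually)
qed

end

end

section \<open>The dual action\<close>

lemma young_function_G_function:
  fixes G :: "'a::euclidean_space \<Rightarrow> real"
  assumes G: "G_function G" and T: "0 < T"
  shows "young_function G T"
proof
  show "convex_on UNIV G" "\<And>x. 0 \<le> G x" "G 0 = 0" "\<And>x. G (- x) = G x" "0 < T"
    using G T by (auto simp: G_function_def)
  obtain C where C: "\<And>u. 1 * norm u - C \<le> G u"
    using superlinear_linear_bound[OF _ G_function_continuous[OF G], of 1] G
    unfolding G_function_def by blast
  have "norm x \<le> G x + C" for x using C[of x] by simp
  then show "\<exists>C. \<forall>x. norm x \<le> G x + C" by blast
qed

lemma abs_continuous_add_const:
  assumes "abs_continuous a b f"
  shows "abs_continuous a b (\<lambda>t. f t + c)"
  by (rule abs_continuous_comparison[OF assms assms, of _ 1]) simp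

lemma integral_lebesgue_on_AE:
  fixes f g :: "'a::euclidean_space \<Rightarrow> 'b::{banach, second_countable_topology}"
  assumes f: "integrable (lebesgue_on S) f" and S: "S \<in> sets lebesgue" and eq: "AE t in lebesgue_on S. f t = g t"
  shows "(LINT t|lebesgue_on S. g t) = (LINT t|lebesgue_on S. f t)"
  using f integrable_lebesgue_on_AE[OF f S eq] eq
  by (intro integral_cong_AE) (auto elim: eventually_mono)

lemma integrable_inner_continuous:
  fixes f g :: "real \<Rightarrow> 'a::euclidean_space"
  assumes f: "integrable (lebesgue_on {a..b}) f" and g: "continuous_on {a..b} g"
  shows "integrable (lebesgue_on {a..b}) (\<lambda>t. f t \<bullet> g t)"
proof -
  have "bounded (g ` {a..b})" using g by (intro compact_imp_bounded compact_continuous_image) auto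
  then obtain B where B: "\<And>t. t \<in> {a..b} \<Longrightarrow> norm (g t) \<le> B" unfolding bounded_iff by blast
  have gm: "g \<in> borel_measurable (lebesgue_on {a..b})"
    using g by (intro continuous_imp_measurable_on_sets_lebesgue) auto
  show ?thesis
  proof (rule Bochner_Integration.integrable_bound)
    show "integrable (lebesgue_on {a..b}) (\<lambda>t. B * norm (f t))" using f by simp
    show "(\<lambda>t. f t \<bullet> g t) \<in> borel_measurable (lebesgue_on {a..b})"
      using f gm by (intro borel_measurable_inner) auto
    show "AE t in lebesgue_on {a..b}. norm (f t \<bullet> g t) \<le> norm (B * norm (f t))"
    proof (rule AE_I2)
      fix t assume "t \<in> space (lebesgue_on {a..b})"
      then have "norm (g t) \<le> B" using B by simp
      have "norm (f t \<bullet> g t) \<le> norm (f t) * norm (g t)" by (simp add: Cauchy_Schwarz_ineq2)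
      also have "\<dots> \<le> norm (f t) * B" using \<open>norm (g t) \<le> B\<close> by (intro mult_left_mono) auto
      finally show "norm (f t \<bullet> g t) \<le> norm (B * norm (f t))" by (simp add: mult.commute)
    qed
  qed
qed

section \<open>Du Bois-Reymond's lemma\<close>

context young_function
begin

lemma Orlicz_abs_continuous:
  assumes "abs_continuous 0 T h"
  shows "h \<in> Orlicz \<Phi> T"
proof -
  have c: "continuous_on {0..T} h" using assms by (rule abs_continuous_imp_continuous_on)
  have "bounded (h ` {0..T})" using c by (intro compact_imp_bounded compact_continuous_image) auto
  then obtain B where "\<And>t. t \<in> {0..T} \<Longrightarrow> norm (h t) \<le> B" unfolding bounded_iff by blast
  then have "AE t in M. norm (h t) \<le> B" by (intro AE_I2) simp
  then show ?thesis
    using c by (intro Orlicz_bounded continuous_imp_measurable_on_sets_lebesgue) auto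
qed

text \<open>Du Bois-Reymond's lemma. The test function is a primitive of \<open>arctan (g \<bullet> e) - m\<close>, with \<open>m\<close> the
  mean of \<open>arctan (g \<bullet> e)\<close>; its derivative is bounded, and monotonicity of \<open>arctan\<close> makes
  \<open>(g \<bullet> e - tan m) * (arctan (g \<bullet> e) - m)\<close> a nonnegative function with integral 0.\<close>
lemma du_Bois_Reymond_component:
  assumes g: "integrable M g" and orth: "\<And>h. h \<in> W1_per \<Phi> T \<Longrightarrow> (LINT t|M. g t \<bullet> dot T h t) = 0"
  shows "\<exists>c. AE t in M. g t \<bullet> e = c"
proof -
  define x where "x = (\<lambda>t. g t \<bullet> e)"
  have xi: "integrable M x" unfolding x_def using g by simp
  have xm: "x \<in> borel_measurable M" using xi by simp
  have am: "(\<lambda>t. arctan (x t)) \<in> borel_measurable M"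
    using measurable_compose[OF xm borel_measurable_continuous_onI[of arctan]]
    by (simp add: continuous_intros)
  have ai: "integrable M (\<lambda>t. arctan (x t))"
  proof (rule finite_measure.integrable_const_bound[OF finite_M _ am, where B="pi/2"])
    have "\<bar>arctan (x t)\<bar> \<le> pi/2" for t using arctan_bounded[of "x t"] by linarith
    then show "AE t in M. norm (arctan (x t)) \<le> pi/2" by simp
  qed
  have ci: "integrable M (\<lambda>t. c)" for c :: real using finite_measure.integrable_const[OF finite_M] .
  have cint: "(LINT t|M. c) = T * c" for c :: real using T_pos by (simp add: measure_restrict_space)
  define m where "m = (LINT t|M. arctan (x t)) / T"
  \<comment> \<open>Positive measure makes the comparison of integrals strict. So m stays strictly
    inside the range of \<open>arctan\<close>, and c = tan m satisfies arctan c = m.\<close>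
  have M0: "emeasure M (space M) \<noteq> 0" using T_pos by (simp add: emeasure_restrict_space)
  have "(LINT t|M. arctan (x t)) < (LINT t|M. pi/2)"
    using arctan_ubound by (intro finite_measure.integral_less_AE_space[OF finite_M ai ci _ M0]) auto
  then have m1: "m < pi / 2" using T_pos unfolding cint by (simp add: m_def pos_divide_less_eq mult.commute)
  have "(LINT t|M. - (pi/2)) < (LINT t|M. arctan (x t))"
    using arctan_lbound by (intro finite_measure.integral_less_AE_space[OF finite_M ci ai _ M0]) auto
  then have m2: "- (pi / 2) < m" using T_pos unfolding cint by (simp add: m_def pos_less_divide_eq mult.commute)
  define c where "c = tan m"
  have c: "arctan c = m" unfolding c_def using m1 m2 by (intro arctan_tan) auto
  define q where "q = (\<lambda>t. (arctan (x t) - m) *\<^sub>R e)"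
  have qm: "q \<in> borel_measurable M"
    unfolding q_def using am by (intro borel_measurable_scaleR borel_measurable_diff borel_measurable_const)
  have qB: "norm (q t) \<le> (pi/2 + \<bar>m\<bar>) * norm e" for t
  proof -
    have "\<bar>arctan (x t) - m\<bar> \<le> pi/2 + \<bar>m\<bar>" using arctan_bounded[of "x t"] by linarith
    then show ?thesis unfolding q_def by (simp add: mult_right_mono)
  qed
  \<comment> \<open>Mean zero makes the primitive of q vanish at both ends, so it is an admissible
    periodic test function.\<close>
  have q0: "(LINT t|M. arctan (x t) - m) = 0" using cint[of m] T_pos
    by (subst Bochner_Integration.integral_diff[OF ai ci]) (simp only: m_def, simp)
  define h where "h = (\<lambda>y. integral {0..y} q)"
  note h = bounded_integrable_primitive[OF T_pos qm qB, folded h_def]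
  have hd: "dot T h \<in> Orlicz \<Phi> T"
  proof (rule Orlicz_bounded)
    show "dot T h \<in> borel_measurable M" using abs_continuous_dot(2)[OF T_pos h(1)] by simp
    show "AE t in M. norm (dot T h t) \<le> (pi/2 + \<bar>m\<bar>) * norm e"
      using h(2) by eventually_elim (simp add: qB)
  qed
  have "h T = (LINT t|M. (arctan (x t) - m) *\<^sub>R e)"
    unfolding h_def using h(4) by (simp add: q_def)
  also have "\<dots> = (LINT t|M. arctan (x t) - m) *\<^sub>R e"
    using ai ci by (intro integral_scaleR_left) simp
  finally have "h 0 = 0" "h T = 0" by (simp_all add: q0 h_def)
  then have "h \<in> W1_per \<Phi> T"
    using h(1) hd Orlicz_abs_continuous[OF h(1)] by (simp add: W1_per_def W1_def)
  then have o: "(LINT t|M. g t \<bullet> dot T h t) = 0" by (rule orth)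
  have xq: "integrable M (\<lambda>t. x t * (arctan (x t) - m))"
  proof (rule Bochner_Integration.integrable_bound)
    show "integrable M (\<lambda>t. (pi/2 + \<bar>m\<bar>) * \<bar>x t\<bar>)" using xi by simp
    show "(\<lambda>t. x t * (arctan (x t) - m)) \<in> borel_measurable M"
      using xm am by (intro borel_measurable_times borel_measurable_diff borel_measurable_const)
    have "\<bar>x t * (arctan (x t) - m)\<bar> \<le> (pi/2 + \<bar>m\<bar>) * \<bar>x t\<bar>" for t
    proof -
      have "\<bar>arctan (x t) - m\<bar> \<le> pi/2 + \<bar>m\<bar>" using arctan_bounded[of "x t"] by linarith
      then show ?thesis by (simp add: abs_mult mult.commute mult_left_mono)
    qed
    then show "AE t in M. norm (x t * (arctan (x t) - m)) \<le> norm ((pi/2 + \<bar>m\<bar>) * \<bar>x t\<bar>)"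
      by (intro AE_I2) (simp add: abs_mult)
  qed
  have "AE t in M. x t * (arctan (x t) - m) = g t \<bullet> dot T h t"
    using h(2) by eventually_elim (simp add: q_def x_def mult.commute)
  from integral_lebesgue_on_AE[OF xq _ this] o
  have xq0: "(LINT t|M. x t * (arctan (x t) - m)) = 0" by simp
  define y where "y = (\<lambda>t. (x t - c) * (arctan (x t) - m))"
  have y_eq: "y = (\<lambda>t. x t * (arctan (x t) - m) - c * (arctan (x t) - m))"
    by (simp add: y_def fun_eq_iff algebra_simps)
  have ami: "integrable M (\<lambda>t. arctan (x t) - m)" using ai ci by simp
  have yi: "integrable M y" unfolding y_eq using xq ami by simp
  \<comment> \<open>Orthogonality kills the first integral; the mean-zero property permits
    subtracting c times the second.\<close>
  have "(LINT t|M. y t) = (LINT t|M. x t * (arctan (x t) - m)) - (LINT t|M. c * (arctan (x t) - m))"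
    unfolding y_eq using xq ami by (intro Bochner_Integration.integral_diff integrable_mult_right)
  also have "\<dots> = 0" using xq0 q0 by (simp only: integral_mult_right_zero)
  finally have "(LINT t|M. y t) = 0" .
  moreover have ypos: "0 \<le> y t" for t
    unfolding y_def c[symmetric] using arctan_le_iff[of c "x t"] arctan_le_iff[of "x t" c]
    by (cases "c \<le> x t") (auto intro: mult_nonneg_nonneg mult_nonpos_nonpos)
  ultimately have "AE t in M. y t = 0"
    using integral_nonneg_eq_0_iff_AE[OF yi] by simp
  then have "AE t in M. x t = c"
    by eventually_elim (auto simp: y_def c[symmetric] arctan_eq_iff)
  then show ?thesis unfolding x_def by blast
qed

lemma du_Bois_Reymond:
  assumes g: "integrable M g" and orth: "\<And>h. h \<in> W1_per \<Phi> T \<Longrightarrow> (LINT t|M. g t \<bullet> dot T h t) = 0"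
  obtains c where "AE t in M. g t = c"
proof -
  have "\<exists>c. \<forall>e. AE t in M. g t \<bullet> e = c e"
    using du_Bois_Reymond_component[OF g orth] by (intro choice allI)
  then obtain c where c: "\<And>e. AE t in M. g t \<bullet> e = c e" by blast
  have "AE t in M. \<forall>e\<in>Basis. g t \<bullet> e = c e"
    using c by (subst AE_finite_all) auto
  then have "AE t in M. g t = (\<Sum>e\<in>Basis. c e *\<^sub>R e)"
    by eventually_elim (rule euclidean_eqI, simp)
  with that show thesis by blast
qed

end

lemma symp_J_bounded_linear: "bounded_linear symp_J"
  unfolding linear_conv_bounded_linear[symmetric]
  by (rule linearI) (auto simp: symp_J_def)

lemma symp_J_inner: "symp_J x \<bullet> y = - (x \<bullet> symp_J y)"
  by (simp add: symp_J_def inner_prod_def)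

lemma symp_J_arith:
  "symp_J (x + y) = symp_J x + symp_J y" "symp_J (c *\<^sub>R x) = c *\<^sub>R symp_J x"
  by (auto simp: symp_J_def)

lemma dot_linear_AE:
  fixes f g :: "real \<Rightarrow> 'a::euclidean_space"
  assumes T: "0 < T" and f: "abs_continuous 0 T f" and g: "abs_continuous 0 T g"
  shows "AE t in lebesgue_on {0..T}. dot T (\<lambda>t. f t + s *\<^sub>R g t) t = dot T f t + s *\<^sub>R dot T g t"
  using abs_continuous_dot(1)[OF T f] abs_continuous_dot(1)[OF T g] AE_space
proof eventually_elim
  case (elim t)
  have "((\<lambda>t. f t + s *\<^sub>R g t) has_vector_derivative dot T f t + s *\<^sub>R dot T g t) (at t within {0..T})"
    by (rule has_vector_derivative_add[OF elim(1) bounded_linear.has_vector_derivative[OF bounded_linear_scaleR_right elim(2)]])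
  then show ?case using elim(3) by (intro dot_eq[OF T]) auto
qed

section \<open>The Gateaux derivative of the dual action\<close>

locale symplectic_dual_hamiltonian = dual_hamiltonian G H \<beta> \<gamma> T lam Lam
  for G :: "(real ^ 'n) \<times> (real ^ 'n) \<Rightarrow> real" and H and \<beta> \<gamma> and T lam Lam :: real
begin

lemma W1_perD:
  assumes "h \<in> W1_per \<Phi> T"
  shows "abs_continuous 0 T h" "dot T h \<in> Orlicz \<Phi> T" "h 0 = h T" "h \<in> Orlicz \<Phi> T"
  using assms by (auto simp: W1_per_def W1_def)

lemma integrable_symp_J_inner:
  assumes "integrable M a" "abs_continuous 0 T h"
  shows "integrable M (\<lambda>t. symp_J (a t) \<bullet> h t)"
  using integrable_bounded_linear[OF symp_J_bounded_linear assms(1)] abs_continuous_imp_continuous_on[OF assms(2)]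
  by (rule integrable_inner_continuous)

text \<open>Periodicity of v and h cancels the boundary terms, and skew symmetry of J makes the two
  mixed terms equal after integration. The resulting 2 cancels the factor 1/2 of the action.\<close>

lemma symp_J_by_parts:
  assumes v: "v \<in> W1_per \<Phi> T" and h: "h \<in> W1_per \<Phi> T"
  shows "(LINT t|M. symp_J (dot T h t) \<bullet> v t + symp_J (dot T v t) \<bullet> h t)
    = - 2 * (LINT t|M. symp_J (v t) \<bullet> dot T h t)"
    and "integrable M (\<lambda>t. symp_J (v t) \<bullet> dot T h t)"
proof -
  note vv = W1_perD[OF v] and hh = W1_perD[OF h]
  have Jv: "abs_continuous 0 T (\<lambda>t. symp_J (v t))"
    using vv(1) symp_J_bounded_linear by (rule abs_continuous_linear)
  have ae: "AE t in M. dot T (\<lambda>t. symp_J (v t)) t = symp_J (dot T v t)"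
    using abs_continuous_dot(1)[OF T vv(1)] AE_space
  proof eventually_elim
    case (elim t)
    then show ?case
      using bounded_linear.has_vector_derivative[OF symp_J_bounded_linear elim(1)] by (intro dot_eq[OF T]) auto
  qed
  have i1: "integrable M (\<lambda>t. symp_J (dot T v t) \<bullet> h t)"
    by (intro integrable_symp_J_inner abs_continuous_dot(2)[OF T] vv hh)
  have "integrable M (\<lambda>t. symp_J (dot T h t) \<bullet> v t)"
    by (intro integrable_symp_J_inner abs_continuous_dot(2)[OF T] vv hh)
  moreover have eq: "symp_J (dot T h t) \<bullet> v t = - (symp_J (v t) \<bullet> dot T h t)" for t
    by (simp add: symp_J_inner inner_commute)
  ultimately show i2: "integrable M (\<lambda>t. symp_J (v t) \<bullet> dot T h t)" by simp
  have "AE t in M. dot T (\<lambda>t. symp_J (v t)) t \<bullet> h t + symp_J (v t) \<bullet> dot T h t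
      = symp_J (dot T v t) \<bullet> h t + symp_J (v t) \<bullet> dot T h t"
    using ae by eventually_elim simp
  from integral_lebesgue_on_AE[OF integral_by_parts_abs_continuous(2)[OF T Jv hh(1)] _ this]
  have "(LINT t|M. symp_J (dot T v t) \<bullet> h t + symp_J (v t) \<bullet> dot T h t) = 0"
    using vv(3) hh(3) by (simp add: integral_by_parts_abs_continuous(1)[OF T Jv hh(1)])
  then have "(LINT t|M. symp_J (dot T v t) \<bullet> h t) = - (LINT t|M. symp_J (v t) \<bullet> dot T h t)"
    using i1 i2 by simp
  then show "(LINT t|M. symp_J (dot T h t) \<bullet> v t + symp_J (dot T v t) \<bullet> h t)
    = - 2 * (LINT t|M. symp_J (v t) \<bullet> dot T h t)"
    unfolding eq using i1 i2 by simp
qed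

lemma Luxemburg_nonneg: "u \<in> Orlicz \<Phi> T \<Longrightarrow> 0 \<le> Luxemburg \<Phi> T u"
  using le_Luxemburg[of u 1 0] by (simp add: admissible_def)

context
  fixes v
  assumes v_dom: "v \<in> dual_domain G T lam"
begin

lemma v_per: "v \<in> W1_per \<Phi> T"
  using v_dom by (simp add: dual_domain_def)

lemmas vD = W1_perD[OF v_per]

lemma mu_exists:
  obtains \<mu> where "\<mu> > 1" "integrable M (\<lambda>t. \<Phi> ((\<mu> / lam) *\<^sub>R dot T v t))" "dot T v \<in> borel_measurable M"
  using dist_L_infinity_less[OF vD(2), of lam] v_dom vD(2) by (auto simp: dual_domain_def Orlicz_iff)

definition resid :: "real \<Rightarrow> (real ^ 'n) \<times> (real ^ 'n)" where
  "resid t = gradient (K t) (dot T v t) - symp_J (v t)"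

lemma dual_integrand_integrable: "integrable M (dual_integrand H T v)"
proof -
  obtain \<mu> where mu: "\<mu> > 1" "integrable M (\<lambda>t. \<Phi> ((\<mu> / lam) *\<^sub>R dot T v t))" "dot T v \<in> borel_measurable M"
    by (rule mu_exists)
  have "integrable M (\<lambda>t. symp_J (dot T v t) \<bullet> v t)"
    by (intro integrable_symp_J_inner abs_continuous_dot(2)[OF T] vD)
  then show ?thesis
    unfolding dual_integrand_def using K_integrable[OF mu(3,1,2)] by simp
qed

lemma resid_inner_integrable:
  assumes h: "h \<in> W1_per \<Phi> T"
  shows "integrable M (\<lambda>t. resid t \<bullet> dot T h t)"
    and "(LINT t|M. resid t \<bullet> dot T h t)
      = (LINT t|M. gradient (K t) (dot T v t) \<bullet> dot T h t) - (LINT t|M. symp_J (v t) \<bullet> dot T h t)"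
proof -
  obtain \<mu> where mu: "\<mu> > 1" "integrable M (\<lambda>t. \<Phi> ((\<mu> / lam) *\<^sub>R dot T v t))" "dot T v \<in> borel_measurable M"
    by (rule mu_exists)
  note i = gradient_inner_integrable[OF mu(3,1,2) W1_perD(2)[OF h]] symp_J_by_parts(2)[OF v_per h]
  show "integrable M (\<lambda>t. resid t \<bullet> dot T h t)"
    "(LINT t|M. resid t \<bullet> dot T h t)
      = (LINT t|M. gradient (K t) (dot T v t) \<bullet> dot T h t) - (LINT t|M. symp_J (v t) \<bullet> dot T h t)"
    using i by (simp_all add: resid_def inner_diff_left)
qed

lemma resid_integrable: "integrable M resid"
proof -
  obtain \<mu> where mu: "\<mu> > 1" "integrable M (\<lambda>t. \<Phi> ((\<mu> / lam) *\<^sub>R dot T v t))" "dot T v \<in> borel_measurable M"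
    by (rule mu_exists)
  \<comment> \<open>Constant directions lie in the Orlicz space. Pairing the gradient with basis
    vectors therefore gives its components as integrable functions.\<close>
  have "(\<lambda>t. e) \<in> Orlicz \<Phi> T" for e by (rule Orlicz_bounded[where B="norm e"]) auto
  from gradient_inner_integrable[OF mu(3,1,2) this]
  have "integrable M (\<lambda>t. \<Sum>e\<in>Basis. (gradient (K t) (dot T v t) \<bullet> e) *\<^sub>R e)" by simp
  then have "integrable M (\<lambda>t. gradient (K t) (dot T v t))" by (simp only: euclidean_representation)
  moreover have "integrable M (\<lambda>t. symp_J (v t))"
    by (intro integrable_bounded_linear[OF symp_J_bounded_linear] Orlicz_integrable vD)
  ultimately show ?thesis unfolding resid_def by simp
qed

lemma dual_action_directional:
  assumes h: "h \<in> W1_per \<Phi> T"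
  shows "((\<lambda>s. (dual_action H T (\<lambda>t. v t + s *\<^sub>R h t) - dual_action H T v) / s)
    \<longlongrightarrow> (LINT t|M. resid t \<bullet> dot T h t)) (at 0)"
proof -
  obtain \<mu> where mu: "\<mu> > 1" "integrable M (\<lambda>t. \<Phi> ((\<mu> / lam) *\<^sub>R dot T v t))" "dot T v \<in> borel_measurable M"
    by (rule mu_exists)
  note hD = W1_perD[OF h]
  note kg = K_gateaux[OF mu(3,1,2) hD(2)]
  have i: "integrable M (\<lambda>t. symp_J (dot T v t) \<bullet> v t)" "integrable M (\<lambda>t. symp_J (dot T h t) \<bullet> v t)"
    "integrable M (\<lambda>t. symp_J (dot T v t) \<bullet> h t)" "integrable M (\<lambda>t. symp_J (dot T h t) \<bullet> h t)"
    by (intro integrable_symp_J_inner abs_continuous_dot(2)[OF T] vD hD)+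
  note Ki = K_integrable[OF mu(3,1,2)]
  \<comment> \<open>A, B and C are the coefficients of 1, s and s * s in the quadratic part along v
    + s h. After division by s only B / 2 survives in the limit.\<close>
  define A where "A = (LINT t|M. symp_J (dot T v t) \<bullet> v t)"
  define B where "B = (LINT t|M. symp_J (dot T h t) \<bullet> v t + symp_J (dot T v t) \<bullet> h t)"
  define C where "C = (LINT t|M. symp_J (dot T h t) \<bullet> h t)"
  have base: "dual_action H T v = A / 2 + (LINT t|M. K t (dot T v t))"
    unfolding dual_action_def dual_integrand_def A_def using i(1) Ki by simp
  have shifted: "dual_action H T (\<lambda>t. v t + s *\<^sub>R h t)
      = A / 2 + s * (B / 2) + s * s * (C / 2) + (LINT t|M. K t (dot T v t + s *\<^sub>R dot T h t))"
    if Ks: "integrable M (\<lambda>t. K t (dot T v t + s *\<^sub>R dot T h t))" for s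
  proof -
    define F where "F = (\<lambda>t. 1/2 * (symp_J (dot T v t) \<bullet> v t)
        + s/2 * (symp_J (dot T h t) \<bullet> v t + symp_J (dot T v t) \<bullet> h t)
        + s * s/2 * (symp_J (dot T h t) \<bullet> h t) + K t (dot T v t + s *\<^sub>R dot T h t))"
    have Fi: "integrable M F" unfolding F_def using i Ks by simp
    have "AE t in M. F t = dual_integrand H T (\<lambda>t. v t + s *\<^sub>R h t) t"
      using dot_linear_AE[OF T vD(1) hD(1), of s]
      by eventually_elim
        (simp add: F_def dual_integrand_def symp_J_arith inner_add_left inner_add_right algebra_simps add_divide_distrib)
    from integral_lebesgue_on_AE[OF Fi _ this]
    have "dual_action H T (\<lambda>t. v t + s *\<^sub>R h t) = (LINT t|M. F t)"
      by (simp add: dual_action_def)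
    also have "\<dots> = 1/2 * A + s/2 * B + s * s/2 * C + (LINT t|M. K t (dot T v t + s *\<^sub>R dot T h t))"
      unfolding F_def A_def B_def C_def using i Ks by simp
    finally show ?thesis by simp
  qed
  have "((\<lambda>s. B / 2 + s * (C / 2) + ((LINT t|M. K t (dot T v t + s *\<^sub>R dot T h t)) - (LINT t|M. K t (dot T v t))) / s)
      \<longlongrightarrow> B / 2 + 0 * (C / 2) + (LINT t|M. gradient (K t) (dot T v t) \<bullet> dot T h t)) (at 0)"
    by (intro tendsto_intros kg(2))
  moreover have "\<forall>\<^sub>F s in at 0. B / 2 + s * (C / 2) + ((LINT t|M. K t (dot T v t + s *\<^sub>R dot T h t)) - (LINT t|M. K t (dot T v t))) / s
      = (dual_action H T (\<lambda>t. v t + s *\<^sub>R h t) - dual_action H T v) / s"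
    using kg(1) eventually_neq_at_within[of 0 0 UNIV]
  proof eventually_elim
    case (elim s)
    then show ?case by (simp add: base shifted[OF elim(1)] field_simps)
  qed
  ultimately have "((\<lambda>s. (dual_action H T (\<lambda>t. v t + s *\<^sub>R h t) - dual_action H T v) / s)
      \<longlongrightarrow> B / 2 + 0 * (C / 2) + (LINT t|M. gradient (K t) (dot T v t) \<bullet> dot T h t)) (at 0)"
    by (rule Lim_transform_eventually)
  moreover have "B / 2 = - (LINT t|M. symp_J (v t) \<bullet> dot T h t)"
    unfolding B_def symp_J_by_parts(1)[OF v_per h] by simp
  ultimately show ?thesis by (simp add: resid_inner_integrable(2)[OF h])
qed

lemma dual_action_gateaux:
  "has_gateaux_derivative (dual_action H T) (W1_per \<Phi> T) (W1_norm \<Phi> T) v (\<lambda>h. LINT t|M. resid t \<bullet> dot T h t)"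
  unfolding has_gateaux_derivative_def
proof (intro conjI ballI allI dual_action_directional)
  fix h assume h: "h \<in> W1_per \<Phi> T"
  note hD = W1_perD[OF h] and hi = resid_inner_integrable(1)[OF h]
  \<comment> \<open>Homogeneity comes from the rule for f + s g with f = 0, so the zero function has
    to be known as absolutely continuous with derivative 0.\<close>
  have z: "abs_continuous 0 T (\<lambda>t. 0 :: (real ^ 'n) \<times> (real ^ 'n))"
    by (rule abs_continuous_Lipschitz[where C=0]) simp
  have dz: "AE t in M. dot T (\<lambda>t. 0 :: (real ^ 'n) \<times> (real ^ 'n)) t = 0"
    by (intro AE_I2 dot_eq[OF T]) auto
  show "(LINT t|M. resid t \<bullet> dot T (\<lambda>t. c *\<^sub>R h t) t) = c * (LINT t|M. resid t \<bullet> dot T h t)" for c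
  proof -
    have "AE t in M. c * (resid t \<bullet> dot T h t) = resid t \<bullet> dot T (\<lambda>t. c *\<^sub>R h t) t"
      using dot_linear_AE[OF T z hD(1), of c] dz by eventually_elim simp
    from integral_lebesgue_on_AE[OF _ _ this] hi show ?thesis by simp
  qed
  fix k assume k: "k \<in> W1_per \<Phi> T"
  note kD = W1_perD[OF k] and ki = resid_inner_integrable(1)[OF k]
  have "AE t in M. resid t \<bullet> dot T h t + resid t \<bullet> dot T k t = resid t \<bullet> dot T (\<lambda>t. h t + k t) t"
    using dot_linear_AE[OF T hD(1) kD(1), of 1] by eventually_elim (simp add: inner_add_right)
  from integral_lebesgue_on_AE[OF _ _ this] hi ki
  show "(LINT t|M. resid t \<bullet> dot T (\<lambda>t. h t + k t) t)
      = (LINT t|M. resid t \<bullet> dot T h t) + (LINT t|M. resid t \<bullet> dot T k t)" by simp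
next
  obtain \<mu> where mu: "\<mu> > 1" "integrable M (\<lambda>t. \<Phi> ((\<mu> / lam) *\<^sub>R dot T v t))" "dot T v \<in> borel_measurable M"
    by (rule mu_exists)
  obtain c1 where c1: "c1 > 0" "\<And>b. b \<in> Orlicz \<Phi> T \<Longrightarrow>
      \<bar>LINT t|M. gradient (K t) (dot T v t) \<bullet> b t\<bar> \<le> c1 * Luxemburg \<Phi> T b"
    using gradient_integral_bound[OF mu(3,1,2)] by blast
  obtain c2 where c2: "c2 > 0" "\<And>u. u \<in> Orlicz \<Phi> T \<Longrightarrow> (LINT t|M. norm (u t)) \<le> c2 * Luxemburg \<Phi> T u"
    using integral_norm_le_Luxemburg by blast
  have "continuous_on {0..T} (\<lambda>t. symp_J (v t))"
    by (rule abs_continuous_imp_continuous_on[OF abs_continuous_linear[OF vD(1) symp_J_bounded_linear]])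
  then have "bounded ((\<lambda>t. symp_J (v t)) ` {0..T})" by (intro compact_imp_bounded compact_continuous_image) auto
  then obtain b where b: "\<And>t. t \<in> {0..T} \<Longrightarrow> norm (symp_J (v t)) \<le> b" unfolding bounded_iff by blast
  have b0: "0 \<le> b" using b[of 0] T norm_ge_zero[of "symp_J (v 0)"] by (simp del: norm_ge_zero)
  \<comment> \<open>The constant collects \<open>c1\<close> for the gradient term, the supremum b of
    the norm of J v, and the embedding constant \<open>c2\<close> into L^1.\<close>
  show "\<exists>B. \<forall>h\<in>W1_per \<Phi> T. \<bar>LINT t|M. resid t \<bullet> dot T h t\<bar> \<le> B * W1_norm \<Phi> T h"
  proof (intro exI[of _ "c1 + b * c2"] ballI)
    fix h assume h: "h \<in> W1_per \<Phi> T"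
    note hD = W1_perD[OF h]
    have hi: "integrable M (dot T h)" by (rule abs_continuous_dot(2)[OF T hD(1)])
    have "\<bar>LINT t|M. symp_J (v t) \<bullet> dot T h t\<bar> \<le> (LINT t|M. \<bar>symp_J (v t) \<bullet> dot T h t\<bar>)"
      by (rule integral_abs_bound)
    also have "\<dots> \<le> (LINT t|M. b * norm (dot T h t))"
    proof (rule integral_mono)
      show "integrable M (\<lambda>t. \<bar>symp_J (v t) \<bullet> dot T h t\<bar>)" using symp_J_by_parts(2)[OF v_per h] by simp
      show "integrable M (\<lambda>t. b * norm (dot T h t))" using hi by simp
      fix t assume "t \<in> space M"
      then have "norm (symp_J (v t)) * norm (dot T h t) \<le> b * norm (dot T h t)"
        using b by (intro mult_right_mono) auto
      then show "\<bar>symp_J (v t) \<bullet> dot T h t\<bar> \<le> b * norm (dot T h t)"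
        using Cauchy_Schwarz_ineq2[of "symp_J (v t)" "dot T h t"] by linarith
    qed
    also have "\<dots> = b * (LINT t|M. norm (dot T h t))" by simp
    also have "\<dots> \<le> b * (c2 * Luxemburg \<Phi> T (dot T h))" using c2(2)[OF hD(2)] b0 by (rule mult_left_mono)
    finally have "\<bar>LINT t|M. resid t \<bullet> dot T h t\<bar> \<le> (c1 + b * c2) * Luxemburg \<Phi> T (dot T h)"
      using c1(2)[OF hD(2)] unfolding resid_inner_integrable(2)[OF h] by (simp add: distrib_right)
    also have "\<dots> \<le> (c1 + b * c2) * W1_norm \<Phi> T h"
      using c1(1) c2(1) b0 Luxemburg_nonneg[OF hD(4)] unfolding W1_norm_def by (intro mult_left_mono) auto
    finally show "\<bar>LINT t|M. resid t \<bullet> dot T h t\<bar> \<le> (c1 + b * c2) * W1_norm \<Phi> T h" .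
  qed
qed

end

text \<open>Uniqueness of limits identifies the zero functional with the pairing of
  \<open>resid\<close> and h'. As \<open>resid\<close> is integrable, du Bois-Reymond's lemma
  applies.\<close>

lemma critical_point_resid_const:
  assumes "critical_point G H T lam v"
  obtains c where "AE t in M. resid v t = c"
proof -
  have v: "v \<in> dual_domain G T lam"
    and crit: "has_gateaux_derivative (dual_action H T) (W1_per \<Phi> T) (W1_norm \<Phi> T) v (\<lambda>h. 0)"
    using assms by (auto simp: critical_point_def)
  have "(LINT t|M. resid v t \<bullet> dot T h t) = 0" if h: "h \<in> W1_per \<Phi> T" for h
  proof (rule tendsto_unique[OF _ dual_action_directional[OF v h]])
    show "((\<lambda>s. (dual_action H T (\<lambda>t. v t + s *\<^sub>R h t) - dual_action H T v) / s) \<longlongrightarrow> 0) (at 0)"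
      using crit h unfolding has_gateaux_derivative_def by blast
  qed simp
  from du_Bois_Reymond[OF resid_integrable[OF v] this] show thesis using that by blast
qed

lemma critical_point_solution:
  assumes crit: "critical_point G H T lam v"
    and diff: "\<And>u. G differentiable (at u)" and semi: "semi_symplectic \<Phi>"
  shows "\<exists>u\<in>W1 G T.
               (AE t in M. u t = gradient (K t) (dot T v t)) \<and>
               (AE t in M. u differentiable (at t within {0..T}) \<and>
                  dot T u t = symp_J (gradient (H t) (u t))) \<and>
               u 0 = u T \<and>
               (AE t in M. dot T u t = symp_J (dot T v t))"
proof -
  have v: "v \<in> dual_domain G T lam" using crit by (simp add: critical_point_def)
  note vD = W1_perD[OF v_per[OF v]]
  obtain c where c: "AE t in M. resid v t = c" by (rule critical_point_resid_const[OF crit])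
  define u where "u = (\<lambda>t. symp_J (v t) + c)"
  have uac: "abs_continuous 0 T u"
    unfolding u_def by (rule abs_continuous_add_const[OF abs_continuous_linear[OF vD(1) symp_J_bounded_linear]])
  have ugrad: "AE t in M. u t = gradient (K t) (dot T v t)"
    using c by eventually_elim (auto simp: u_def resid_def[OF v])
  have ud: "AE t in M. (u has_vector_derivative symp_J (dot T v t)) (at t within {0..T})"
    using abs_continuous_dot(1)[OF T vD(1)]
    unfolding u_def
    by eventually_elim (use has_vector_derivative_add[OF bounded_linear.has_vector_derivative[OF symp_J_bounded_linear] has_vector_derivative_const] in fastforce)
  have udot: "AE t in M. dot T u t = symp_J (dot T v t)"
    using ud AE_space by eventually_elim (auto intro: dot_eq[OF T])
  have usol: "AE t in M. u differentiable (at t within {0..T}) \<and> dot T u t = symp_J (gradient (H t) (u t))"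
    using ud udot ugrad AE_space
  proof eventually_elim
    case (elim t)
    have "gradient (H t) (u t) = dot T v t"
      unfolding elim(3) using elim(4) by (intro gradient_eq H_GDERIV) simp
    with elim show ?case by (auto intro: differentiableI_vector)
  qed
  interpret G: young_function G T using G T by (rule young_function_G_function)
  obtain k0 C where k0: "k0 > 0" and C: "\<And>x. convex_conjugate \<Phi> (symp_J x) \<le> \<Phi> (k0 *\<^sub>R x) + C"
    using semi unfolding semi_symplectic_def by blast
  obtain k where k: "k > 0" "integrable M (\<lambda>t. \<Phi> (k *\<^sub>R dot T v t))"
    using vD(2) unfolding Orlicz_iff by blast
  have um: "dot T u \<in> borel_measurable M" using abs_continuous_dot(2)[OF T uac] by simp
  \<comment> \<open>Semi-symplecticity costs the factor \<open>k0\<close> inside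
    \<open>\<Phi>\<close>. Scaling u' by k / k0 leaves exactly the modular of k v', which is known
    to be finite.\<close>
  have "integrable M (\<lambda>t. G ((k / k0) *\<^sub>R dot T u t))"
  proof (rule Bochner_Integration.integrable_bound)
    show "integrable M (\<lambda>t. \<Phi> (k *\<^sub>R dot T v t) + C)"
      using k finite_measure.integrable_const[OF finite_M] by simp
    show "(\<lambda>t. G ((k / k0) *\<^sub>R dot T u t)) \<in> borel_measurable M"
      using um by (intro G.measurable_compose_Phi borel_measurable_scaleR borel_measurable_const)
    show "AE t in M. norm (G ((k / k0) *\<^sub>R dot T u t)) \<le> norm (\<Phi> (k *\<^sub>R dot T v t) + C)"
      using udot
    proof eventually_elim
      case (elim t)
      have "G (symp_J ((k / k0) *\<^sub>R dot T v t)) \<le> convex_conjugate \<Phi> (symp_J ((k / k0) *\<^sub>R dot T v t))"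
        by (intro G_function_le_biconjugate G diff)
      also have "\<dots> \<le> \<Phi> (k0 *\<^sub>R (k / k0) *\<^sub>R dot T v t) + C" by (rule C)
      also have "k0 *\<^sub>R (k / k0) *\<^sub>R dot T v t = k *\<^sub>R dot T v t" using k0 by simp
      finally have "G ((k / k0) *\<^sub>R dot T u t) \<le> \<Phi> (k *\<^sub>R dot T v t) + C" by (simp add: elim symp_J_arith)
      then show ?case using G.nonneg[of "(k / k0) *\<^sub>R dot T u t"] unfolding real_norm_def by linarith
    qed
  qed
  then have "dot T u \<in> Orlicz G T"
    unfolding G.Orlicz_iff using k k0 um by (intro conjI exI[of _ "k / k0"]) auto
  then have "u \<in> W1 G T" using uac G.Orlicz_abs_continuous[OF uac] by (simp add: W1_def)
  moreover have "u 0 = u T" using vD(3) by (simp add: u_def)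
  ultimately show ?thesis using ugrad usol udot by blast
qed

end

theorem theorem4p1:
  fixes T :: real
    and G :: "(real ^ 'n) \<times> (real ^ 'n) \<Rightarrow> real"
    and H :: "real \<Rightarrow> (real ^ 'n) \<times> (real ^ 'n) \<Rightarrow> real"
    and \<beta> \<gamma> :: "real \<Rightarrow> real"
    and lam Lam :: real
  assumes T_pos: "T > 0"
    and G: "G_function G" "\<And>u. G differentiable (at u)" "semi_symplectic (convex_conjugate G)"
    and H_meas: "\<And>u. (\<lambda>t. H t u) \<in> borel_measurable (lebesgue_on {0..T})"
    and H_C1: "\<And>t. t \<in> {0..T} \<Longrightarrow> (\<forall>u. H t differentiable (at u)) \<and> continuous_on UNIV (gradient (H t))"
    and H_Gamma: "\<And>t. t \<in> {0..T} \<Longrightarrow> H t \<in> \<Gamma>"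
    and L1: "integrable (lebesgue_on {0..T}) \<beta>" "integrable (lebesgue_on {0..T}) \<gamma>"
    and lam: "0 < lam" "lam < Lam"
    and H_bounds: "\<And>t u. t \<in> {0..T} \<Longrightarrow>
          G (lam *\<^sub>R u) - \<beta> t \<le> H t u \<and> H t u \<le> G (Lam *\<^sub>R u) + \<gamma> t"
  shows "(\<forall>v\<in>dual_domain G T lam.
            integrable (lebesgue_on {0..T}) (dual_integrand H T v) \<and>
            (\<exists>D. has_gateaux_derivative (dual_action H T) (W1_per (convex_conjugate G) T)
                   (W1_norm (convex_conjugate G) T) v D))
       \<and> (\<forall>v. critical_point G H T lam v \<longrightarrow>
            (\<exists>u\<in>W1 G T.
               (AE t in lebesgue_on {0..T}. u t = gradient (convex_conjugate (H t)) (dot T v t)) \<and>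
               (AE t in lebesgue_on {0..T}. u differentiable (at t within {0..T}) \<and>
                  dot T u t = symp_J (gradient (H t) (u t))) \<and>
               u 0 = u T \<and>
               (AE t in lebesgue_on {0..T}. dot T u t = symp_J (dot T v t))))"
proof -
  interpret symplectic_dual_hamiltonian G H \<beta> \<gamma> T lam Lam
    by unfold_locales (use assms in auto)
  show ?thesis
    using dual_integrand_integrable dual_action_gateaux critical_point_solution[OF _ assms(3,4)] by blast
qed

end
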